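(* Let $1<k<n$, let $\Omega\subset\mathbb R^n$ be a bounded domain, and let $u\in\mathcal{SH}_k(\Omega)$. Then for any ball $B_R\Subset\Omega$ there is a sequence of smooth $H_k$-subharmonic functions $u_j\in C^\infty(B_R)$ converging to $u$ in $B_R$.
   Context: For a $C^2$ function $u$ put $w=\sqrt{1+|Du|^2}$ and $H_k[u]=\sigma_k\big(D(\tfrac{Du}{w})\big)$, where $\sigma_k$ of a matrix is the sum of its principal minors of order $k$ (so $H_k[u]$ is the $k$-th elementary symmetric polynomial of the principal curvatures of the graph of $u$). A $C^2$ function $u$ is $H_k$-subharmonic if $H_j[u]\ge0$ for $j=1,\dots,k$. More generally, an upper semicontinuous function $u:\Omega\to[-\infty,\infty)$ is $H_k$-subharmonic if $\{u=-\infty\}$ has measure zero and, for any open set $\omega\Subset\Omega$ and any $h\in C^2(\overline\omega)$ with $H_k[h]\le0$ in $\omega$ and $h\ge u$ on $\partial\omega$, one has $h\ge u$ in $\omega$ (equivalently, $H_k[u]\ge0$ in the viscosity sense). $\mathcal{SH}_k(\Omega)$ is the set of all $H_k$-subharmonic functions on $\Omega$. *)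

theory Defs
  imports "HOL-Analysis.Analysis"
begin

definition partial_deriv :: "'n::finite \<Rightarrow> (real^'n \<Rightarrow> real) \<Rightarrow> real^'n \<Rightarrow> real" where
  "partial_deriv i f x = frechet_derivative f (at x) (axis i 1)"

definition iter_partial :: "'n::finite list \<Rightarrow> (real^'n \<Rightarrow> real) \<Rightarrow> real^'n \<Rightarrow> real" where
  "iter_partial is f = foldr partial_deriv is f"

text \<open>The classes \<open>C\<^sup>m(S)\<close> and \<open>C\<^sup>\<infinity>(S)\<close>, intended for open \<open>S\<close>.\<close>

definition Cm_on :: "nat \<Rightarrow> (real^'n \<Rightarrow> real) \<Rightarrow> (real^'n::finite) set \<Rightarrow> bool" where
  "Cm_on m f S \<longleftrightarrow>
     (\<forall>is. length is < m \<longrightarrow> (\<forall>x\<in>S. iter_partial is f differentiable (at x))) \<and>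
     (\<forall>is. length is \<le> m \<longrightarrow> continuous_on S (iter_partial is f))"

definition Cinf_on :: "(real^'n \<Rightarrow> real) \<Rightarrow> (real^'n::finite) set \<Rightarrow> bool" where
  "Cinf_on f S \<longleftrightarrow> (\<forall>m. Cm_on m f S)"

text \<open>\<open>C\<^sup>m\<close> of the closure of an open set: all derivatives of order at most \<open>m\<close> extend
  continuously from \<open>S\<close> to its closure, and \<open>f\<close> itself is its own continuous extension (so that
  the values of \<open>f\<close> on the frontier are the boundary values).\<close>

definition Cm_on_closure :: "nat \<Rightarrow> (real^'n \<Rightarrow> real) \<Rightarrow> (real^'n::finite) set \<Rightarrow> bool" where
  "Cm_on_closure m f S \<longleftrightarrow>
     Cm_on m f S \<and> continuous_on (closure S) f \<and>
     (\<forall>is. length is \<le> m \<longrightarrow>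
       (\<exists>g. continuous_on (closure S) g \<and> (\<forall>x\<in>S. g x = iter_partial is f x)))"

definition grad :: "(real^'n \<Rightarrow> real) \<Rightarrow> real^'n \<Rightarrow> real^'n::finite" where
  "grad u x = (\<chi> i. partial_deriv i u x)"

text \<open>Leibniz formula for the determinant of the submatrix of \<open>A\<close> with rows and columns in \<open>S\<close>
  (for \<open>S = UNIV\<close> this is the definition of \<^const>\<open>det\<close>).\<close>

definition principal_minor :: "real^'n^'n \<Rightarrow> 'n::finite set \<Rightarrow> real" where
  "principal_minor A S =
     (\<Sum>p | p permutes S. of_int (sign p) * (\<Prod>i\<in>S. A $ i $ p i))"

definition sigma :: "nat \<Rightarrow> real^'n^'n::finite \<Rightarrow> real" where
  "sigma k A = (\<Sum>S | card S = k. principal_minor A S)"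

definition H_curv :: "nat \<Rightarrow> (real^'n \<Rightarrow> real) \<Rightarrow> real^'n::finite \<Rightarrow> real" where
  "H_curv k u x =
     sigma k (jacobian (\<lambda>y. grad u y /\<^sub>R sqrt (1 + (norm (grad u y))\<^sup>2)) (at x))"

definition C2_H_subharmonic :: "nat \<Rightarrow> (real^'n \<Rightarrow> real) \<Rightarrow> (real^'n::finite) set \<Rightarrow> bool" where
  "C2_H_subharmonic k u \<Omega> \<longleftrightarrow>
     Cm_on 2 u \<Omega> \<and> (\<forall>j\<in>{1..k}. \<forall>x\<in>\<Omega>. H_curv j u x \<ge> 0)"

definition usc_on :: "('a::topological_space) set \<Rightarrow> ('a \<Rightarrow> ereal) \<Rightarrow> bool" where
  "usc_on S u \<longleftrightarrow> (\<forall>c. openin (top_of_set S) {x\<in>S. u x < c})"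

text \<open>The class of \<open>H\<^sub>k\<close>-subharmonic functions on an open set \<open>\<Omega>\<close>, with values in
  \<open>[-\<infinity>, \<infinity>)\<close>. The values of \<open>u\<close> outside \<open>\<Omega>\<close> are irrelevant.\<close>

definition SH :: "nat \<Rightarrow> (real^'n::finite) set \<Rightarrow> (real^'n \<Rightarrow> ereal) set" where
  "SH k \<Omega> = {u.
     (\<forall>x\<in>\<Omega>. u x \<noteq> \<infinity>) \<and> usc_on \<Omega> u \<and> negligible {x\<in>\<Omega>. u x = -\<infinity>} \<and>
     (\<forall>\<omega> h. open \<omega> \<longrightarrow> compact (closure \<omega>) \<longrightarrow> closure \<omega> \<subseteq> \<Omega> \<longrightarrow>
        Cm_on_closure 2 h \<omega> \<longrightarrow> (\<forall>x\<in>\<omega>. H_curv k h x \<le> 0) \<longrightarrow>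
        (\<forall>x\<in>frontier \<omega>. u x \<le> ereal (h x)) \<longrightarrow>
        (\<forall>x\<in>\<omega>. u x \<le> ereal (h x)))}"

end

theory Submission
  imports Defs
begin

text \<open>At each second-order superjet \<open>(p, X)\<close> of an \<open>H\<^sub>k\<close>-subharmonic function the
  eigenvalues of \<open>g\<^sup>-\<^sup>1\<^sup>/\<^sup>2 X g\<^sup>-\<^sup>1\<^sup>/\<^sup>2\<close>, where \<open>g = I + p p\<^sup>T\<close>, lie in the closed Garding cone:
  otherwise a quadratic polynomial would violate the comparison principle. Adding \<open>\<eta> |x - z|\<^sup>2\<close>
  to the sup-convolution \<open>w(x) = max\<^sub>y (u(y) - |x - y|\<^sup>2 / \<epsilon>)\<close> gives a Lipschitz semiconvex
  function \<open>W\<close> whose superjets are strictly admissible, provided \<open>\<eta>\<close> is small against \<open>\<epsilon>\<close>: the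
  superjet of \<open>u\<close> is transported along the linear map that carries the metric at the gradient of
  \<open>w\<close> to the metric at the gradient of \<open>W\<close>.

  The smooth approximation is \<open>V = \<tau> ln (\<rho> * exp (W / \<tau>))\<close>. By duality the cone is an
  intersection of half-spaces, so it suffices that \<open>\<Sum>\<^sub>i a\<^sub>i D\<^sup>2V(b\<^sub>i, b\<^sub>i) \<ge> 0\<close> at each point, for
  \<open>a\<close> in the dual cone and \<open>b\<^sub>i\<close> formed from the gradient \<open>p'\<close> of \<open>V\<close> there. Up to a linear
  function in the exponent, \<open>exp (W / \<tau>)\<close> is a viscosity subsolution of this constant-coefficient
  equation, and such subsolutions are preserved by convolution. It is a subsolution because the
  terms \<open>(b\<^sub>i \<bullet> (p - p'))\<^sup>2 / \<tau>\<close> produced by the exponential compensate, for small \<open>\<tau>\<close>, the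
  dependence of the admissibility condition on \<open>p\<close>; this is a compactness argument.\<close>

section \<open>The Garding cone\<close>

text \<open>Direct mollification fails because admissibility of a jet \<open>(p, X)\<close> is
  convex in \<open>X\<close> for fixed \<open>p\<close> but not jointly, so averaging jets with
  different gradients may leave the admissible set. The exponential average adds the covariance of
  these gradients to the Hessian, with the same weights \<open>a\<close> and vectors
  \<open>b\<close> as in the inequality to be proved. It controls \<open>p - p'\<close> only where
  \<open>a\<close> is not small; elsewhere the error carries the small weight as well, and only the
  products of \<open>sqrt (a $ i)\<close> with \<open>(p - p') \<bullet> b i\<close> have to be
  small. Strictness absorbs what is left, and semiconvexity of the sup-convolution keeps the Hessian
  part from outweighing the gain.

  That convolution preserves linear subsolutions is shown without differentiability almost
  everywhere: a subsolution lies below its evolution under repeated averaging over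
  \<open>x + h b\<close> and \<open>x - h b\<close>, and this averaging is monotone and commutes
  with convolution.

  Test functions in \<open>SH\<close> are constrained by \<open>H_curv k\<close> alone. An
  inadmissible Hessian must therefore be raised to one with negative \<open>sigma k\<close>, which
  is what the order description of the cone provides.\<close>

definition esym :: "nat \<Rightarrow> 'a set \<Rightarrow> ('a \<Rightarrow> real) \<Rightarrow> real" where
  "esym k S x = (\<Sum>T | T \<subseteq> S \<and> card T = k. \<Prod>i\<in>T. x i)"

lemma esym_0: "finite S \<Longrightarrow> esym 0 S x = 1"
proof -
  assume "finite S"
  then have "{T. T \<subseteq> S \<and> card T = 0} = {{}}"
    by (auto dest: finite_subset)
  then show ?thesis by (simp add: esym_def)
qed

lemma esym_cong: "(\<And>i. i \<in> S \<Longrightarrow> x i = y i) \<Longrightarrow> esym k S x = esym k S y"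
  unfolding esym_def by (intro sum.cong refl prod.cong) auto

lemma esym_insert:
  assumes "finite S" "i \<notin> S"
  shows "esym (Suc k) (insert i S) x = esym (Suc k) S x + x i * esym k S x"
proof -
  let ?A = "{T. T \<subseteq> S \<and> card T = Suc k}" and ?B = "{T. T \<subseteq> S \<and> card T = k}"
  have fin: "finite ?A" "finite ?B" using assms(1) by auto
  have dec: "{T. T \<subseteq> insert i S \<and> card T = Suc k} = ?A \<union> insert i ` ?B" (is "?L = ?R")
  proof (rule set_eqI, rule iffI)
    fix T assume T: "T \<in> ?L"
    then have fT: "finite T" using assms(1) by (auto dest: finite_subset)
    show "T \<in> ?R"
    proof (cases "i \<in> T")
      case True
      then have "T = insert i (T - {i})" "T - {i} \<subseteq> S" "card (T - {i}) = k"
        using T fT by auto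
      then show ?thesis by blast
    next
      case False
      then show ?thesis using T by auto
    qed
  next
    fix T assume "T \<in> ?R"
    then show "T \<in> ?L"
    proof
      assume "T \<in> insert i ` ?B"
      then obtain U where U: "T = insert i U" "U \<subseteq> S" "card U = k" by auto
      have "finite U" using U(2) assms(1) finite_subset by blast
      moreover have "i \<notin> U" using U assms by auto
      ultimately show ?thesis using U by auto
    qed auto
  qed
  have disj: "?A \<inter> insert i ` ?B = {}" using assms(2) by auto
  have inj: "inj_on (insert i) ?B"
    using assms(2) by (auto simp: inj_on_def)
  have "(\<Sum>T\<in>insert i ` ?B. \<Prod>j\<in>T. x j) = (\<Sum>T\<in>?B. \<Prod>j\<in>insert i T. x j)"
    by (rule sum.reindex_cong[OF inj refl]) simp
  also have "\<dots> = (\<Sum>T\<in>?B. x i * (\<Prod>j\<in>T. x j))"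
  proof (rule sum.cong[OF refl])
    fix T assume "T \<in> ?B"
    then have "finite T" "i \<notin> T" using assms by (auto dest: finite_subset)
    then show "(\<Prod>j\<in>insert i T. x j) = x i * (\<Prod>j\<in>T. x j)" by simp
  qed
  also have "\<dots> = x i * esym k S x" by (simp add: esym_def sum_distrib_left)
  finally have "(\<Sum>T\<in>insert i ` ?B. \<Prod>j\<in>T. x j) = x i * esym k S x" .
  then show ?thesis
    unfolding esym_def dec using fin disj by (simp add: sum.union_disjoint)
qed

lemma esym_split:
  assumes "finite S" "i \<in> S"
  shows "esym (Suc k) S x = esym (Suc k) (S - {i}) x + x i * esym k (S - {i}) x"
  using esym_insert[of "S - {i}" i k x] assms by (simp add: insert_absorb)

text \<open>Euler's relation for a homogeneous polynomial of degree \<open>Suc k\<close>: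
  \<open>esym k (S - {i})\<close> is the partial derivative of \<open>esym (Suc k) S\<close> in
  \<open>x i\<close>.\<close>

lemma esym_euler:
  assumes "finite S"
  shows "(\<Sum>i\<in>S. x i * esym k (S - {i}) x) = real (Suc k) * esym (Suc k) S x"
  using assms
proof (induction S arbitrary: k)
  case empty
  then show ?case by (simp add: esym_def)
next
  case (insert a S)
  have *: "esym k (insert a S - {i}) x = (if k = 0 then 1 else esym k (S - {i}) x + x a * esym (k - 1) (S - {i}) x)"
    if "i \<in> S" for i
  proof (cases k)
    case 0 then show ?thesis using insert by (simp add: esym_0)
  next
    case (Suc l)
    have "insert a S - {i} = insert a (S - {i})" using that insert by auto
    then show ?thesis using Suc insert esym_insert[of "S - {i}" a l x] by simp
  qed
  have "(\<Sum>i\<in>insert a S. x i * esym k (insert a S - {i}) x)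
     = x a * esym k S x + (\<Sum>i\<in>S. x i * esym k (insert a S - {i}) x)"
    using insert by simp
  also have "\<dots> = real (Suc k) * esym (Suc k) (insert a S) x"
  proof (cases k)
    case 0
    have "(\<Sum>i\<in>S. x i * esym k (insert a S - {i}) x) = (\<Sum>i\<in>S. x i * esym 0 (S - {i}) x)"
      using 0 insert by (intro sum.cong) (auto simp: esym_0)
    moreover have "sum x S = esym (Suc 0) S x"
      using insert.IH[of 0] insert.hyps by (simp add: esym_0)
    ultimately show ?thesis using 0 insert.hyps by (simp add: esym_insert esym_0)
  next
    case (Suc l)
    have "(\<Sum>i\<in>S. x i * esym k (insert a S - {i}) x)
       = (\<Sum>i\<in>S. x i * esym k (S - {i}) x) + x a * (\<Sum>i\<in>S. x i * esym l (S - {i}) x)"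
      unfolding sum_distrib_left sum.distrib[symmetric]
      by (intro sum.cong refl) (simp add: *[unfolded Suc] Suc algebra_simps)
    then show ?thesis using Suc insert by (simp add: esym_insert algebra_simps)
  qed
  finally show ?case .
qed

text \<open>Each \<open>k\<close>-subset of \<open>S\<close> misses exactly
  \<open>card S - k\<close> indices. This is how signs pass from the sets \<open>S - {i}\<close> to
  \<open>S\<close>.\<close>

lemma esym_count:
  assumes "finite S" "k \<le> card S"
  shows "(\<Sum>i\<in>S. esym k (S - {i}) x) = real (card S - k) * esym k S x"
proof (cases k)
  case 0
  then show ?thesis using assms by (simp add: esym_0)
next
  case (Suc l)
  have "(\<Sum>i\<in>S. esym k S x) = (\<Sum>i\<in>S. esym k (S - {i}) x + x i * esym l (S - {i}) x)"
    using esym_split[OF assms(1)] Suc by (intro sum.cong) auto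
  also have "\<dots> = (\<Sum>i\<in>S. esym k (S - {i}) x) + real k * esym k S x"
    using esym_euler[OF assms(1), of x l] Suc by (simp add: sum.distrib)
  finally have "real (card S) * esym k S x = (\<Sum>i\<in>S. esym k (S - {i}) x) + real k * esym k S x"
    by simp
  then show ?thesis using assms by (simp add: of_nat_diff algebra_simps)
qed

lemma tendsto_esym:
  assumes "\<And>i. i \<in> S \<Longrightarrow> ((\<lambda>t. x t i) \<longlongrightarrow> y i) F"
  shows "((\<lambda>t. esym k S (x t)) \<longlongrightarrow> esym k S y) F"
  unfolding esym_def by (intro tendsto_intros) (use assms in auto)

lemma esym_scale: "esym k S (\<lambda>i. t * x i) = t ^ k * esym k S x"
proof -
  have "esym k S (\<lambda>i. t * x i) = (\<Sum>T | T \<subseteq> S \<and> card T = k. t ^ k * (\<Prod>i\<in>T. x i))"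
    unfolding esym_def by (intro sum.cong refl) (auto simp: prod.distrib)
  then show ?thesis by (simp add: esym_def sum_distrib_left)
qed

text \<open>The closed Garding cone, described by the order instead of by \<open>e\<^sub>1, \<dots>, e\<^sub>k \<ge> 0\<close>:
  this makes the passage to subsets of the coordinates and the comparison principle immediate.\<close>

definition gcone :: "nat \<Rightarrow> 'a set \<Rightarrow> ('a \<Rightarrow> real) set" where
  "gcone k S = {x. \<forall>y. (\<forall>i\<in>S. x i < y i) \<longrightarrow> 0 \<le> esym k S y}"

lemma gcone_mono: "x \<in> gcone k S \<Longrightarrow> (\<And>i. i \<in> S \<Longrightarrow> x i \<le> y i) \<Longrightarrow> y \<in> gcone k S"
  unfolding gcone_def by (auto intro: order.strict_trans1)

lemma linear_bound_nonneg:
  fixes a b :: real assumes "\<And>t. t > 0 \<Longrightarrow> a + t * b \<ge> 0" shows "b \<ge> 0"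
proof (rule ccontr)
  assume "\<not> b \<ge> 0"
  then have b: "b < 0" by simp
  let ?t = "(\<bar>a\<bar> + 1) / (- b)"
  have "?t > 0" using b by (simp add: divide_simps)
  moreover have "?t * b = - (\<bar>a\<bar> + 1)" using b by (simp add: field_simps)
  ultimately show False using assms[of ?t] by linarith
qed

text \<open>The cone is closed under raising a coordinate, so coordinate \<open>i\<close> may tend
  to infinity. \<open>esym (Suc k) S\<close> is affine in it with slope
  \<open>esym k (S - {i})\<close>, and a negative slope would eventually make it negative.\<close>

lemma gcone_remove:
  assumes "finite S" "i \<in> S" "x \<in> gcone (Suc k) S"
  shows "x \<in> gcone k (S - {i})"
  unfolding gcone_def mem_Collect_eq
proof (intro allI impI)
  fix y assume y: "\<forall>j\<in>S - {i}. x j < y j"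
  show "0 \<le> esym k (S - {i}) y"
  proof (rule linear_bound_nonneg)
    fix t :: real assume t: "t > 0"
    let ?y = "y(i := x i + t)"
    have c: "esym m (S - {i}) ?y = esym m (S - {i}) y" for m
      by (rule esym_cong) auto
    have "0 \<le> esym (Suc k) S ?y"
      using assms(3) y t unfolding gcone_def by auto
    also have "\<dots> = (esym (Suc k) (S - {i}) y + x i * esym k (S - {i}) y) + t * esym k (S - {i}) y"
      using esym_split[OF assms(1,2), of k ?y] by (simp add: c distrib_right)
    finally show "0 \<le> (esym (Suc k) (S - {i}) y + x i * esym k (S - {i}) y) + t * esym k (S - {i}) y" .
  qed
qed

lemma gcone_Suc_subset:
  assumes "finite S" "Suc k \<le> card S" "x \<in> gcone (Suc k) S"
  shows "x \<in> gcone k S"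
  unfolding gcone_def mem_Collect_eq
proof (intro allI impI)
  fix y assume y: "\<forall>j\<in>S. x j < y j"
  have "0 \<le> (\<Sum>i\<in>S. esym k (S - {i}) y)"
    using gcone_remove[OF assms(1) _ assms(3)] y by (intro sum_nonneg) (auto simp: gcone_def)
  then have "0 \<le> real (card S - k) * esym k S y"
    using esym_count[OF assms(1), of k y] assms(2) by simp
  then show "0 \<le> esym k S y"
    using assms(2) by (simp add: zero_le_mult_iff)
qed

lemma gcone_subset:
  assumes "finite S" "k \<le> card S" "x \<in> gcone k S" "j \<le> k"
  shows "x \<in> gcone j S"
  using assms(4) assms(2,3)
proof (induction "k - j" arbitrary: k)
  case 0 then show ?case by simp
next
  case (Suc m)
  then obtain k' where k': "k = Suc k'" by (cases k) auto
  then show ?case using Suc(1)[of k'] Suc(2-) gcone_Suc_subset[OF assms(1), of k' x] by auto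
qed

lemma gcone_nonneg:
  assumes "x \<in> gcone k S"
  shows "0 \<le> esym k S x"
proof -
  have "((\<lambda>t. esym k S (\<lambda>i. x i + t)) \<longlongrightarrow> esym k S (\<lambda>i. x i + 0)) (at_right 0)"
    by (intro tendsto_esym tendsto_intros)
  moreover have "\<forall>\<^sub>F t in at_right (0::real). 0 \<le> esym k S (\<lambda>i. x i + t)"
    unfolding eventually_at_right_field
    using assms by (auto simp: gcone_def intro!: exI[of _ 1])
  ultimately show ?thesis
    using tendsto_lowerbound by fastforce
qed

lemma gcone_esym_nonneg:
  assumes "finite S" "k \<le> card S" "x \<in> gcone k S" "j \<le> k"
  shows "0 \<le> esym j S x"
  using gcone_nonneg[OF gcone_subset[OF assms]] .

text \<open>Makes positivity inside the cone quantitative. Raising all coordinates except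
  \<open>a\<close> keeps the point in the cone; raising \<open>a\<close> as well then adds
  \<open>t * esym l S\<close>, to which the induction hypothesis applies.\<close>

lemma esym_shift_ge:
  assumes "finite S" "k \<le> card S" "x \<in> gcone k S" "t \<ge> 0"
  shows "t ^ k \<le> esym k S (\<lambda>i. x i + t)"
  using assms
proof (induction S arbitrary: k)
  case empty
  then show ?case by (simp add: esym_0)
next
  case (insert a S)
  show ?case
  proof (cases k)
    case 0 then show ?thesis using insert by (simp add: esym_0)
  next
    case (Suc l)
    have mono: "(\<lambda>i. if i = a then x i else x i + t) \<in> gcone k (insert a S)"
      by (rule gcone_mono[OF insert.prems(2)]) (use insert in auto)
    have xl: "x \<in> gcone l S"
      using gcone_remove[of "insert a S" a x l] insert Suc by simp
    have "0 \<le> esym k (insert a S) (\<lambda>i. if i = a then x i else x i + t)"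
      by (rule gcone_nonneg[OF mono])
    also have "\<dots> = esym k S (\<lambda>i. if i = a then x i else x i + t) + x a * esym l S (\<lambda>i. if i = a then x i else x i + t)"
      using insert Suc by (simp add: esym_insert)
    also have "\<dots> = esym k S (\<lambda>i. x i + t) + x a * esym l S (\<lambda>i. x i + t)"
      using insert by (intro arg_cong2[where f="(+)"] arg_cong2[where f="(*)"] esym_cong refl) auto
    finally have "t * esym l S (\<lambda>i. x i + t) \<le> esym k (insert a S) (\<lambda>i. x i + t)"
      using insert Suc by (simp add: esym_insert algebra_simps)
    moreover have "t ^ l \<le> esym l S (\<lambda>i. x i + t)"
      using insert.IH[of l] xl insert Suc by simp
    then have "t ^ k \<le> t * esym l S (\<lambda>i. x i + t)"
      using insert.prems Suc by (simp add: mult_left_mono)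
    ultimately show ?thesis by linarith
  qed
qed

text \<open>The interior of the cone for finite \<open>S\<close>: since the cone is closed under
  raising coordinates, a point is interior iff it stays inside when some positive constant is
  subtracted everywhere. The same \<open>t\<close> survives the removal of a coordinate and the
  lowering of the order.\<close>

definition gcone_int :: "nat \<Rightarrow> 'a set \<Rightarrow> ('a \<Rightarrow> real) set" where
  "gcone_int k S = {x. \<exists>t>0. (\<lambda>i. x i - t) \<in> gcone k S}"

lemma gcone_int_pos:
  assumes "finite S" "k \<le> card S" "x \<in> gcone_int k S"
  shows "0 < esym k S x"
proof -
  obtain t where t: "t > 0" "(\<lambda>i. x i - t) \<in> gcone k S" using assms by (auto simp: gcone_int_def)
  have "0 < t ^ k" using t by simp
  also have "\<dots> \<le> esym k S x" using esym_shift_ge[OF assms(1,2) t(2), of t] t by simp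
  finally show ?thesis .
qed

lemma gcone_int_remove:
  assumes "finite S" "i \<in> S" "x \<in> gcone_int (Suc k) S"
  shows "x \<in> gcone_int k (S - {i})"
  using assms gcone_remove[OF assms(1,2)] by (auto simp: gcone_int_def)

lemma gcone_int_Suc_subset:
  assumes "finite S" "Suc k \<le> card S" "x \<in> gcone_int (Suc k) S"
  shows "x \<in> gcone_int k S"
  using assms gcone_Suc_subset[OF assms(1,2)] by (auto simp: gcone_int_def)

text \<open>Subadditivity of the convex, homogeneous function \<open>a\<^sup>2 / s\<close>; a larger
  denominator on the left only helps.\<close>

lemma sq_div_subadd:
  fixes a b s t :: real
  assumes "s > 0" "t > 0" "s + t \<le> r"
  shows "(a + b)\<^sup>2 / r \<le> a\<^sup>2 / s + b\<^sup>2 / t"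
proof -
  have "(a + b)\<^sup>2 / r \<le> (a + b)\<^sup>2 / (s + t)"
    using assms by (intro divide_left_mono) auto
  also have "\<dots> \<le> a\<^sup>2 / s + b\<^sup>2 / t"
  proof -
    have "0 \<le> (a * t - b * s)\<^sup>2 / (s * t * (s + t))" using assms by simp
    also have "\<dots> = a\<^sup>2 / s + b\<^sup>2 / t - (a + b)\<^sup>2 / (s + t)"
      using assms by (simp add: field_simps power2_eq_square)
    finally show ?thesis by simp
  qed
  finally show ?thesis .
qed

text \<open>The recursion behind Marcus--Lopes: the quotient is a linear term minus terms
  \<open>a\<^sup>2 / s\<close> whose denominators contain the quotients of one order less on
  \<open>S - {i}\<close>. By \<open>sq_div_subadd\<close>, superadditive denominators give a
  superadditive quotient.\<close>

lemma esym_quotient_formula: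
  assumes S: "finite S" and k: "0 < esym (Suc k) S x" and kk: "\<And>i. i \<in> S \<Longrightarrow> 0 < esym k (S - {i}) x"
  shows "real (Suc (Suc k)) * (esym (Suc (Suc k)) S x / esym (Suc k) S x)
    = (\<Sum>i\<in>S. x i - (x i)\<^sup>2 / (x i + esym (Suc k) (S - {i}) x / esym k (S - {i}) x))"
proof -
  have "real (Suc (Suc k)) * (esym (Suc (Suc k)) S x / esym (Suc k) S x)
      = (\<Sum>i\<in>S. x i * esym (Suc k) (S - {i}) x / esym (Suc k) S x)"
    using esym_euler[OF S, of x "Suc k"] by (simp add: sum_divide_distrib[symmetric])
  also have "\<dots> = (\<Sum>i\<in>S. x i - (x i)\<^sup>2 / (x i + esym (Suc k) (S - {i}) x / esym k (S - {i}) x))"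
  proof (rule sum.cong[OF refl])
    fix i assume i: "i \<in> S"
    let ?E = "esym (Suc k) (S - {i}) x" and ?e = "esym k (S - {i}) x"
    have e: "?e > 0" by (rule kk[OF i])
    have s: "esym (Suc k) S x = ?E + x i * ?e" by (rule esym_split[OF S i])
    have "x i + ?E / ?e = esym (Suc k) S x / ?e" using e s by (simp add: field_simps)
    then have "x i - (x i)\<^sup>2 / (x i + ?E / ?e) = x i - (x i)\<^sup>2 * ?e / esym (Suc k) S x" by simp
    also have "\<dots> = (x i * esym (Suc k) S x - (x i)\<^sup>2 * ?e) / esym (Suc k) S x"
      using k by (simp add: diff_divide_distrib)
    also have "\<dots> = x i * ?E / esym (Suc k) S x"
      by (simp add: s algebra_simps power2_eq_square)
    finally show "x i * ?E / esym (Suc k) S x = x i - (x i)\<^sup>2 / (x i + ?E / ?e)" by simp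
  qed
  finally show ?thesis .
qed

text \<open>Marcus--Lopes: the quotient \<open>e\<^sub>k\<^sub>+\<^sub>1 / e\<^sub>k\<close> is superadditive on the open Garding cone.\<close>

lemma esym_quotient_superadditive:
  assumes "finite S" "Suc k \<le> card S" "x \<in> gcone_int (Suc k) S" "y \<in> gcone_int (Suc k) S"
  shows "esym (Suc k) S x / esym k S x + esym (Suc k) S y / esym k S y
      \<le> esym (Suc k) S (\<lambda>i. x i + y i) / esym k S (\<lambda>i. x i + y i)
    \<and> 0 < esym k S (\<lambda>i. x i + y i) \<and> 0 < esym (Suc k) S (\<lambda>i. x i + y i)"
  using assms
proof (induction k arbitrary: S)
  case 0
  have "esym (Suc 0) S z = sum z S" for z
    using esym_euler[OF 0(1), of z 0] 0(1) by (simp add: esym_0)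
  moreover have "0 < esym (Suc 0) S x" "0 < esym (Suc 0) S y"
    using gcone_int_pos 0 by blast+
  ultimately show ?case using 0 by (simp add: esym_0 sum.distrib)
next
  case (Suc k)
  note S = Suc.prems(1)
  let ?z = "\<lambda>i. x i + y i"
  have int: "x \<in> gcone_int (Suc k) S" "y \<in> gcone_int (Suc k) S"
    using gcone_int_Suc_subset[OF S] Suc.prems by auto
  have pos: "0 < esym (Suc k) S x" "0 < esym (Suc k) S y"
    "0 < esym (Suc (Suc k)) S x" "0 < esym (Suc (Suc k)) S y"
    using gcone_int_pos[OF S] int Suc.prems by auto
  \<comment> \<open>The denominator at \<open>?z\<close> must be known to be positive before the
    formula applies there; this is why positivity is carried along in the statement being proved by
    induction.\<close>
  have z: "0 < esym (Suc k) S ?z" using Suc.IH[OF S _ int] Suc.prems by auto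
  { fix i assume i: "i \<in> S"
    have r: "x \<in> gcone_int (Suc k) (S - {i})" "y \<in> gcone_int (Suc k) (S - {i})"
      using gcone_int_remove[OF S i] Suc.prems by auto
    have c: "Suc k \<le> card (S - {i})" using Suc.prems i by simp
    have r': "x \<in> gcone_int k (S - {i})" "y \<in> gcone_int k (S - {i})"
      using gcone_int_Suc_subset[OF _ c] r S by auto
    note Suc.IH[OF _ c r] gcone_int_pos[OF _ _ r(1)] gcone_int_pos[OF _ _ r(2)]
      gcone_int_pos[OF _ _ r'(1)] gcone_int_pos[OF _ _ r'(2)]
  } note sub = this
  have xk: "0 < esym k (S - {i}) x" "0 < esym k (S - {i}) y" "0 < esym k (S - {i}) ?z"
    if "i \<in> S" for i using sub[OF that] S Suc.prems that by auto
  let ?f = "\<lambda>w i. w i + esym (Suc k) (S - {i}) w / esym k (S - {i}) w"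
  have fpos: "?f x i > 0" "?f y i > 0" if i: "i \<in> S" for i
  proof -
    have "?f x i = esym (Suc k) S x / esym k (S - {i}) x" "?f y i = esym (Suc k) S y / esym k (S - {i}) y"
      using esym_split[OF S i] xk[OF i] by (auto simp: field_simps)
    then show "?f x i > 0" "?f y i > 0" using xk[OF i] pos by auto
  qed
  have fsup: "?f x i + ?f y i \<le> ?f ?z i" if i: "i \<in> S" for i
    using sub(1)[OF i] S by auto
  have "real (Suc (Suc k)) * (esym (Suc (Suc k)) S x / esym (Suc k) S x + esym (Suc (Suc k)) S y / esym (Suc k) S y)
     = (\<Sum>i\<in>S. (x i + y i) - ((x i)\<^sup>2 / ?f x i + (y i)\<^sup>2 / ?f y i))"
    using esym_quotient_formula[OF S pos(1) xk(1)] esym_quotient_formula[OF S pos(2) xk(2)]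
    by (simp only: distrib_left sum.distrib[symmetric]) (simp add: algebra_simps)
  also have "\<dots> \<le> (\<Sum>i\<in>S. (x i + y i) - (x i + y i)\<^sup>2 / ?f ?z i)"
    using sq_div_subadd fpos fsup by (intro sum_mono diff_left_mono) blast
  also have "\<dots> = real (Suc (Suc k)) * (esym (Suc (Suc k)) S ?z / esym (Suc k) S ?z)"
    by (rule esym_quotient_formula[OF S z xk(3), symmetric])
  finally have main: "esym (Suc (Suc k)) S x / esym (Suc k) S x + esym (Suc (Suc k)) S y / esym (Suc k) S y
     \<le> esym (Suc (Suc k)) S ?z / esym (Suc k) S ?z"
    by (rule mult_left_le_imp_le) simp
  have "0 < esym (Suc (Suc k)) S x / esym (Suc k) S x + esym (Suc (Suc k)) S y / esym (Suc k) S y"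
    using pos by (simp add: add_pos_pos)
  then have "0 < esym (Suc (Suc k)) S ?z / esym (Suc k) S ?z" using main by linarith
  then have "0 < esym (Suc (Suc k)) S ?z" using z by (simp add: zero_less_divide_iff)
  with main z show ?case by blast
qed

lemma gcone_add:
  assumes "finite S" "k \<le> card S" "x \<in> gcone k S" "y \<in> gcone k S"
  shows "(\<lambda>i. x i + y i) \<in> gcone k S"
proof (cases k)
  case 0 then show ?thesis using assms by (simp add: gcone_def esym_0)
next
  case (Suc l)
  show ?thesis unfolding gcone_def mem_Collect_eq
  proof (intro allI impI)
    fix z assume z: "\<forall>i\<in>S. x i + y i < z i"
    have "S \<noteq> {}" using assms Suc by auto
    \<comment> \<open>With a slack of \<open>2 * t\<close> in every coordinate, \<open>z\<close>
      splits into \<open>?x\<close> and \<open>?y\<close>, which exceed \<open>x\<close> and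
      \<open>y\<close> by at least \<open>t\<close> and so lie in the interior, where
      superadditivity is available.\<close>
    define t where "t = Min ((\<lambda>i. z i - (x i + y i)) ` S) / 2"
    have t: "t > 0" using z assms(1) \<open>S \<noteq> {}\<close> by (auto simp: t_def)
    have t2: "2 * t \<le> z i - (x i + y i)" if "i \<in> S" for i
      using assms(1) that by (auto simp: t_def)
    let ?x = "\<lambda>i. z i - y i - t" and ?y = "\<lambda>i. y i + t"
    have "(\<lambda>i. ?x i - t) \<in> gcone k S" "(\<lambda>i. ?y i - t) \<in> gcone k S"
      using assms(4) t2 by (auto intro!: gcone_mono[OF assms(3)]) fastforce
    then have "?x \<in> gcone_int k S" "?y \<in> gcone_int k S"
      using t unfolding gcone_int_def by blast+
    then have "0 < esym k S (\<lambda>i. ?x i + ?y i)"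
      using esym_quotient_superadditive[OF assms(1)] assms(2) Suc by blast
    then show "0 \<le> esym k S z" by simp
  qed
qed

section \<open>Diagonalisation of symmetric forms\<close>

definition qform :: "real^'n^'n \<Rightarrow> real^'n::finite \<Rightarrow> real" where
  "qform X v = v \<bullet> (X *v v)"

text \<open>Orthonormal bases are stored as the rows of a matrix, so that extremal problems over
  bases become extremal problems over a compact set.\<close>

definition frames :: "(real^'n^'n::finite) set" where
  "frames = {q. \<forall>i j. q $ i \<bullet> q $ j = (if i = j then 1 else 0)}"

lemma frames_orthogonal: "q \<in> frames \<longleftrightarrow> q ** transpose q = mat 1"
  by (auto simp: frames_def vec_eq_iff matrix_matrix_mult_def transpose_def mat_def inner_vec_def)

lemma frames_orthogonal': "q \<in> frames \<Longrightarrow> transpose q ** q = mat 1"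
  using frames_orthogonal matrix_left_right_inverse by blast

lemma frames_inner: "q \<in> frames \<Longrightarrow> q $ i \<bullet> q $ j = (if i = j then 1 else 0)"
  by (simp add: frames_def)

lemma frames_norm: "q \<in> frames \<Longrightarrow> norm (q $ i) = 1"
  by (simp add: frames_inner norm_eq_sqrt_inner)

lemma frames_expand:
  assumes "q \<in> frames"
  shows "(\<Sum>i\<in>UNIV. (q $ i \<bullet> v) *\<^sub>R q $ i) = v"
proof -
  have "v = (transpose q ** q) *v v" using frames_orthogonal'[OF assms] by simp
  also have "\<dots> = transpose q *v (q *v v)" by (simp add: matrix_vector_mul_assoc)
  also have "\<dots> = (\<Sum>i\<in>UNIV. (q $ i \<bullet> v) *\<^sub>R q $ i)"
    by (simp add: vec_eq_iff matrix_vector_mult_def transpose_def inner_vec_def mult.commute)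
  finally show ?thesis by simp
qed

lemma frames_parseval:
  assumes "q \<in> frames"
  shows "(\<Sum>i\<in>UNIV. (q $ i \<bullet> u) * (q $ i \<bullet> v)) = u \<bullet> v"
proof -
  have "u \<bullet> v = (\<Sum>i\<in>UNIV. (q $ i \<bullet> u) *\<^sub>R q $ i) \<bullet> v" using frames_expand[OF assms] by simp
  then show ?thesis by (simp add: inner_sum_left)
qed

lemma frames_columns:
  assumes "q \<in> frames"
  shows "(\<Sum>i\<in>UNIV. q $ i $ k * q $ i $ l) = (if k = l then 1 else 0)"
  using frames_parseval[OF assms, of "axis k 1" "axis l 1"]
  by (simp add: inner_axis inner_axis_axis) (simp add: axis_def)

lemma mat_frames: "mat 1 \<in> frames"
  by (simp add: frames_orthogonal)

lemma compact_frames: "compact (frames :: (real^'n^'n::finite) set)"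
proof -
  have "frames = (\<Inter>i. \<Inter>j. {q::real^'n^'n. q $ i \<bullet> q $ j = (if i = j then 1 else 0)})"
    by (auto simp: frames_def)
  also have "closed \<dots>"
    by (intro closed_INT ballI closed_Collect_eq continuous_intros)
  finally have "closed (frames :: (real^'n^'n) set)" .
  moreover have "norm q \<le> real CARD('n)" if "q \<in> frames" for q :: "real^'n^'n"
  proof -
    have "norm q \<le> (\<Sum>i\<in>UNIV. norm (q $ i))"
      unfolding norm_vec_def by (rule L2_set_le_sum) simp
    then show ?thesis using frames_norm[OF that] by simp
  qed
  then have "bounded (frames :: (real^'n^'n) set)" by (auto simp: bounded_iff)
  ultimately show ?thesis by (simp add: compact_eq_bounded_closed)
qed

lemma sym_inner: "transpose X = X \<Longrightarrow> (X *v u) \<bullet> v = u \<bullet> (X *v (v::real^'n::finite))"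
  by (metis dot_lmul_matrix inner_commute transpose_matrix_vector)

lemma qform_rot:
  assumes "transpose X = X"
  shows "qform X (c *\<^sub>R u + s *\<^sub>R v) = c\<^sup>2 * qform X u + 2 * c * s * (u \<bullet> (X *v v)) + s\<^sup>2 * qform X v"
proof -
  have "v \<bullet> (X *v u) = u \<bullet> (X *v v)" using sym_inner[OF assms, of v u] by (simp add: inner_commute)
  then show ?thesis
    unfolding qform_def by (simp add: matrix_vector_right_distrib matrix_vector_mult_scaleR
      inner_add_left inner_add_right power2_eq_square algebra_simps)
qed

lemma qform_scaleR: "qform X (c *\<^sub>R v) = c\<^sup>2 * qform X v"
  by (simp add: qform_def matrix_vector_mult_scaleR power2_eq_square)

text \<open>One step of the Jacobi eigenvalue algorithm; the sign of the new difference of the two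
  diagonal entries may be chosen freely.\<close>

lemma jacobi_rotation:
  assumes X: "transpose X = X" and q: "q \<in> frames" and ij: "i \<noteq> j" and m: "q $ i \<bullet> (X *v q $ j) \<noteq> 0"
  obtains q' where "q' \<in> frames" "(\<Sum>k\<in>UNIV. a $ k * qform X (q' $ k)) \<le> (\<Sum>k\<in>UNIV. a $ k * qform X (q $ k))"
    "(\<Sum>k\<in>UNIV. (qform X (q' $ k))\<^sup>2) > (\<Sum>k\<in>UNIV. (qform X (q $ k))\<^sup>2)"
proof -
  define A where "A = qform X (q $ i)"
  define B where "B = qform X (q $ j)"
  define m where "m = q $ i \<bullet> (X *v q $ j)"
  \<comment> \<open>The distance between the two eigenvalues of the 2 by 2 block on \<open>i\<close>
    and \<open>j\<close>. Rotating by half of the angle \<open>t\<close> below diagonalises this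
    block.\<close>
  define r where "r = sqrt ((A - B)\<^sup>2 + (2 * m)\<^sup>2)"
  have m0: "m \<noteq> 0" using assms by (simp add: m_def)
  then have "(A - B)\<^sup>2 < r\<^sup>2" by (simp add: r_def)
  moreover have r0: "r \<ge> 0" by (simp add: r_def)
  ultimately have rAB: "\<bar>A - B\<bar> < r" by (metis abs_of_nonneg power2_less_imp_less power2_abs)
  \<comment> \<open>The smaller eigenvalue goes to the index with the larger weight, so that the
    weighted sum cannot increase.\<close>
  define \<delta> where "\<delta> = (if a $ i \<ge> a $ j then - r else r)"
  have \<delta>2: "\<delta>\<^sup>2 = r\<^sup>2" by (simp add: \<delta>_def)
  have \<delta>0: "\<delta> \<noteq> 0" using rAB by (auto simp: \<delta>_def)
  have "((A - B) / \<delta>)\<^sup>2 + (2 * m / \<delta>)\<^sup>2 = ((A - B)\<^sup>2 + (2 * m)\<^sup>2) / r\<^sup>2"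
    by (simp only: power_divide \<delta>2 add_divide_distrib)
  also have "\<dots> = r\<^sup>2 / r\<^sup>2" by (simp add: r_def)
  also have "\<dots> = 1" using rAB by auto
  finally obtain t where t: "(A - B) / \<delta> = cos t" "2 * m / \<delta> = sin t"
    using sincos_total_2pi by metis
  define c s where "c = cos (t / 2)" and "s = sin (t / 2)"
  have cs: "c\<^sup>2 + s\<^sup>2 = 1" by (simp add: c_def s_def)
  have c2: "c\<^sup>2 - s\<^sup>2 = (A - B) / \<delta>" using t(1) cos_double[of "t/2"] by (simp add: c_def s_def)
  have s2: "2 * c * s = 2 * m / \<delta>" using t(2) sin_double[of "t/2"] by (simp add: c_def s_def)
  define q' where "q' = (\<chi> k. if k = i then c *\<^sub>R q $ i + s *\<^sub>R q $ j
      else if k = j then (- s) *\<^sub>R q $ i + c *\<^sub>R q $ j else q $ k)"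
  note qi = frames_inner[OF q]
  have q': "q' \<in> frames"
    using ij cs unfolding frames_def q'_def
    by (auto simp: qi inner_add_left inner_add_right power2_eq_square algebra_simps)
  define A' B' where "A' = qform X (q' $ i)" and "B' = qform X (q' $ j)"
  have A': "A' = c\<^sup>2 * A + 2 * c * s * m + s\<^sup>2 * B"
    using qform_rot[OF X, of c "q $ i" s "q $ j"] by (simp add: A'_def q'_def A_def B_def m_def)
  have B': "B' = s\<^sup>2 * A - 2 * c * s * m + c\<^sup>2 * B"
    using qform_rot[OF X, of "- s" "q $ i" c "q $ j"] ij by (simp add: B'_def q'_def A_def B_def m_def)
  have sum: "A' + B' = A + B"
  proof -
    have "A' + B' = (c\<^sup>2 + s\<^sup>2) * (A + B)" unfolding A' B' by (simp add: algebra_simps)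
    then show ?thesis using cs by simp
  qed
  have diff: "A' - B' = \<delta>"
  proof -
    have "A' - B' = (c\<^sup>2 - s\<^sup>2) * (A - B) + (2 * c * s) * (2 * m)"
      unfolding A' B' by (simp add: algebra_simps)
    also have "\<dots> = ((A - B)\<^sup>2 + (2 * m)\<^sup>2) / \<delta>"
      unfolding c2 s2 by (simp add: add_divide_distrib power2_eq_square)
    also have "\<dots> = r\<^sup>2 / \<delta>" by (simp add: r_def)
    also have "\<dots> = \<delta>" using \<delta>2 \<delta>0 by (simp add: power2_eq_square divide_simps)
    finally show ?thesis .
  qed
  have split: "(\<Sum>k\<in>UNIV. f k (qform X (q' $ k))) = (\<Sum>k\<in>UNIV. f k (qform X (q $ k)))
     + (f i A' + f j B' - f i A - f j B)" for f :: "'a \<Rightarrow> real \<Rightarrow> real"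
  proof -
    have "(\<Sum>k\<in>UNIV. g k) = (\<Sum>k\<in>UNIV - {i, j}. g k) + (g i + g j)" for g :: "'a \<Rightarrow> real"
      using ij by (subst sum.subset_diff[of "{i,j}"]) auto
    moreover have "(\<Sum>k\<in>UNIV - {i, j}. f k (qform X (q' $ k))) = (\<Sum>k\<in>UNIV - {i, j}. f k (qform X (q $ k)))"
      by (intro sum.cong) (auto simp: q'_def)
    ultimately show ?thesis by (simp add: A_def B_def A'_def B'_def)
  qed
  have "(a $ i - a $ j) * (A' - B') \<le> (a $ i - a $ j) * (A - B)"
  proof (cases "a $ i \<ge> a $ j")
    case True
    then show ?thesis unfolding diff using rAB by (intro mult_left_mono) (auto simp: \<delta>_def)
  next
    case False
    then show ?thesis unfolding diff using rAB by (intro mult_left_mono_neg) (auto simp: \<delta>_def)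
  qed
  moreover have "2 * (a $ i * A' + a $ j * B') = (a $ i + a $ j) * (A' + B') + (a $ i - a $ j) * (A' - B')"
    "2 * (a $ i * A + a $ j * B) = (a $ i + a $ j) * (A + B) + (a $ i - a $ j) * (A - B)"
    by (simp_all add: algebra_simps)
  ultimately have "a $ i * A' + a $ j * B' \<le> a $ i * A + a $ j * B"
    using sum by simp
  then have 1: "(\<Sum>k\<in>UNIV. a $ k * qform X (q' $ k)) \<le> (\<Sum>k\<in>UNIV. a $ k * qform X (q $ k))"
    using split[of "\<lambda>k x. a $ k * x"] by simp
  have "(A - B)\<^sup>2 < (A' - B')\<^sup>2" using \<open>(A - B)\<^sup>2 < r\<^sup>2\<close> diff \<delta>2 by simp
  moreover have "2 * (A'\<^sup>2 + B'\<^sup>2) = (A' + B')\<^sup>2 + (A' - B')\<^sup>2" "2 * (A\<^sup>2 + B\<^sup>2) = (A + B)\<^sup>2 + (A - B)\<^sup>2"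
    by (simp_all add: power2_eq_square algebra_simps)
  ultimately have "A\<^sup>2 + B\<^sup>2 < A'\<^sup>2 + B'\<^sup>2" using sum by simp
  then have 2: "(\<Sum>k\<in>UNIV. (qform X (q' $ k))\<^sup>2) > (\<Sum>k\<in>UNIV. (qform X (q $ k))\<^sup>2)"
    using split[of "\<lambda>k x. x\<^sup>2"] by simp
  show ?thesis by (rule that[OF q' 1 2])
qed

lemma continuous_matrix_vector_mult [continuous_intros]:
  fixes f :: "'a::topological_space \<Rightarrow> real^'n^'m::finite" and g :: "'a \<Rightarrow> real^'n::finite"
  assumes "continuous_on S f" "continuous_on S g"
  shows "continuous_on S (\<lambda>x. f x *v g x)"
  unfolding matrix_vector_mult_def by (intro continuous_intros assms continuous_on_vec_lambda)

lemma continuous_qform [continuous_intros]: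
  fixes g :: "'a::topological_space \<Rightarrow> real^'n::finite"
  assumes "continuous_on S f" "continuous_on S g"
  shows "continuous_on S (\<lambda>x. qform (f x) (g x))"
  unfolding qform_def by (intro continuous_intros assms)

text \<open>Minimising the linear functional over all frames and then maximising the sum of squares of the
  diagonal gives a frame that no Jacobi rotation can improve, so it diagonalises.\<close>

lemma diagonalising_frame:
  assumes X: "transpose X = X" and q0: "q0 \<in> frames"
  obtains q where "q \<in> frames" "\<And>i. X *v (q $ i) = qform X (q $ i) *\<^sub>R q $ i"
    "(\<Sum>k\<in>UNIV. a $ k * qform X (q $ k)) \<le> (\<Sum>k\<in>UNIV. a $ k * qform X (q0 $ k))"
proof -
  let ?f = "\<lambda>q. \<Sum>k\<in>UNIV. a $ k * qform X (q $ k)" and ?g = "\<lambda>q. \<Sum>k\<in>UNIV. (qform X (q $ k))\<^sup>2"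
  have cf: "continuous_on S ?f" "continuous_on S ?g" for S by (intro continuous_intros)+
  obtain q1 where q1: "q1 \<in> frames" "\<And>q. q \<in> frames \<Longrightarrow> ?f q1 \<le> ?f q"
    using continuous_attains_inf[OF compact_frames _ cf(1)] q0 by blast
  let ?M = "frames \<inter> {q. ?f q = ?f q1}"
  have cM: "compact ?M"
    by (intro compact_Int_closed compact_frames closed_Collect_eq cf continuous_intros)
  have neM: "?M \<noteq> {}" using q1(1) by auto
  obtain q where q: "q \<in> ?M" "\<forall>q'\<in>?M. ?g q' \<le> ?g q"
    by (rule bexE[OF continuous_attains_sup[OF cM neM cf(2)]])
  have off: "q $ i \<bullet> (X *v q $ j) = 0" if ij: "i \<noteq> j" for i j
  proof (rule ccontr)
    assume nz: "q $ i \<bullet> (X *v q $ j) \<noteq> 0"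
    obtain q' where q': "q' \<in> frames" "?f q' \<le> ?f q" "?g q' > ?g q"
      by (rule jacobi_rotation[OF X _ ij nz, of a]) (use q(1) in auto)
    have "?f q = ?f q1" using q(1) by simp
    then have "?f q' = ?f q1" using q'(2) q1(2)[OF q'(1)] by linarith
    then have "q' \<in> ?M" using q'(1) by simp
    then show False using bspec[OF q(2), of q'] q'(3) by linarith
  qed
  have qf: "q \<in> frames" using q by blast
  have "X *v (q $ i) = qform X (q $ i) *\<^sub>R q $ i" for i
  proof -
    have "X *v (q $ i) = (\<Sum>k\<in>UNIV. (q $ k \<bullet> (X *v q $ i)) *\<^sub>R q $ k)"
      by (rule frames_expand[OF qf, symmetric])
    also have "\<dots> = (\<Sum>k\<in>UNIV. if k = i then qform X (q $ i) *\<^sub>R q $ i else 0)"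
      by (intro sum.cong) (auto simp: off qform_def)
    finally show ?thesis by simp
  qed
  moreover have "?f q \<le> ?f q0" using q(1) q1(2)[OF q0] by simp
  ultimately show ?thesis by (rule that[OF qf])
qed

text \<open>Coefficients of the polynomial \<open>det (I + t M)\<close> are compared: the Leibniz
  formula yields the sums of principal minors, the eigenbasis yields the product of the factors
  \<open>1 + t * \<mu> i\<close>. Symmetry of \<open>M\<close> is not assumed, since
  \<open>shape\<close> is in general not symmetric.\<close>

lemma sigma_eigen:
  fixes M B :: "real^'n^'n::finite"
  assumes B: "invertible B" and eig: "\<And>i. M *v (B $ i) = \<mu> i *\<^sub>R B $ i"
  shows "sigma k M = esym k UNIV \<mu>"
proof -
  define L :: "real \<Rightarrow> real^'n^'n" where "L t = (\<chi> i j. (if i = j then 1 else 0) + t * M $ i $ j)" for t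
  have Lv: "L t *v v = v + t *\<^sub>R (M *v v)" for t v
  proof -
    have "(\<Sum>j\<in>UNIV. ((if i = j then 1 else 0) + t * M $ i $ j) * v $ j) = v $ i + t * (\<Sum>j\<in>UNIV. M $ i $ j * v $ j)" for i
    proof -
      have "(\<Sum>j\<in>UNIV. ((if i = j then 1 else 0) + t * M $ i $ j) * v $ j)
        = (\<Sum>j\<in>UNIV. (if i = j then v $ j else 0) + t * (M $ i $ j * v $ j))"
        by (intro sum.cong) (auto simp: algebra_simps)
      then show ?thesis by (simp add: sum.distrib sum_distrib_left)
    qed
    then show ?thesis by (simp add: L_def vec_eq_iff matrix_vector_mult_def)
  qed
  define D :: "real \<Rightarrow> real^'n^'n" where "D t = (\<chi> i j. if i = j then 1 + t * \<mu> i else 0)" for t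
  have "L t ** transpose B = transpose B ** D t" for t
  proof -
    have "(L t ** transpose B) $ a $ b = (transpose B ** D t) $ a $ b" for a b
    proof -
      have "(L t ** transpose B) $ a $ b = (L t *v (B $ b)) $ a"
        by (simp add: matrix_matrix_mult_def matrix_vector_mult_def transpose_def)
      also have "\<dots> = (1 + t * \<mu> b) * B $ b $ a" by (simp add: Lv eig algebra_simps)
      also have "\<dots> = (transpose B ** D t) $ a $ b"
        by (simp add: matrix_matrix_mult_def transpose_def D_def if_distrib cong: if_cong)
      finally show ?thesis .
    qed
    then show ?thesis by (simp add: vec_eq_iff)
  qed
  then have "det (L t) * det B = det B * det (D t)" for t
    by (metis det_mul det_transpose)
  then have "det (L t) = det (D t)" for t
    using B invertible_det_nz by (metis mult.commute mult_left_cancel)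
  moreover have "det (D t) = (\<Prod>i\<in>UNIV. 1 + t * \<mu> i)" for t
    by (subst det_diagonal) (auto simp: D_def)
  moreover have "(\<Prod>i\<in>UNIV. 1 + t * \<mu> i) = (\<Sum>j\<le>CARD('n). esym j UNIV \<mu> * t ^ j)" for t
  proof -
    have "(\<Prod>i\<in>UNIV. 1 + t * \<mu> i) = (\<Prod>i\<in>UNIV. t * \<mu> i + 1)" by (simp add: add.commute)
    also have "\<dots> = (\<Sum>S\<in>Pow (UNIV::'n set). t ^ card S * (\<Prod>i\<in>S. \<mu> i))"
      by (subst prod_add) (simp_all add: prod.distrib)
    also have "\<dots> = (\<Sum>j\<le>CARD('n). \<Sum>S | S \<in> Pow UNIV \<and> card S = j. t ^ card S * (\<Prod>i\<in>S. \<mu> i))"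
      by (subst sum.group) (auto simp: card_mono)
    also have "\<dots> = (\<Sum>j\<le>CARD('n). esym j UNIV \<mu> * t ^ j)"
      unfolding esym_def sum_distrib_right by (intro sum.cong) auto
    finally show ?thesis .
  qed
  moreover have "det (L t) = (\<Sum>j\<le>CARD('n). sigma j M * t ^ j)" for t
  proof -
    have "(\<Prod>i\<in>UNIV. L t $ i $ p i) = (\<Sum>S\<in>Pow UNIV. if p permutes S then t ^ card S * (\<Prod>i\<in>S. M $ i $ p i) else 0)"
      if p: "p permutes UNIV" for p
    proof -
      have "(\<Prod>i\<in>UNIV. L t $ i $ p i) = (\<Prod>i\<in>UNIV. t * M $ i $ p i + (if i = p i then 1 else 0))"
        by (simp add: L_def add.commute)
      also have "\<dots> = (\<Sum>S\<in>Pow UNIV. (\<Prod>i\<in>S. t * M $ i $ p i) * (\<Prod>i\<in>UNIV - S. if i = p i then 1 else 0))"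
        by (subst prod_add) simp_all
      also have "\<dots> = (\<Sum>S\<in>Pow UNIV. if p permutes S then t ^ card S * (\<Prod>i\<in>S. M $ i $ p i) else 0)"
      proof (rule sum.cong[OF refl])
        fix S :: "'n set"
        \<comment> \<open>\<open>S\<close> is the set of rows from which the factor with
          \<open>M\<close> is taken. The other factors come from the identity matrix and vanish
          unless \<open>p\<close> fixes every index outside \<open>S\<close>.\<close>
        have "(\<Prod>i\<in>UNIV - S. if i = p i then 1 else 0) = (if p permutes S then 1 else (0::real))"
        proof (cases "p permutes S")
          case True
          then show ?thesis by (auto simp: permutes_def intro!: prod.neutral)
        next
          case False
          then obtain i where "i \<notin> S" "p i \<noteq> i" using p by (auto simp: permutes_def)
          then have "\<exists>i\<in>UNIV - S. (if i = p i then 1 else 0) = (0::real)" by (intro bexI[of _ i]) auto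
          then have "(\<Prod>i\<in>UNIV - S. if i = p i then 1 else 0) = (0::real)" by (rule prod_zero[rotated]) simp
          then show ?thesis using False by simp
        qed
        then show "(\<Prod>i\<in>S. t * M $ i $ p i) * (\<Prod>i\<in>UNIV - S. if i = p i then 1 else 0)
          = (if p permutes S then t ^ card S * (\<Prod>i\<in>S. M $ i $ p i) else 0)"
          by (simp add: prod.distrib)
      qed
      finally show ?thesis .
    qed
    then have "det (L t) = (\<Sum>p | p permutes UNIV. of_int (sign p) *
        (\<Sum>S\<in>Pow UNIV. if p permutes S then t ^ card S * (\<Prod>i\<in>S. M $ i $ p i) else 0))"
      unfolding det_def by (intro sum.cong) auto
    also have "\<dots> = (\<Sum>S\<in>Pow UNIV. \<Sum>p | p permutes UNIV. if p permutes S then of_int (sign p) * (t ^ card S * (\<Prod>i\<in>S. M $ i $ p i)) else 0)"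
      unfolding sum_distrib_left by (subst sum.swap) (intro sum.cong, auto)
    also have "\<dots> = (\<Sum>S\<in>Pow UNIV. t ^ card S * principal_minor M S)"
    proof (rule sum.cong[OF refl])
      fix S :: "'n set"
      have "{p. p permutes S} = {p. p permutes UNIV} \<inter> {p. p permutes S}"
        by (auto intro: permutes_subset)
      then show "(\<Sum>p | p permutes UNIV. if p permutes S then of_int (sign p) * (t ^ card S * (\<Prod>i\<in>S. M $ i $ p i)) else 0)
        = t ^ card S * principal_minor M S"
        unfolding principal_minor_def sum_distrib_left
        by (subst sum.inter_filter[symmetric]) (auto intro!: sum.cong simp: finite_permutations)
    qed
    also have "\<dots> = (\<Sum>j\<le>CARD('n). \<Sum>S | S \<in> Pow UNIV \<and> card S = j. t ^ card S * principal_minor M S)"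
      by (subst sum.group) (auto simp: card_mono)
    also have "\<dots> = (\<Sum>j\<le>CARD('n). sigma j M * t ^ j)"
      unfolding sigma_def sum_distrib_right by (intro sum.cong) auto
    finally show ?thesis .
  qed
  ultimately have "(\<Sum>j\<le>CARD('n). sigma j M * t ^ j) = (\<Sum>j\<le>CARD('n). esym j UNIV \<mu> * t ^ j)" for t
    by metis
  then have coeff: "\<forall>j\<le>CARD('n). sigma j M = esym j UNIV \<mu>"
    using polyfun_eq_coeffs[of "\<lambda>j. sigma j M" "CARD('n)" "\<lambda>j. esym j UNIV \<mu>"] by blast
  show ?thesis
  proof (cases "k \<le> CARD('n)")
    case True then show ?thesis using coeff by blast
  next
    case False
    then have "{S :: 'n set. card S = k} = {}"
      using card_mono[OF finite subset_UNIV] by auto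
    then show ?thesis by (simp add: sigma_def esym_def)
  qed
qed

section \<open>Admissible jets\<close>

definition dcone :: "nat \<Rightarrow> (real^'n::finite) set" where
  "dcone k = {a. \<forall>x. ($) x \<in> gcone k UNIV \<longrightarrow> 0 \<le> a \<bullet> x}"

lemma nonneg_gcone: "(\<And>i. i \<in> S \<Longrightarrow> 0 \<le> x i) \<Longrightarrow> x \<in> gcone k S"
  unfolding gcone_def esym_def
  by (auto intro!: sum_nonneg prod_nonneg) (meson order.strict_trans1 less_imp_le subsetD)

lemma dcone_nonneg:
  fixes a :: "real^'n::finite"
  assumes "a \<in> dcone k" shows "0 \<le> a $ i"
proof -
  have "($) (axis i 1 :: real^'n) \<in> gcone k UNIV"
    by (rule nonneg_gcone) (simp add: axis_def)
  then have "0 \<le> a \<bullet> axis i 1" using assms unfolding dcone_def by blast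
  then show ?thesis by (simp add: inner_axis)
qed

lemma dcone_add: "a \<in> dcone k \<Longrightarrow> b \<in> dcone k \<Longrightarrow> a + b \<in> dcone k"
  by (auto simp: dcone_def inner_add_left)

lemma dcone_scaleR: "a \<in> dcone k \<Longrightarrow> 0 \<le> c \<Longrightarrow> c *\<^sub>R a \<in> dcone k"
  by (auto simp: dcone_def)

lemma closed_dcone: "closed (dcone k :: (real^'n::finite) set)"
proof -
  have "dcone k = (\<Inter>x\<in>{x::real^'n. ($) x \<in> gcone k UNIV}. {a. 0 \<le> a \<bullet> x})"
    by (auto simp: dcone_def)
  then show ?thesis by (auto intro!: closed_INT closed_Collect_le continuous_intros)
qed

lemma one_dcone:
  assumes "1 \<le> k" "k \<le> CARD('n::finite)" shows "(\<chi> i. 1) \<in> (dcone k :: (real^'n) set)"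
  unfolding dcone_def mem_Collect_eq
proof (intro allI impI)
  fix x :: "real^'n" assume "($) x \<in> gcone k UNIV"
  then have "0 \<le> esym 1 UNIV (($) x)" using gcone_esym_nonneg[of UNIV k "($) x" 1] assms by simp
  moreover have "esym 1 UNIV (($) x) = (\<Sum>i\<in>UNIV. x $ i)"
    using esym_euler[of UNIV "($) x" 0] by (simp add: esym_0)
  ultimately show "0 \<le> (\<chi> i. 1) \<bullet> x" by (simp add: inner_vec_def)
qed

lemma esym_permute:
  fixes p :: "'a \<Rightarrow> 'a"
  assumes "bij p" shows "esym k UNIV (x \<circ> p) = esym k UNIV x"
proof -
  have inj: "inj p" using assms by (simp add: bij_def)
  have inv: "p ` (p -` T) = T" for T :: "'a set" using assms by (metis bij_is_surj surj_image_vimage_eq)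
  have "(\<Sum>T | card T = k. \<Prod>i\<in>T. x (p i)) = (\<Sum>T :: 'a set | card T = k. \<Prod>i\<in>T. x i)"
  proof (rule sum.reindex_bij_witness[where i = "\<lambda>T. p -` T" and j = "\<lambda>T. p ` T"])
    fix T :: "'a set" assume "T \<in> {T. card T = k}"
    then show "p -` T \<in> {T. card T = k}" using inv inj by (metis (mono_tags) card_image inj_on_subset mem_Collect_eq subset_UNIV)
  qed (auto simp: inv inj inj_vimage_image_eq card_image inj_on_subset[OF inj] prod.reindex bij_is_surj[OF assms])
  then show ?thesis by (simp add: esym_def)
qed

text \<open>Inherited from the symmetry of \<open>esym\<close>. In the compactness argument the
  limiting eigenvalues are a permutation of the limiting weights and have to be in the dual cone
  again.\<close>

lemma dcone_permute:
  fixes a :: "real^'n::finite" and p :: "'n \<Rightarrow> 'n"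
  assumes "bij p" "a \<in> dcone k" shows "(\<chi> i. a $ p i) \<in> dcone k"
  unfolding dcone_def mem_Collect_eq
proof (intro allI impI)
  fix x :: "real^'n" assume x: "($) x \<in> gcone k UNIV"
  let ?r = "inv p"
  have r: "bij ?r" "\<And>i. p (?r i) = i" "\<And>i. ?r (p i) = i"
    using assms(1) by (auto simp: bij_imp_bij_inv bij_is_surj surj_f_inv_f bij_is_inj)
  let ?y = "(\<chi> i. x $ ?r i) :: real^'n"
  have "($) ?y \<in> gcone k UNIV"
    unfolding gcone_def mem_Collect_eq
  proof (intro allI impI)
    fix z assume z: "\<forall>i\<in>UNIV. ?y $ i < z i"
    have "x $ i < z (p i)" for i using z[rule_format, of "p i"] r by simp
    then have "0 \<le> esym k UNIV (z \<circ> p)" using x by (auto simp: gcone_def)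
    then show "0 \<le> esym k UNIV z" using esym_permute[OF assms(1)] by metis
  qed
  then have "0 \<le> a \<bullet> ?y" using assms(2) by (simp add: dcone_def)
  also have "a \<bullet> ?y = (\<chi> i. a $ p i) \<bullet> x"
    unfolding inner_vec_def
    by (rule sum.reindex_bij_witness[where i = p and j = ?r]) (auto simp: r)
  finally show "0 \<le> (\<chi> i. a $ p i) \<bullet> x" .
qed

text \<open>The bipolar theorem. Convexity of the cone rests on \<open>gcone_add\<close>, hence on
  Marcus--Lopes; the separating functional is nonpositive nowhere below zero on the cone because the
  cone is closed under scaling, so it belongs to \<open>dcone\<close>.\<close>

lemma gcone_bipolar:
  fixes x :: "real^'n::finite"
  assumes k: "k \<le> CARD('n)" and x: "\<And>a. a \<in> dcone k \<Longrightarrow> 0 \<le> a \<bullet> x"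
  shows "($) x \<in> gcone k UNIV"
proof (rule ccontr)
  let ?S = "{x :: real^'n. ($) x \<in> gcone k UNIV}"
  assume nx: "($) x \<notin> gcone k UNIV"
  have scale: "c *\<^sub>R u \<in> ?S" if u: "u \<in> ?S" and c: "c > 0" for c u
  proof -
    have "0 \<le> esym k UNIV y" if "\<forall>i\<in>UNIV. (c *\<^sub>R u) $ i < y i" for y
    proof -
      have "\<forall>i\<in>UNIV. u $ i < (1 / c) * y i" using that c by (auto simp: field_simps)
      then have "0 \<le> esym k UNIV (\<lambda>i. (1 / c) * y i)" using u by (auto simp: gcone_def)
      then have "0 \<le> (1 / c) ^ k * esym k UNIV y" by (simp only: esym_scale)
      then show ?thesis using c by (metis mult_less_0_iff not_le zero_less_divide_1_iff zero_less_power)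
    qed
    then show ?thesis by (simp add: gcone_def)
  qed
  have z: "0 \<in> ?S" by (auto intro: nonneg_gcone)
  have scale0: "c *\<^sub>R u \<in> ?S" if "u \<in> ?S" "c \<ge> 0" for c u
    using scale[OF that(1)] z that(2) by (cases "c = 0") auto
  have add: "u + v \<in> ?S" if "u \<in> ?S" "v \<in> ?S" for u v
    using gcone_add[of UNIV k "($) u" "($) v"] that k
    by (simp add: plus_vec_def[abs_def] vec_lambda_inverse)
  have "convex ?S" unfolding convex_def using scale0 add by blast
  moreover have "closed ?S"
  proof -
    \<comment> \<open>By the order description the complement of the cone is a union of open
      orthants, one below each \<open>y\<close> with negative \<open>esym k\<close>.\<close>
    have "?S = (\<Inter>y\<in>{y. esym k UNIV y < 0}. - {x. \<forall>i. x $ i < y i})"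
      by (auto simp: gcone_def not_less[symmetric])
    moreover have "open {x :: real^'n. \<forall>i. x $ i < y i}" for y
    proof -
      have "{x :: real^'n. \<forall>i. x $ i < y i} = (\<Inter>i. {x. x $ i < y i})" by auto
      then show ?thesis by (auto intro!: open_INT open_Collect_less continuous_intros)
    qed
    ultimately show ?thesis by (metis (no_types, lifting) closed_Compl closed_INT)
  qed
  ultimately obtain a b where ab: "a \<bullet> x < b" "\<forall>u\<in>?S. b < a \<bullet> u"
    using separating_hyperplane_closed_point[of ?S x] nx by auto
  have b: "b < 0" using ab(2) z by auto
  have "a \<in> dcone k"
    unfolding dcone_def mem_Collect_eq
  proof (intro allI impI)
    fix u :: "real^'n" assume u: "($) u \<in> gcone k UNIV"
    show "0 \<le> a \<bullet> u"
    proof (rule linear_bound_nonneg[where a = "- b"])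
      fix t :: real assume "t > 0"
      then have "b < a \<bullet> (t *\<^sub>R u)" using ab(2) scale[of u t] u by blast
      then show "0 \<le> - b + t * (a \<bullet> u)" by simp
    qed
  qed
  then show False using x[of a] ab b by simp
qed

text \<open>For a graph with gradient \<open>p\<close> the induced metric is \<open>g = I + p p\<^sup>T\<close>; \<open>Gp\<close> and \<open>Gi\<close> are
  \<open>g\<close> to the powers \<open>1/2\<close> and \<open>-1/2\<close>.\<close>

definition vslope :: "real^'n::finite \<Rightarrow> real" where
  "vslope p = sqrt (1 + (norm p)\<^sup>2)"

definition Gp :: "real^'n::finite \<Rightarrow> real^'n \<Rightarrow> real^'n" where
  "Gp p v = v + ((p \<bullet> v) / (1 + vslope p)) *\<^sub>R p"

definition Gi :: "real^'n::finite \<Rightarrow> real^'n \<Rightarrow> real^'n" where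
  "Gi p v = v - ((p \<bullet> v) / (vslope p * (1 + vslope p))) *\<^sub>R p"

lemma vslope_sq: "(vslope p)\<^sup>2 = 1 + p \<bullet> p"
  by (simp add: vslope_def power2_norm_eq_inner)

lemma vslope_ge_1: "1 \<le> vslope p"
  by (simp add: vslope_def)

lemma vslope_pos [simp]: "0 < vslope p" "0 < 1 + vslope p" "vslope p \<noteq> 0" "1 + vslope p \<noteq> 0"
  using vslope_ge_1[of p] by auto

text \<open>Eliminates the length of \<open>p\<close>: the identities between \<open>Gp\<close> and
  \<open>Gi\<close> become rational identities in the slope \<open>w\<close>, which
  \<open>slope_identities\<close> collects.\<close>

lemma inner_self_vslope: "p \<bullet> p = (vslope p - 1) * (vslope p + 1)"
  using vslope_sq[of p] by (simp add: algebra_simps power2_eq_square)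

lemma slope_identities:
  fixes w c :: real assumes "0 < w"
  shows "c - c / (w * (1 + w)) * ((w - 1) * (w + 1)) = c / w"
    and "c + c / (1 + w) * ((w - 1) * (w + 1)) = c * w"
    and "2 / (1 + w) + (w - 1) * (w + 1) / ((1 + w) * (1 + w)) = 1"
    and "c / (w * (1 + w)) + c / w / (w * (1 + w)) = c / w\<^sup>2"
proof -
  have "w * (1 + w) \<noteq> 0" "1 + w \<noteq> 0" using assms by auto
  then show "c - c / (w * (1 + w)) * ((w - 1) * (w + 1)) = c / w"
    "c + c / (1 + w) * ((w - 1) * (w + 1)) = c * w"
    "2 / (1 + w) + (w - 1) * (w + 1) / ((1 + w) * (1 + w)) = 1"
    "c / (w * (1 + w)) + c / w / (w * (1 + w)) = c / w\<^sup>2"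
    using assms by (simp_all add: divide_simps) (simp_all add: algebra_simps power2_eq_square)
qed

lemma linear_Gp: "linear (Gp p)"
  by (auto simp: linear_iff Gp_def inner_add_right algebra_simps add_divide_distrib)

lemma linear_Gi: "linear (Gi p)"
  by (auto simp: linear_iff Gi_def inner_add_right algebra_simps add_divide_distrib)

lemma Gp_Gi [simp]: "Gp p (Gi p v) = v"
proof -
  let ?w = "vslope p" and ?c = "p \<bullet> v"
  have "p \<bullet> Gi p v = ?c - ?c / (?w * (1 + ?w)) * ((?w - 1) * (?w + 1))"
    by (simp add: Gi_def inner_diff_right inner_self_vslope)
  also have "\<dots> = ?c / ?w" by (rule slope_identities) simp
  finally have "Gp p (Gi p v) = v + (?c / ?w / (1 + ?w) - ?c / (?w * (1 + ?w))) *\<^sub>R p"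
    unfolding Gp_def[of p "Gi p v"] by (simp add: Gi_def scaleR_diff_left)
  then show ?thesis by simp
qed

lemma Gi_Gp [simp]: "Gi p (Gp p v) = v"
proof -
  let ?w = "vslope p" and ?c = "p \<bullet> v"
  have "p \<bullet> Gp p v = ?c + ?c / (1 + ?w) * ((?w - 1) * (?w + 1))"
    by (simp add: Gp_def inner_add_right inner_self_vslope)
  also have "\<dots> = ?c * ?w" by (rule slope_identities) simp
  finally have "Gi p (Gp p v) = v + (?c / (1 + ?w) - ?c * ?w / (?w * (1 + ?w))) *\<^sub>R p"
    by (simp add: Gp_def Gi_def algebra_simps)
  then show ?thesis by simp
qed

lemma Gp_adjoint: "Gp p u \<bullet> v = u \<bullet> Gp p v"
  by (simp add: Gp_def inner_add_left inner_add_right inner_commute)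

lemma Gi_adjoint: "Gi p u \<bullet> v = u \<bullet> Gi p v"
  by (simp add: Gi_def inner_diff_left inner_diff_right inner_commute)

text \<open>\<open>Gi p\<close> applied twice is the inverse metric, here in its Sherman--Morrison
  form.\<close>

lemma Gi_Gi: "Gi p (Gi p v) = v - ((p \<bullet> v) / (vslope p)\<^sup>2) *\<^sub>R p"
proof -
  let ?w = "vslope p" and ?c = "p \<bullet> v"
  have "p \<bullet> Gi p v = ?c - ?c / (?w * (1 + ?w)) * ((?w - 1) * (?w + 1))"
    by (simp add: Gi_def inner_diff_right inner_self_vslope)
  also have "\<dots> = ?c / ?w" by (rule slope_identities) simp
  finally have "Gi p (Gi p v) = v - (?c / (?w * (1 + ?w)) + ?c / ?w / (?w * (1 + ?w))) *\<^sub>R p"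
    unfolding Gi_def[of p "Gi p v"] by (simp add: Gi_def scaleR_add_left)
  also have "?c / (?w * (1 + ?w)) + ?c / ?w / (?w * (1 + ?w)) = ?c / ?w\<^sup>2"
    by (rule slope_identities) simp
  finally show ?thesis .
qed

text \<open>The square of \<open>Gp p\<close> is the metric \<open>I + p p^T\<close>; this is the
  only property of \<open>Gp\<close> that enters the comparison of two gradients.\<close>

lemma Gp_inner: "Gp p u \<bullet> Gp p v = u \<bullet> v + (p \<bullet> u) * (p \<bullet> v)"
proof -
  let ?w = "vslope p"
  have "Gp p u \<bullet> Gp p v = u \<bullet> v + (2 * ((p \<bullet> u) * (p \<bullet> v) / (1 + ?w)) + (p \<bullet> u) * (p \<bullet> v) / ((1 + ?w) * (1 + ?w)) * (p \<bullet> p))"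
    by (simp add: Gp_def inner_add_left inner_add_right inner_commute)
  also have "\<dots> = u \<bullet> v + (p \<bullet> u) * (p \<bullet> v) * (2 / (1 + ?w) + (?w - 1) * (?w + 1) / ((1 + ?w) * (1 + ?w)))"
    unfolding inner_self_vslope by (simp only: distrib_left times_divide_eq_right times_divide_eq_left mult_ac)
  also have "2 / (1 + ?w) + (?w - 1) * (?w + 1) / ((1 + ?w) * (1 + ?w)) = 1"
    by (rule slope_identities) simp
  finally show ?thesis by simp
qed

lemma norm_Gp_sq: "(norm (Gp p v))\<^sup>2 = (norm v)\<^sup>2 + (p \<bullet> v)\<^sup>2"
  by (simp add: power2_norm_eq_inner Gp_inner) (simp add: power2_eq_square)

lemma norm_Gp_ge: "norm v \<le> norm (Gp p v)"
  by (rule power2_le_imp_le) (simp_all add: norm_Gp_sq)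

lemma norm_Gi_le: "norm (Gi p v) \<le> norm v"
  using norm_Gp_ge[of "Gi p v" p] by simp

lemma norm_Gp_le: "norm (Gp p v) \<le> vslope p * norm v"
proof (rule power2_le_imp_le)
  have "(p \<bullet> v)\<^sup>2 \<le> (norm p)\<^sup>2 * (norm v)\<^sup>2"
    using Cauchy_Schwarz_ineq[of p v] by (simp add: power2_norm_eq_inner)
  then show "(norm (Gp p v))\<^sup>2 \<le> (vslope p * norm v)\<^sup>2"
    by (simp add: norm_Gp_sq power_mult_distrib vslope_def algebra_simps)
qed (simp add: less_imp_le)

lemma norm_Gi_ge: "norm v \<le> vslope p * norm (Gi p v)"
  using norm_Gp_le[of p "Gi p v"] by simp

text \<open>Admissibility in polar form, linear in \<open>X\<close>: by \<open>diagonalising_frame\<close> it says that the eigenvalues of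
  \<open>g\<^sup>-\<^sup>1\<^sup>/\<^sup>2 X g\<^sup>-\<^sup>1\<^sup>/\<^sup>2\<close> lie in the closed Garding cone.\<close>

definition adm :: "nat \<Rightarrow> real^'n::finite \<Rightarrow> real^'n^'n \<Rightarrow> bool" where
  "adm k p X \<longleftrightarrow> (\<forall>q\<in>frames. \<forall>a\<in>dcone k. 0 \<le> (\<Sum>i\<in>UNIV. a $ i * qform X (Gi p (q $ i))))"

text \<open>The matrix whose elementary symmetric functions are the curvatures of a graph with gradient
  \<open>p\<close> and Hessian \<open>X\<close>.\<close>

definition shape :: "real^'n::finite \<Rightarrow> real^'n^'n \<Rightarrow> real^'n^'n" where
  "shape p X = matrix (\<lambda>v. (1 / vslope p) *\<^sub>R Gi p (Gi p (X *v v)))"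

lemma shape_mult: "shape p X *v v = (1 / vslope p) *\<^sub>R Gi p (Gi p (X *v v))"
proof -
  have "linear (\<lambda>v. (1 / vslope p) *\<^sub>R Gi p (Gi p (X *v v)))"
    by (intro linear_compose_scale_right linear_compose[unfolded o_def, OF _ linear_Gi] matrix_vector_mul_linear)
  then show ?thesis by (simp add: shape_def matrix_works)
qed

text \<open>\<open>Gp p\<close> is the metric composed with \<open>Gi p\<close>, so
  \<open>eig\<close> says that the vectors \<open>Gi p (q $ i)\<close> diagonalise \<open>X\<close>
  relative to the metric. Applying the inverse metric turns them into eigenvectors of
  \<open>shape\<close>, and the factor \<open>1 / vslope p\<close> comes out by homogeneity.\<close>

lemma sigma_shape:
  fixes X :: "real^'n^'n::finite"
  assumes q: "q \<in> frames" and eig: "\<And>i. X *v Gi p (q $ i) = d i *\<^sub>R Gp p (q $ i)"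
  shows "sigma k (shape p X) = (1 / vslope p) ^ k * esym k UNIV d"
proof -
  let ?B = "(\<chi> i. Gi p (q $ i)) :: real^'n^'n" and ?C = "(\<chi> i. Gp p (q $ i)) :: real^'n^'n"
  have "?B ** transpose ?C = mat 1"
    using frames_inner[OF q] Gi_adjoint[of p "q $ _" "Gp p (q $ _)"]
    by (simp add: vec_eq_iff matrix_matrix_mult_def transpose_def mat_def inner_vec_def)
  then have "invertible ?B" using invertible_right_inverse by blast
  moreover have "shape p X *v (?B $ i) = ((1 / vslope p) * d i) *\<^sub>R ?B $ i" for i
    by (simp add: shape_mult eig linear_scale[OF linear_Gi] del: scaleR_conv_of_real)
  ultimately have "sigma k (shape p X) = esym k UNIV (\<lambda>i. (1 / vslope p) * d i)"
    by (rule sigma_eigen)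
  then show ?thesis by (simp only: esym_scale)
qed

lemma Gi_conj:
  assumes "transpose X = X"
  obtains Z where "transpose Z = Z" "\<And>v. Z *v v = Gi p (X *v Gi p v)" "\<And>v. qform Z v = qform X (Gi p v)"
proof -
  let ?Z = "matrix (\<lambda>v. Gi p (X *v Gi p v))"
  have "linear (\<lambda>v. Gi p (X *v Gi p v))"
    by (intro linear_compose[unfolded o_def, OF _ linear_Gi] linear_compose[unfolded o_def, OF linear_Gi] matrix_vector_mul_linear)
  then have Z: "?Z *v v = Gi p (X *v Gi p v)" for v by (simp add: matrix_works)
  have "u \<bullet> (?Z *v v) = (?Z *v u) \<bullet> v" for u v
    by (simp add: Z Gi_adjoint sym_inner[OF assms] Gi_adjoint[symmetric, of p u])
  then have "?Z *v v = transpose ?Z *v v" for v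
    by (metis dot_lmul_matrix transpose_matrix_vector vector_eq_rdot)
  then have "transpose ?Z = ?Z" by (metis matrix_eq)
  moreover have "qform ?Z v = qform X (Gi p v)" for v by (simp add: qform_def Z Gi_adjoint[symmetric])
  ultimately show ?thesis using Z that by blast
qed

text \<open>Only the eigenframe of \<open>Z\<close> is needed: for it the polar inequalities are the
  bipolar test for the vector of eigenvalues.\<close>

lemma adm_sigma_nonneg:
  fixes X :: "real^'n^'n::finite"
  assumes k: "k \<le> CARD('n)" and X: "transpose X = X" and adm: "adm k p X" and j: "j \<le> k"
  shows "0 \<le> sigma j (shape p X)"
proof -
  obtain Z where Z: "transpose Z = Z" "\<And>v. Z *v v = Gi p (X *v Gi p v)" "\<And>v. qform Z v = qform X (Gi p v)"
    using Gi_conj[OF X] by metis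
  obtain q where q: "q \<in> frames" "\<And>i. Z *v (q $ i) = qform Z (q $ i) *\<^sub>R q $ i"
    using diagonalising_frame[OF Z(1) mat_frames] by metis
  let ?d = "\<chi> i. qform Z (q $ i)"
  have "X *v Gi p (q $ i) = qform Z (q $ i) *\<^sub>R Gp p (q $ i)" for i
    using q(2)[of i] Z(2)[of "q $ i"] Gp_Gi[of p "X *v Gi p (q $ i)"]
    by (metis linear_Gp linear_scale)
  then have s: "sigma j (shape p X) = (1 / vslope p) ^ j * esym j UNIV (($) ?d)"
    by (subst sigma_shape[OF q(1), where d = "($) ?d"]) auto
  have "($) ?d \<in> gcone k UNIV"
  proof (rule gcone_bipolar[OF k])
    fix a :: "real^'n" assume "a \<in> dcone k"
    then have "0 \<le> (\<Sum>i\<in>UNIV. a $ i * qform X (Gi p (q $ i)))" using adm q(1) by (auto simp: adm_def)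
    then show "0 \<le> a \<bullet> ?d" by (simp add: inner_vec_def Z(3))
  qed
  then have "0 \<le> esym j UNIV (($) ?d)" using gcone_esym_nonneg[of UNIV k "($) ?d" j] k j by simp
  then show ?thesis unfolding s using vslope_pos(1)[of p] by (intro mult_nonneg_nonneg) (auto simp: less_imp_le)
qed

text \<open>A violated polar inequality in some frame persists in an eigenframe, because
  \<open>diagonalising_frame\<close> does not increase the weighted diagonal sum. So the eigenvalues
  leave the cone, and its order description offers larger ones with negative \<open>esym k\<close>.
  \<open>X'\<close> will be the Hessian of a test function.\<close>

lemma not_adm_witness:
  fixes X :: "real^'n^'n::finite"
  assumes X: "transpose X = X" and nadm: "\<not> adm k p X"
  obtains X' m where "transpose X' = X'" "m > 0" "\<And>v. qform X v + m * (norm v)\<^sup>2 \<le> qform X' v"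
    "sigma k (shape p X') < 0"
proof -
  obtain Z where Z: "transpose Z = Z" "\<And>v. Z *v v = Gi p (X *v Gi p v)" "\<And>v. qform Z v = qform X (Gi p v)"
    using Gi_conj[OF X] by metis
  obtain q0 a where q0: "q0 \<in> frames" and a: "a \<in> dcone k" and neg: "(\<Sum>i\<in>UNIV. a $ i * qform Z (q0 $ i)) < 0"
    using nadm by (auto simp: adm_def Z(3) not_le)
  obtain q where q: "q \<in> frames" "\<And>i. Z *v (q $ i) = qform Z (q $ i) *\<^sub>R q $ i"
    "(\<Sum>i\<in>UNIV. a $ i * qform Z (q $ i)) \<le> (\<Sum>i\<in>UNIV. a $ i * qform Z (q0 $ i))"
    by (rule diagonalising_frame[OF Z(1) q0, of a]) blast
  let ?d = "(\<chi> i. qform Z (q $ i)) :: real^'n"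
  have "($) ?d \<notin> gcone k UNIV"
    using a q(3) neg by (auto simp: dcone_def inner_vec_def dest!: spec[of _ ?d])
  then obtain \<mu> where \<mu>: "\<And>i. ?d $ i < \<mu> i" "esym k UNIV \<mu> < 0"
    by (auto simp: gcone_def not_le)
  \<comment> \<open>The smallest gap between the old and the new eigenvalues. It becomes a Euclidean
    margin because \<open>Gp p\<close> never shortens vectors.\<close>
  define m where "m = Min (range (\<lambda>i. \<mu> i - ?d $ i))"
  have m: "m > 0" using \<mu>(1) by (simp add: m_def)
  have m_le: "m \<le> \<mu> i - ?d $ i" for i by (simp add: m_def)
  define X' :: "real^'n^'n" where "X' = matrix (\<lambda>v. \<Sum>i\<in>UNIV. (\<mu> i * (Gp p (q $ i) \<bullet> v)) *\<^sub>R Gp p (q $ i))"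
  have "linear (\<lambda>v. \<Sum>i\<in>UNIV. (\<mu> i * (Gp p (q $ i) \<bullet> v)) *\<^sub>R Gp p (q $ i))"
    by (auto simp: linear_iff inner_add_right algebra_simps sum.distrib scaleR_sum_right)
  then have X'v: "X' *v v = (\<Sum>i\<in>UNIV. (\<mu> i * (Gp p (q $ i) \<bullet> v)) *\<^sub>R Gp p (q $ i))" for v
    by (simp add: X'_def matrix_works)
  have "u \<bullet> (X' *v v) = (X' *v u) \<bullet> v" for u v
    by (simp add: X'v inner_sum_left inner_sum_right inner_commute mult_ac)
  then have "X' *v v = transpose X' *v v" for v
    by (metis dot_lmul_matrix transpose_matrix_vector vector_eq_rdot)
  then have X'sym: "transpose X' = X'" by (metis matrix_eq)
  have qX': "qform X' v = (\<Sum>i\<in>UNIV. \<mu> i * (q $ i \<bullet> Gp p v)\<^sup>2)" for v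
    unfolding qform_def X'v inner_sum_right
    by (intro sum.cong refl) (simp add: Gp_adjoint inner_commute[of v "Gp p (q $ _)"] power2_eq_square)
  have qX: "qform X v = (\<Sum>i\<in>UNIV. ?d $ i * (q $ i \<bullet> Gp p v)\<^sup>2)" for v
  proof -
    have "qform X v = qform Z (Gp p v)" by (simp add: Z(3))
    also have "\<dots> = (\<Sum>i\<in>UNIV. (q $ i \<bullet> Gp p v) * (q $ i \<bullet> (Z *v Gp p v)))"
      unfolding qform_def by (rule frames_parseval[OF q(1), symmetric])
    also have "\<dots> = (\<Sum>i\<in>UNIV. ?d $ i * (q $ i \<bullet> Gp p v)\<^sup>2)"
      by (intro sum.cong refl) (simp add: sym_inner[OF Z(1), symmetric] q(2) power2_eq_square)
    finally show ?thesis .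
  qed
  have ge: "qform X v + m * (norm v)\<^sup>2 \<le> qform X' v" for v
  proof -
    have "m * (norm v)\<^sup>2 \<le> m * (norm (Gp p v))\<^sup>2"
      using m norm_Gp_ge[of v p] by (simp add: power_mono)
    also have "\<dots> = (\<Sum>i\<in>UNIV. m * (q $ i \<bullet> Gp p v)\<^sup>2)"
      using frames_parseval[OF q(1), of "Gp p v" "Gp p v"]
      by (simp add: power2_norm_eq_inner sum_distrib_left[symmetric]) (simp add: power2_eq_square)
    also have "\<dots> \<le> (\<Sum>i\<in>UNIV. (\<mu> i - ?d $ i) * (q $ i \<bullet> Gp p v)\<^sup>2)"
      using m_le by (intro sum_mono mult_right_mono) auto
    also have "\<dots> = qform X' v - qform X v"
      by (simp add: qX qX' sum_subtractf left_diff_distrib)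
    finally show ?thesis by simp
  qed
  have "X' *v Gi p (q $ i) = \<mu> i *\<^sub>R Gp p (q $ i)" for i
  proof -
    have "X' *v Gi p (q $ i) = (\<Sum>j\<in>UNIV. (\<mu> j * (q $ j \<bullet> q $ i)) *\<^sub>R Gp p (q $ j))"
      by (simp add: X'v Gp_adjoint)
    also have "\<dots> = (\<Sum>j\<in>UNIV. if j = i then \<mu> i *\<^sub>R Gp p (q $ i) else 0)"
      by (intro sum.cong) (auto simp: frames_inner[OF q(1)])
    finally show ?thesis by simp
  qed
  then have "sigma k (shape p X') = (1 / vslope p) ^ k * esym k UNIV \<mu>"
    by (rule sigma_shape[OF q(1)])
  then have "sigma k (shape p X') < 0"
    using \<mu>(2) vslope_pos(1)[of p] by (simp add: mult_less_0_iff)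
  then show ?thesis using that X'sym m ge by blast
qed

section \<open>The convexity defect\<close>

lemma qform_sum:
  fixes b :: "'n::finite \<Rightarrow> real^'n"
  shows "qform X (\<Sum>i\<in>UNIV. c i *\<^sub>R b i) = (\<Sum>i\<in>UNIV. \<Sum>l\<in>UNIV. (c i * c l) * (b i \<bullet> (X *v b l)))"
proof -
  have "X *v (\<Sum>i\<in>UNIV. c i *\<^sub>R b i) = (\<Sum>i\<in>UNIV. c i *\<^sub>R (X *v b i))"
    by (simp add: linear_sum[OF matrix_vector_mul_linear] matrix_vector_mult_scaleR)
  then show ?thesis
    by (simp add: qform_def inner_sum_left inner_sum_right mult.assoc sum_distrib_left)
      (subst sum.swap, simp add: mult_ac)
qed

text \<open>The sum is the trace of \<open>X\<close> against the sum of the rank-one matrices of the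
  vectors \<open>e i *\<^sub>R b i\<close>, and mixing these vectors by an orthogonal matrix does
  not change that sum.\<close>

lemma frames_qform_sum:
  fixes b :: "'n::finite \<Rightarrow> real^'n"
  assumes "r \<in> frames"
  shows "(\<Sum>j\<in>UNIV. qform X (\<Sum>i\<in>UNIV. (r $ j $ i * e i) *\<^sub>R b i)) = (\<Sum>i\<in>UNIV. (e i)\<^sup>2 * qform X (b i))"
proof -
  have "(\<Sum>j\<in>UNIV. qform X (\<Sum>i\<in>UNIV. (r $ j $ i * e i) *\<^sub>R b i))
    = (\<Sum>j\<in>UNIV. \<Sum>i\<in>UNIV. \<Sum>l\<in>UNIV. (r $ j $ i * r $ j $ l) * (e i * e l * (b i \<bullet> (X *v b l))))"
    by (simp add: qform_sum mult_ac)
  also have "\<dots> = (\<Sum>i\<in>UNIV. \<Sum>l\<in>UNIV. \<Sum>j\<in>UNIV. (r $ j $ i * r $ j $ l) * (e i * e l * (b i \<bullet> (X *v b l))))"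
    by (subst sum.swap, rule sum.cong[OF refl], rule sum.swap)
  also have "\<dots> = (\<Sum>i\<in>UNIV. \<Sum>l\<in>UNIV. if i = l then (e i)\<^sup>2 * qform X (b i) else 0)"
    by (intro sum.cong refl)
      (auto simp: sum_distrib_right[symmetric] frames_columns[OF assms] qform_def power2_eq_square)
  finally show ?thesis by simp
qed

text \<open>With \<open>C\<close> the matrix of columns \<open>Gp p (Gi p' (\<surd>a\<^sub>i q\<^sub>i))\<close>, the matrices \<open>C C\<^sup>T\<close> and \<open>Y = C\<^sup>T C\<close> are
  orthogonally similar, so the left-hand side below, a trace against \<open>C C\<^sup>T\<close>, is a trace against \<open>Y\<close>
  in another frame.\<close>

lemma change_of_metric:
  fixes p p' a :: "real^'n::finite" and X Y :: "real^'n^'n"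
  assumes q: "q \<in> frames" and a: "\<And>i. a $ i > 0" and r: "r \<in> frames"
    and Y: "\<And>i l. Y $ i $ l = sqrt (a $ i) * sqrt (a $ l) * (Gp p (Gi p' (q $ i)) \<bullet> Gp p (Gi p' (q $ l)))"
    and eig: "\<And>j. Y *v r $ j = d j *\<^sub>R r $ j"
  obtains f where "f \<in> frames" "\<And>j. d j > 0"
    "(\<Sum>i\<in>UNIV. a $ i * qform X (Gi p' (q $ i))) = (\<Sum>j\<in>UNIV. d j * qform X (Gi p (f $ j)))"
proof -
  let ?b = "\<lambda>i. Gi p' (q $ i)"
  define z where "z j = (\<Sum>i\<in>UNIV. (r $ j $ i * sqrt (a $ i)) *\<^sub>R q $ i)" for j
  define h where "h j = (\<Sum>i\<in>UNIV. (r $ j $ i * sqrt (a $ i)) *\<^sub>R ?b i)" for j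
  have h: "h j = Gi p' (z j)" for j
    by (simp add: h_def z_def linear_sum[OF linear_Gi] linear_scale[OF linear_Gi])
  \<comment> \<open>\<open>Y\<close> is the Gram matrix of the scaled vectors
    \<open>Gp p (?b i)\<close>. Mixing them by the eigenvectors \<open>r\<close> of \<open>Y\<close>
    makes them orthogonal, with squared lengths \<open>d\<close>.\<close>
  have inner: "Gp p (h j) \<bullet> Gp p (h l) = (if j = l then d l else 0)" for j l
  proof -
    have "Gp p (h j) = (\<Sum>i\<in>UNIV. (r $ j $ i * sqrt (a $ i)) *\<^sub>R Gp p (?b i))" for j
      by (simp add: h_def linear_sum[OF linear_Gp] linear_scale[OF linear_Gp])
    then have "Gp p (h j) \<bullet> Gp p (h l) = (\<Sum>i\<in>UNIV. \<Sum>m\<in>UNIV. r $ j $ i * (Y $ i $ m * r $ l $ m))"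
      by (simp add: inner_sum_left inner_sum_right Y mult_ac sum_distrib_left)
        (subst sum.swap, simp add: mult_ac)
    also have "\<dots> = r $ j \<bullet> (Y *v r $ l)"
      by (simp add: inner_vec_def matrix_vector_mult_def sum_distrib_left)
    also have "\<dots> = (if j = l then d l else 0)" by (simp add: eig frames_inner[OF r])
    finally show ?thesis .
  qed
  \<comment> \<open>All weights \<open>a $ i\<close> have to be positive here: then \<open>r\<close>
    can be recovered from \<open>z\<close>, and no \<open>h j\<close> vanishes.\<close>
  have dpos: "d j > 0" for j
  proof -
    have "h j \<noteq> 0"
    proof
      assume "h j = 0"
      then have "z j = 0" using h[of j] Gp_Gi[of p' "z j"] linear_0[OF linear_Gp] by metis
      moreover have "q $ l \<bullet> z j = r $ j $ l * sqrt (a $ l)" for l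
      proof -
        have "q $ l \<bullet> z j = (\<Sum>i\<in>UNIV. if i = l then r $ j $ l * sqrt (a $ l) else 0)"
          unfolding z_def inner_sum_right by (intro sum.cong) (auto simp: frames_inner[OF q])
        then show ?thesis by simp
      qed
      ultimately have "r $ j $ l = 0" for l using a[of l] by (metis inner_zero_right less_irrefl mult_eq_0_iff real_sqrt_eq_0_iff)
      then have "r $ j = 0" by (simp add: vec_eq_iff)
      then show False using frames_norm[OF r, of j] by simp
    qed
    then have "0 < norm (h j)" by simp
    also have "\<dots> \<le> norm (Gp p (h j))" by (rule norm_Gp_ge)
    finally have "0 < (norm (Gp p (h j)))\<^sup>2" by simp
    then show ?thesis using inner[of j j] by (simp add: power2_norm_eq_inner)
  qed
  define f where "f = (\<chi> j. (1 / sqrt (d j)) *\<^sub>R Gp p (h j))"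
  have f: "f \<in> frames"
    unfolding frames_def f_def
    by (auto simp: inner less_imp_le[OF dpos] less_imp_neq[OF dpos, symmetric])
  have "(\<Sum>j\<in>UNIV. d j * qform X (Gi p (f $ j))) = (\<Sum>j\<in>UNIV. qform X (h j))"
    by (intro sum.cong refl)
      (simp add: f_def linear_scale[OF linear_Gi] qform_scaleR power_divide
        less_imp_le[OF dpos] less_imp_neq[OF dpos, symmetric])
  also have "\<dots> = (\<Sum>i\<in>UNIV. (sqrt (a $ i))\<^sup>2 * qform X (?b i))"
    unfolding h_def by (rule frames_qform_sum[OF r])
  also have "\<dots> = (\<Sum>i\<in>UNIV. a $ i * qform X (?b i))" using a by (simp add: less_imp_le)
  finally show ?thesis using that[OF f dpos] by simp
qed

text \<open>A nonzero determinant has a nonzero Leibniz term. This pairs the eigenvectors of a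
  diagonal matrix with its entries, even if entries coincide.\<close>

lemma frames_perm:
  fixes r :: "real^'n^'n::finite"
  assumes "r \<in> frames"
  obtains \<pi> where "bij \<pi>" "\<And>j. r $ j $ \<pi> j \<noteq> 0"
proof -
  have "det r \<noteq> 0"
    using frames_orthogonal[of r] assms by (metis det_I det_mul mult_zero_left zero_neq_one)
  then obtain \<pi> where "\<pi> permutes (UNIV :: 'n set)" "(\<Prod>i\<in>UNIV. r $ i $ \<pi> i) \<noteq> 0"
    unfolding det_def by (metis (mono_tags, lifting) mem_Collect_eq mult_zero_right sum.neutral)
  then show ?thesis using that[of \<pi>] by (auto simp: permutes_bij)
qed

text \<open>The lower bound \<open>- K\<close> on \<open>X\<close> forces the quadratic terms to be
  of size \<open>K * \<tau> m\<close>, so the weighted gradient differences \<open>t\<close> tend to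
  0. Seen from the metric of \<open>p\<close>, the weights then converge to a permutation
  \<open>D\<close> of a limit of \<open>a\<close>, and strict admissibility for \<open>D\<close>
  contradicts \<open>bad\<close>. Limits are taken only in \<open>a\<close> and \<open>r\<close>:
  \<open>X\<close> has no upper bound, and its values enter only through \<open>key\<close>.\<close>

lemma convexity_defect_sequence:
  fixes p p' a :: "nat \<Rightarrow> real^'n::finite" and X q :: "nat \<Rightarrow> real^'n^'n"
  assumes k: "1 \<le> k" "k \<le> CARD('n)" and c: "c > 0" and K: "K \<ge> 0"
    and \<tau>: "\<And>m. \<tau> m > 0" "\<tau> \<longlonglongrightarrow> 0"
    and p: "\<And>m. norm (p m) \<le> P" "\<And>m. norm (p' m) \<le> P"
    and X: "\<And>m. transpose (X m) = X m" "\<And>m v. - K * (norm v)\<^sup>2 \<le> qform (X m) v"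
    and adm: "\<And>m. adm k (p m) (X m - c *\<^sub>R mat 1)"
    and q: "\<And>m. q m \<in> frames"
    and a: "\<And>m. a m \<in> dcone k" "\<And>m i. a m $ i > 0" "\<And>m. (\<Sum>i\<in>UNIV. a m $ i) = 1"
    and bad: "\<And>m. (\<Sum>i\<in>UNIV. a m $ i * (qform (X m) (Gi (p' m) (q m $ i)) + ((p m - p' m) \<bullet> Gi (p' m) (q m $ i))\<^sup>2 / \<tau> m)) < 0"
  shows False
proof -
  have P: "P \<ge> 0" using p(1)[of 0] norm_ge_zero order_trans by blast
  let ?b = "\<lambda>m i. Gi (p' m) (q m $ i)"
  have nb: "norm (?b m i) \<le> 1" for m i
    using norm_Gi_le[of "p' m" "q m $ i"] frames_norm[OF q, of m i] by simp
  \<comment> \<open>The weight enters through its square root, so that \<open>t\<close> is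
    controlled also where \<open>a m $ i\<close> tends to 0 and the difference
    \<open>p m - p' m\<close> itself is not small in that direction.\<close>
  define t where "t m i = sqrt (a m $ i) * ((p m - p' m) \<bullet> ?b m i)" for m i
  define s where "s m i = sqrt (a m $ i) * (p' m \<bullet> ?b m i)" for m i
  have a1: "a m $ i \<le> 1" for m i
    using sum_mono2[of UNIV "{i}" "\<lambda>i. a m $ i"] a(2,3) by (simp add: less_imp_le)
  have split: "(\<Sum>i\<in>UNIV. a m $ i * qform (X m) (?b m i)) + (\<Sum>i\<in>UNIV. (t m i)\<^sup>2) / \<tau> m < 0" for m
    using bad[of m] a(2)[of m]
    by (simp add: t_def power_mult_distrib distrib_left sum.distrib sum_divide_distrib less_imp_le)
  have Xb: "- K \<le> qform (X m) (?b m i)" for m i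
  proof -
    have "K * (norm (?b m i))\<^sup>2 \<le> K * 1"
      using nb[of m i] K by (intro mult_left_mono) (auto simp: power_le_one)
    then show ?thesis using X(2)[where m = m and v = "?b m i"] by simp
  qed
  have sumX: "- K \<le> (\<Sum>i\<in>UNIV. a m $ i * qform (X m) (?b m i))" for m
  proof -
    have "- K = (\<Sum>i\<in>UNIV. a m $ i * - K)" by (simp add: sum_negf sum_distrib_right[symmetric] a(3))
    also have "\<dots> \<le> (\<Sum>i\<in>UNIV. a m $ i * qform (X m) (?b m i))"
      using Xb a(2) by (intro sum_mono mult_left_mono) (auto simp: less_imp_le)
    finally show ?thesis .
  qed
  have t_small: "\<bar>t m i\<bar> \<le> sqrt (K * \<tau> m)" for m i
  proof -
    have "(\<Sum>i\<in>UNIV. (t m i)\<^sup>2) / \<tau> m \<le> K" using split[of m] sumX[of m] by linarith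
    then have "(\<Sum>i\<in>UNIV. (t m i)\<^sup>2) \<le> K * \<tau> m" using \<tau>(1)[of m] by (simp add: field_simps)
    moreover have "(t m i)\<^sup>2 \<le> (\<Sum>i\<in>UNIV. (t m i)\<^sup>2)" by (rule member_le_sum) auto
    ultimately have "(t m i)\<^sup>2 \<le> K * \<tau> m" by linarith
    then show ?thesis by (metis real_sqrt_abs real_sqrt_le_mono)
  qed
  have "(\<lambda>m. sqrt (K * \<tau> m)) \<longlonglongrightarrow> sqrt (K * 0)" by (intro tendsto_intros \<tau>)
  then have t0: "(\<lambda>m. t m i) \<longlonglongrightarrow> 0" for i
    by (rule Lim_null_comparison[rotated, OF tendsto_eq_rhs]) (auto simp: t_small)
  have s_bd: "\<bar>s m i\<bar> \<le> P" for m i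
  proof -
    have "\<bar>p' m \<bullet> ?b m i\<bar> \<le> norm (p' m) * norm (?b m i)" by (rule Cauchy_Schwarz_ineq2)
    also have "\<dots> \<le> P * 1" using p nb P by (intro mult_mono) auto
    finally have "\<bar>p' m \<bullet> ?b m i\<bar> \<le> P" by simp
    moreover have "sqrt (a m $ i) \<le> 1" using a1[of m i] by simp
    ultimately have "\<bar>s m i\<bar> \<le> 1 * P" unfolding s_def abs_mult
      using a(2)[of m i] P by (intro mult_mono) (auto simp: less_imp_le)
    then show ?thesis by simp
  qed
  define Y where "Y m = (\<chi> i l. sqrt (a m $ i) * sqrt (a m $ l) * (Gp (p m) (?b m i) \<bullet> Gp (p m) (?b m l)))" for m
  have Ysym: "transpose (Y m) = Y m" for m
    by (simp add: Y_def transpose_def vec_eq_iff inner_commute mult_ac)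
  \<comment> \<open>The metric of \<open>p'\<close> alone would give the diagonal matrix of
    \<open>a\<close>, because \<open>Gp (p' m)\<close> takes the vectors \<open>?b m i\<close> to an
    orthonormal frame. Writing \<open>p\<close> as \<open>p'\<close> plus the difference leaves only
    errors that contain a factor \<open>t\<close>.\<close>
  have Yeq: "Y m $ i $ l = (if i = l then a m $ i else 0) + (s m i * t m l + t m i * s m l + t m i * t m l)" for m i l
  proof -
    have "?b m i \<bullet> ?b m l + (p' m \<bullet> ?b m i) * (p' m \<bullet> ?b m l) = (if i = l then 1 else 0)"
      using Gp_inner[of "p' m" "?b m i" "?b m l"] frames_inner[OF q, of m i l] by simp
    moreover have pb: "p m \<bullet> ?b m i = p' m \<bullet> ?b m i + (p m - p' m) \<bullet> ?b m i" for i by (simp add: inner_diff_left)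
    ultimately have "Gp (p m) (?b m i) \<bullet> Gp (p m) (?b m l) = (if i = l then 1 else 0)
        + ((p' m \<bullet> ?b m i) * ((p m - p' m) \<bullet> ?b m l) + ((p m - p' m) \<bullet> ?b m i) * (p' m \<bullet> ?b m l)
          + ((p m - p' m) \<bullet> ?b m i) * ((p m - p' m) \<bullet> ?b m l))"
      unfolding Gp_inner pb by (simp only: distrib_left distrib_right)
    then have "Y m $ i $ l = sqrt (a m $ i) * sqrt (a m $ l) * (if i = l then 1 else 0)
        + (s m i * t m l + t m i * s m l + t m i * t m l)"
      by (simp only: Y_def s_def t_def vec_lambda_beta distrib_left mult_ac)
    moreover have "sqrt (a m $ i) * sqrt (a m $ l) * (if i = l then 1 else 0) = (if i = l then a m $ i else 0)"
      using a(2)[of m i] by (cases "i = l") auto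
    ultimately show ?thesis by simp
  qed
  have "\<exists>r\<in>frames. \<forall>i. Y m *v (r $ i) = qform (Y m) (r $ i) *\<^sub>R r $ i" for m
    by (rule diagonalising_frame[OF Ysym mat_frames, of m "0"]) blast
  then obtain r where r: "\<And>m. r m \<in> frames" "\<And>m i. Y m *v (r m $ i) = qform (Y m) (r m $ i) *\<^sub>R r m $ i"
    by metis
  define d where "d m = (\<chi> j. qform (Y m) (r m $ j))" for m
  have eig: "Y m *v (r m $ j) = d m $ j *\<^sub>R r m $ j" for m j using r(2) by (simp add: d_def)
  let ?A = "dcone k \<inter> {a :: real^'n. (\<Sum>i\<in>UNIV. a $ i) = 1}"
  have cA: "compact ?A"
  proof -
    have "closed ?A" by (intro closed_Int closed_dcone closed_Collect_eq continuous_intros)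
    moreover have "norm x \<le> 1" if "x \<in> ?A" for x
      using norm_le_l1_cart[of x] dcone_nonneg[of x k] that by simp
    then have "bounded ?A" by (auto simp: bounded_iff)
    ultimately show ?thesis by (simp add: compact_eq_bounded_closed)
  qed
  have "seq_compact (?A \<times> (frames :: (real^'n^'n) set))"
    by (intro compact_imp_seq_compact compact_Times cA compact_frames)
  moreover have "\<forall>m. (a m, r m) \<in> ?A \<times> frames" using a r by simp
  ultimately obtain L \<phi> where L: "L \<in> ?A \<times> frames" and \<phi>: "strict_mono \<phi>" and lim: "((\<lambda>m. (a m, r m)) \<circ> \<phi>) \<longlonglongrightarrow> L"
    by (rule seq_compactE)
  define A R where "A = fst L" and "R = snd L"
  have A: "A \<in> dcone k" "(\<Sum>i\<in>UNIV. A $ i) = 1" and R: "R \<in> frames"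
    using L by (auto simp: A_def R_def mem_Times_iff)
  have aA: "(\<lambda>m. a (\<phi> m) $ i) \<longlonglongrightarrow> A $ i" and rR: "(\<lambda>m. r (\<phi> m) $ j $ i) \<longlonglongrightarrow> R $ j $ i" for i j
    using tendsto_fst[OF lim] tendsto_snd[OF lim] by (auto simp: o_def A_def R_def intro!: tendsto_vec_nth)
  have t0': "(\<lambda>m. t (\<phi> m) i) \<longlonglongrightarrow> 0" for i
    using LIMSEQ_subseq_LIMSEQ[OF t0 \<phi>] by (simp add: o_def)
  have st0: "(\<lambda>m. s (\<phi> m) i * t (\<phi> m) l) \<longlonglongrightarrow> 0" for i l
  proof (rule Lim_null_comparison)
    have "(\<lambda>m. P * \<bar>t (\<phi> m) l\<bar>) \<longlonglongrightarrow> P * \<bar>0\<bar>" by (intro tendsto_intros t0')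
    then show "(\<lambda>m. P * \<bar>t (\<phi> m) l\<bar>) \<longlonglongrightarrow> 0" by simp
    show "\<forall>\<^sub>F m in sequentially. norm (s (\<phi> m) i * t (\<phi> m) l) \<le> P * \<bar>t (\<phi> m) l\<bar>"
      by (intro always_eventually allI) (simp add: abs_mult mult_right_mono s_bd)
  qed
  have YA: "(\<lambda>m. Y (\<phi> m) $ i $ l) \<longlonglongrightarrow> (if i = l then A $ i else 0)" for i l
  proof -
    have "(\<lambda>m. t (\<phi> m) i * s (\<phi> m) l) \<longlonglongrightarrow> 0" using st0[of l i] by (simp add: mult.commute)
    then have "(\<lambda>m. s (\<phi> m) i * t (\<phi> m) l + t (\<phi> m) i * s (\<phi> m) l + t (\<phi> m) i * t (\<phi> m) l) \<longlonglongrightarrow> 0 + 0 + 0 * 0"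
      by (intro tendsto_add tendsto_mult st0 t0')
    then have "(\<lambda>m. (if i = l then a (\<phi> m) $ i else 0) + (s (\<phi> m) i * t (\<phi> m) l + t (\<phi> m) i * s (\<phi> m) l + t (\<phi> m) i * t (\<phi> m) l))
       \<longlonglongrightarrow> (if i = l then A $ i else 0) + 0"
      by (intro tendsto_add) (auto intro: aA)
    then show ?thesis by (simp add: Yeq)
  qed
  have Yr: "(\<lambda>m. (Y (\<phi> m) *v r (\<phi> m) $ j) $ i) \<longlonglongrightarrow> A $ i * R $ j $ i" for i j
  proof -
    have "(\<lambda>m. \<Sum>l\<in>UNIV. Y (\<phi> m) $ i $ l * r (\<phi> m) $ j $ l) \<longlonglongrightarrow> (\<Sum>l\<in>UNIV. (if i = l then A $ i else 0) * R $ j $ l)"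
      by (intro tendsto_sum tendsto_mult YA rR)
    moreover have "(\<Sum>l\<in>UNIV. (if i = l then A $ i else 0) * R $ j $ l) = A $ i * R $ j $ i"
      by (simp add: if_distrib[of "\<lambda>x. x * _"] cong: if_cong)
    ultimately show ?thesis by (simp add: matrix_vector_mult_def)
  qed
  define D where "D = (\<chi> j. \<Sum>i\<in>UNIV. R $ j $ i * (A $ i * R $ j $ i))"
  have dD: "(\<lambda>m. d (\<phi> m) $ j) \<longlonglongrightarrow> D $ j" for j
  proof -
    have "(\<lambda>m. \<Sum>i\<in>UNIV. r (\<phi> m) $ j $ i * (Y (\<phi> m) *v r (\<phi> m) $ j) $ i) \<longlonglongrightarrow> (\<Sum>i\<in>UNIV. R $ j $ i * (A $ i * R $ j $ i))"
      by (intro tendsto_sum tendsto_mult Yr rR)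
    then show ?thesis by (simp add: d_def D_def qform_def inner_vec_def)
  qed
  have AR: "A $ i * R $ j $ i = D $ j * R $ j $ i" for i j
  proof (rule LIMSEQ_unique[OF Yr])
    have "(\<lambda>m. d (\<phi> m) $ j * r (\<phi> m) $ j $ i) \<longlonglongrightarrow> D $ j * R $ j $ i" by (intro tendsto_mult dD rR)
    then show "(\<lambda>m. (Y (\<phi> m) *v r (\<phi> m) $ j) $ i) \<longlonglongrightarrow> D $ j * R $ j $ i" by (simp add: eig)
  qed
  \<comment> \<open>The limit of \<open>Y\<close> is the diagonal matrix of \<open>A\<close>, with
    eigenvector \<open>R $ j\<close> for the eigenvalue \<open>D $ j\<close>. A nonzero entry of
    \<open>R $ j\<close> at \<open>\<pi> j\<close> forces this eigenvalue to be
    \<open>A $ \<pi> j\<close>.\<close>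
  obtain \<pi> where \<pi>: "bij \<pi>" "\<And>j. R $ j $ \<pi> j \<noteq> 0" using frames_perm[OF R] by blast
  have D: "D = (\<chi> j. A $ \<pi> j)"
    using AR[of "\<pi> _"] \<pi>(2) by (simp add: vec_eq_iff) (metis mult_right_cancel)
  have Dd: "D \<in> dcone k" unfolding D by (rule dcone_permute[OF \<pi>(1) A(1)])
  have Dsum: "(\<Sum>j\<in>UNIV. D $ j) = 1"
    using A(2) sum.reindex_bij_betw[of \<pi> UNIV UNIV "\<lambda>i. A $ i"] \<pi>(1) by (simp add: D)
  have D0: "0 \<le> D $ j" for j by (rule dcone_nonneg[OF Dd])
  \<comment> \<open>\<open>c\<close> reduced by the smallest possible value of the squared length of
    \<open>Gi (p m)\<close> on unit vectors with \<open>norm (p m) \<le> P\<close>.\<close>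
  define c' where "c' = c / (1 + P\<^sup>2)"
  have c': "c' > 0" unfolding c'_def using c by (intro divide_pos_pos) (auto intro: add_pos_nonneg)
  \<comment> \<open>The weights \<open>d\<close> are split into \<open>\<theta> * D\<close>, to
    which strict admissibility applies, and a nonnegative remainder of small mass, where the lower
    bound \<open>- K\<close> suffices.\<close>
  have key: "\<theta> * c' < K * ((\<Sum>j\<in>UNIV. d m $ j) - \<theta>)" if \<theta>: "0 \<le> \<theta>" "\<And>j. \<theta> * D $ j \<le> d m $ j" for \<theta> m
  proof -
    obtain f where f: "f \<in> frames" "\<And>j. d m $ j > 0"
      "(\<Sum>i\<in>UNIV. a m $ i * qform (X m) (?b m i)) = (\<Sum>j\<in>UNIV. d m $ j * qform (X m) (Gi (p m) (f $ j)))"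
      by (rule change_of_metric[OF q a(2) r(1) _ eig, where p = "p m" and p' = "p' m" and X = "X m"])
        (auto simp: Y_def)
    let ?x = "\<lambda>j. qform (X m) (Gi (p m) (f $ j))"
    have "0 \<le> (\<Sum>i\<in>UNIV. (t m i)\<^sup>2) / \<tau> m" using \<tau>(1)[of m] by (intro divide_nonneg_pos sum_nonneg) auto
    then have neg: "(\<Sum>j\<in>UNIV. d m $ j * ?x j) < 0" using split[of m] f(3) by linarith
    have nG: "norm (Gi (p m) (f $ j)) \<le> 1" for j
      using norm_Gi_le[of "p m" "f $ j"] frames_norm[OF f(1)] by simp
    have xK: "- K \<le> ?x j" for j
    proof -
      have "K * (norm (Gi (p m) (f $ j)))\<^sup>2 \<le> K * 1"
        using nG K by (intro mult_left_mono) (auto simp: power_le_one)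
      then show ?thesis using X(2)[of "Gi (p m) (f $ j)" m] by simp
    qed
    have Gc: "c' \<le> c * (norm (Gi (p m) (f $ j)))\<^sup>2" for j
    proof -
      have "1 \<le> vslope (p m) * norm (Gi (p m) (f $ j))"
        using norm_Gi_ge[of "f $ j" "p m"] frames_norm[OF f(1)] by simp
      then have "1 \<le> (vslope (p m) * norm (Gi (p m) (f $ j)))\<^sup>2"
        by (metis one_le_power)
      also have "\<dots> = (1 + (norm (p m))\<^sup>2) * (norm (Gi (p m) (f $ j)))\<^sup>2"
        by (simp add: power_mult_distrib vslope_sq power2_norm_eq_inner)
      also have "\<dots> \<le> (1 + P\<^sup>2) * (norm (Gi (p m) (f $ j)))\<^sup>2"
        using p(1)[of m] by (intro mult_right_mono) (auto intro: power_mono)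
      finally have "c * 1 \<le> c * ((1 + P\<^sup>2) * (norm (Gi (p m) (f $ j)))\<^sup>2)"
        using c by (intro mult_left_mono) auto
      moreover have "1 + P\<^sup>2 > 0" by (simp add: add_pos_nonneg)
      ultimately show ?thesis by (simp add: c'_def field_simps)
    qed
    have "0 \<le> (\<Sum>j\<in>UNIV. D $ j * qform (X m - c *\<^sub>R mat 1) (Gi (p m) (f $ j)))"
      using adm[of m] f(1) Dd by (auto simp: adm_def)
    also have "\<dots> = (\<Sum>j\<in>UNIV. D $ j * (?x j - c * (norm (Gi (p m) (f $ j)))\<^sup>2))"
      by (simp add: qform_def matrix_vector_mult_diff_rdistrib scaleR_matrix_vector_assoc[symmetric]
        inner_diff_right power2_norm_eq_inner)
    also have "\<dots> \<le> (\<Sum>j\<in>UNIV. D $ j * (?x j - c'))"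
      using Gc D0 by (intro sum_mono mult_left_mono) (auto simp: diff_left_mono)
    also have "\<dots> = (\<Sum>j\<in>UNIV. D $ j * ?x j) - c'"
      by (simp add: right_diff_distrib sum_subtractf sum_distrib_right[symmetric] Dsum)
    finally have Dx: "c' \<le> (\<Sum>j\<in>UNIV. D $ j * ?x j)" by simp
    have "\<theta> * c' - K * ((\<Sum>j\<in>UNIV. d m $ j) - \<theta>) \<le> \<theta> * (\<Sum>j\<in>UNIV. D $ j * ?x j) + (\<Sum>j\<in>UNIV. (d m $ j - \<theta> * D $ j) * - K)"
      using mult_left_mono[OF Dx \<theta>(1)]
      by (simp add: sum_subtractf sum_distrib_left[symmetric] sum_distrib_right[symmetric] sum_negf Dsum algebra_simps)
    also have "\<dots> \<le> \<theta> * (\<Sum>j\<in>UNIV. D $ j * ?x j) + (\<Sum>j\<in>UNIV. (d m $ j - \<theta> * D $ j) * ?x j)"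
      using \<theta>(2) xK by (intro add_left_mono sum_mono mult_left_mono) auto
    also have "\<dots> = (\<Sum>j\<in>UNIV. d m $ j * ?x j)"
      by (simp add: sum_distrib_left sum.distrib[symmetric] algebra_simps)
    finally show ?thesis using neg by linarith
  qed
  have dpos: "d m $ j > 0" for m j
    by (rule change_of_metric[OF q a(2) r(1) _ eig, where p = "p m" and p' = "p' m" and X = "X m"])
        (auto simp: Y_def)
  \<comment> \<open>The midpoint between 1 and \<open>K / (K + c')\<close>, the value at which the
    gain \<open>\<theta> * c'\<close> would just balance the loss
    \<open>K * (1 - \<theta>)\<close>.\<close>
  define \<theta> where "\<theta> = (K + c' / 2) / (K + c')"
  have "\<theta> * (K + c') = K + c' / 2" "0 < \<theta>" "\<theta> < 1" using c' K by (auto simp: \<theta>_def)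
  then have \<theta>: "0 < \<theta>" "\<theta> < 1" "\<theta> * c' - K * (1 - \<theta>) = c' / 2"
    by (simp_all add: algebra_simps)
  have "eventually (\<lambda>m. \<theta> * D $ j \<le> d (\<phi> m) $ j) sequentially" for j
  proof (cases "D $ j = 0")
    case True
    then show ?thesis using dpos by (simp add: less_imp_le)
  next
    case False
    then have "D $ j > 0" using D0[of j] by simp
    then have "\<theta> * D $ j < D $ j" using \<theta> by simp
    then show ?thesis by (rule eventually_mono[OF order_tendstoD(1)[OF dD]]) simp
  qed
  then have 1: "eventually (\<lambda>m. \<forall>j. \<theta> * D $ j \<le> d (\<phi> m) $ j) sequentially"
    by (simp add: eventually_all_finite)
  have "(\<lambda>m. K * ((\<Sum>j\<in>UNIV. d (\<phi> m) $ j) - \<theta>)) \<longlonglongrightarrow> K * ((\<Sum>j\<in>UNIV. D $ j) - \<theta>)"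
    by (intro tendsto_intros dD)
  moreover have "K * ((\<Sum>j\<in>UNIV. D $ j) - \<theta>) < \<theta> * c'" using \<theta>(3) c' by (simp add: Dsum)
  ultimately have 2: "eventually (\<lambda>m. K * ((\<Sum>j\<in>UNIV. d (\<phi> m) $ j) - \<theta>) < \<theta> * c') sequentially"
    by (rule order_tendstoD)
  obtain m where "\<forall>j. \<theta> * D $ j \<le> d (\<phi> m) $ j" "K * ((\<Sum>j\<in>UNIV. d (\<phi> m) $ j) - \<theta>) < \<theta> * c'"
    using eventually_happens[OF eventually_conj[OF 1 2]] by auto
  then show False using key[of \<theta> "\<phi> m"] \<theta>(1) by simp
qed

text \<open>\<open>\<tau>\<close> must be uniform over all jets within the bounds \<open>P\<close>,
  \<open>K\<close> and \<open>c\<close>, because one value of \<open>\<tau>\<close> serves all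
  points of the ball at once. The failing weights are first made positive and normalised to total
  mass 1, as the compactness argument requires.\<close>

proposition convexity_defect_inequality:
  fixes P K c :: real
  assumes k: "1 \<le> k" "k \<le> CARD('n::finite)" and c: "c > 0" and K: "K \<ge> 0"
  shows "\<exists>\<tau>>0. \<forall>(p :: real^'n) p' X q a. norm p \<le> P \<and> norm p' \<le> P \<and> transpose X = X \<and>
      (\<forall>v. - K * (norm v)\<^sup>2 \<le> qform X v) \<and> adm k p (X - c *\<^sub>R mat 1) \<and> q \<in> frames \<and> a \<in> dcone k \<longrightarrow>
      0 \<le> (\<Sum>i\<in>UNIV. a $ i * (qform X (Gi p' (q $ i)) + ((p - p') \<bullet> Gi p' (q $ i))\<^sup>2 / \<tau>))"
proof -
  define S where "S \<tau> p p' X q a = (\<Sum>i\<in>UNIV. a $ i * (qform X (Gi p' (q $ i)) + ((p - p') \<bullet> Gi p' (q $ i))\<^sup>2 / \<tau>))"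
     for \<tau> :: real and p p' a :: "real^'n" and X q :: "real^'n^'n"
  define good where "good \<tau> p p' X q \<longleftrightarrow> 0 < \<tau> \<and> norm p \<le> P \<and> norm p' \<le> P \<and> transpose X = X
      \<and> (\<forall>v. - K * (norm v)\<^sup>2 \<le> qform X v) \<and> adm k p (X - c *\<^sub>R mat 1) \<and> q \<in> frames"
     for \<tau> :: real and p p' :: "real^'n" and X q :: "real^'n^'n"
  have "\<exists>\<tau>0>0. \<forall>\<tau> p p' X q a. \<tau> \<le> \<tau>0 \<longrightarrow> good \<tau> p p' X q \<longrightarrow> a \<in> dcone k \<longrightarrow> 0 \<le> S \<tau> p p' X q a"
  proof (rule ccontr)
    assume "\<not> ?thesis"
    then have "\<forall>m. \<exists>\<tau> p p' X q a. \<tau> \<le> inverse (real (Suc m)) \<and> good \<tau> p p' X q \<and> a \<in> dcone k \<and> S \<tau> p p' X q a < 0"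
      by (meson inverse_positive_iff_positive not_le of_nat_0_less_iff zero_less_Suc)
    then obtain \<tau> p p' X q a where *: "\<And>m. \<tau> m \<le> inverse (real (Suc m))" "\<And>m. good (\<tau> m) (p m) (p' m) (X m) (q m)"
      "\<And>m. a m \<in> dcone k" "\<And>m. S (\<tau> m) (p m) (p' m) (X m) (q m) (a m) < 0"
      by metis
    have "\<exists>b. b \<in> dcone k \<and> (\<forall>i. b $ i > 0) \<and> (\<Sum>i\<in>UNIV. b $ i) = 1 \<and> S (\<tau> m) (p m) (p' m) (X m) (q m) b < 0" for m
    proof -
      let ?S = "S (\<tau> m) (p m) (p' m) (X m) (q m)" and ?e = "(\<chi> i. 1) :: real^'n"
      have lin: "?S (u + c *\<^sub>R v) = ?S u + c * ?S v" for u v c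
        unfolding S_def sum_distrib_left sum.distrib[symmetric]
        by (intro sum.cong refl) (simp add: distrib_right)
      \<comment> \<open>Small enough for the sum, which is linear in the weights, to stay negative
        after \<open>\<delta> *\<^sub>R ?e\<close> is added.\<close>
      define \<delta> where "\<delta> = - ?S (a m) / (2 * (\<bar>?S ?e\<bar> + 1))"
      have \<delta>: "\<delta> > 0" unfolding \<delta>_def using *(4)[of m] by (intro divide_pos_pos) auto
      let ?b = "a m + \<delta> *\<^sub>R ?e"
      have "\<delta> * ?S ?e \<le> \<delta> * (\<bar>?S ?e\<bar> + 1)" using \<delta> by (intro mult_left_mono) auto
      also have "\<dots> = - ?S (a m) / 2"
        by (simp add: \<delta>_def add_pos_nonneg divide_simps)
      finally have neg: "?S ?b < 0" using *(4)[of m] by (simp add: lin)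
      have bd: "?b \<in> dcone k" using dcone_add[OF *(3) dcone_scaleR[OF one_dcone[OF k]]] \<delta> by simp
      have pos: "?b $ i > 0" for i using dcone_nonneg[OF *(3), of m i] \<delta> by simp
      define s where "s = (\<Sum>i\<in>UNIV. ?b $ i)"
      have s: "s > 0" unfolding s_def using pos by (intro sum_pos) auto
      let ?c = "(1 / s) *\<^sub>R ?b"
      have "?S ?c = (1 / s) * ?S ?b" using lin[of 0 "1 / s" ?b] by (simp add: S_def)
      then have "?S ?c < 0" using neg s by (simp add: divide_less_0_iff)
      moreover have "?c \<in> dcone k" by (rule dcone_scaleR[OF bd]) (use s in simp)
      moreover have "?c $ i > 0" for i using pos[of i] s by simp
      moreover have "(\<Sum>i\<in>UNIV. ?c $ i) = 1"
        using s by (simp only: vector_scaleR_component real_scaleR_def sum_distrib_left[symmetric] s_def[symmetric]) simp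
      ultimately show ?thesis by blast
    qed
    then obtain b where b: "\<And>m. b m \<in> dcone k" "\<And>m i. b m $ i > 0" "\<And>m. (\<Sum>i\<in>UNIV. b m $ i) = 1"
      "\<And>m. S (\<tau> m) (p m) (p' m) (X m) (q m) (b m) < 0"
      by metis
    have "\<tau> \<longlonglongrightarrow> 0"
      by (rule Lim_null_comparison[OF _ LIMSEQ_inverse_real_of_nat])
        (use * in \<open>auto simp: good_def less_imp_le intro!: always_eventually\<close>)
    then show False
      using convexity_defect_sequence[OF k c K, of \<tau> p P p' X q b] b(1-3) *(2) b(4)
      by (simp add: good_def S_def)
  qed
  then obtain \<tau> where "\<tau> > 0" "\<And>p p' X q a. good \<tau> p p' X q \<Longrightarrow> a \<in> dcone k \<Longrightarrow> 0 \<le> S \<tau> p p' X q a"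
    by blast
  then show ?thesis by (intro exI[of _ \<tau>]) (simp add: good_def S_def)
qed

section \<open>Smooth functions\<close>

definition has_partials :: "(real^'n::finite) set \<Rightarrow> (real^'n \<Rightarrow> real) \<Rightarrow> ('n \<Rightarrow> real^'n \<Rightarrow> real) \<Rightarrow> bool" where
  "has_partials S f D \<longleftrightarrow> (\<forall>x\<in>S. (f has_derivative (\<lambda>h. \<Sum>i\<in>UNIV. h $ i * D i x)) (at x))"

text \<open>Infinite differentiability as a greatest fixed point: no order of differentiation is
  counted, and closure properties follow by a single coinduction.\<close>

coinductive smooth_on :: "(real^'n::finite) set \<Rightarrow> (real^'n \<Rightarrow> real) \<Rightarrow> bool" for S where
  "has_partials S f D \<Longrightarrow> (\<And>i. smooth_on S (D i)) \<Longrightarrow> smooth_on S f"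

text \<open>A set of functions whose partial derivatives lie in the algebra it generates consists of smooth
  functions: this is coinduction for \<^const>\<open>smooth_on\<close> up to the algebra operations.\<close>

inductive alg :: "(real^'n::finite) set \<Rightarrow> (real^'n \<Rightarrow> real) set \<Rightarrow> (real^'n \<Rightarrow> real) \<Rightarrow> bool" for S B where
  base: "f \<in> B \<Longrightarrow> alg S B f"
| const: "alg S B (\<lambda>x. c)"
| add: "alg S B f \<Longrightarrow> alg S B g \<Longrightarrow> alg S B (\<lambda>x. f x + g x)"
| mult: "alg S B f \<Longrightarrow> alg S B g \<Longrightarrow> alg S B (\<lambda>x. f x * g x)"
| inv: "alg S B f \<Longrightarrow> (\<And>x. x \<in> S \<Longrightarrow> f x \<noteq> 0) \<Longrightarrow> alg S B (\<lambda>x. inverse (f x))"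

lemma alg_sum: "(\<And>j. j \<in> J \<Longrightarrow> alg S B (f j)) \<Longrightarrow> alg S B (\<lambda>x. \<Sum>j\<in>J. f j x)"
  by (induction J rule: infinite_finite_induct) (auto intro: alg.intros)

lemma alg_partials:
  assumes B: "\<And>f. f \<in> B \<Longrightarrow> \<exists>D. has_partials S f D \<and> (\<forall>i. alg S B (D i))"
    and f: "alg S B f"
  shows "\<exists>D. has_partials S f D \<and> (\<forall>i. alg S B (D i))"
  using f
proof induction
  case (base f)
  then show ?case by (rule B)
next
  case (const c)
  then show ?case by (intro exI[of _ "\<lambda>i x. 0"]) (auto simp: has_partials_def intro: alg.const)
next
  case (add f g)
  then obtain D E where "has_partials S f D" "has_partials S g E" "\<And>i. alg S B (D i)" "\<And>i. alg S B (E i)" by blast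
  then show ?case
    by (intro exI[of _ "\<lambda>i x. D i x + E i x"])
      (auto simp: has_partials_def sum.distrib distrib_left intro!: alg.add derivative_eq_intros)
next
  case (mult f g)
  then obtain D E where D: "has_partials S f D" "has_partials S g E" "\<And>i. alg S B (D i)" "\<And>i. alg S B (E i)" by blast
  have "has_partials S (\<lambda>x. f x * g x) (\<lambda>i x. f x * E i x + g x * D i x)"
    unfolding has_partials_def
  proof
    fix x assume x: "x \<in> S"
    have "((\<lambda>x. f x * g x) has_derivative (\<lambda>h. f x * (\<Sum>i\<in>UNIV. h $ i * E i x) + (\<Sum>i\<in>UNIV. h $ i * D i x) * g x)) (at x)"
      using D x by (intro has_derivative_mult) (auto simp: has_partials_def)
    then show "((\<lambda>x. f x * g x) has_derivative (\<lambda>h. \<Sum>i\<in>UNIV. h $ i * (f x * E i x + g x * D i x))) (at x)"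
      by (rule has_derivative_eq_rhs) (auto simp: sum_distrib_left sum_distrib_right sum.distrib[symmetric] algebra_simps)
  qed
  then show ?case using D mult by (intro exI[of _ "\<lambda>i x. f x * E i x + g x * D i x"]) (auto intro!: alg.add alg.mult)
next
  case (inv f)
  then obtain D where D: "has_partials S f D" "\<And>i. alg S B (D i)" by blast
  have "has_partials S (\<lambda>x. inverse (f x)) (\<lambda>i x. (-1) * (inverse (f x) * (inverse (f x) * D i x)))"
    unfolding has_partials_def
  proof
    fix x assume x: "x \<in> S"
    have "((\<lambda>x. inverse (f x)) has_derivative (\<lambda>h. - (inverse (f x) * (\<Sum>i\<in>UNIV. h $ i * D i x) * inverse (f x)))) (at x)"
      using D x inv by (intro Deriv.has_derivative_inverse) (auto simp: has_partials_def)
    then show "((\<lambda>x. inverse (f x)) has_derivative (\<lambda>h. \<Sum>i\<in>UNIV. h $ i * ((-1) * (inverse (f x) * (inverse (f x) * D i x))))) (at x)"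
      by (rule has_derivative_eq_rhs) (auto simp: sum_distrib_left sum_distrib_right sum_negf[symmetric] algebra_simps)
  qed
  moreover have "alg S B (\<lambda>x. (-1) * (inverse (f x) * (inverse (f x) * D i x)))" for i
    by (intro alg.mult alg.const alg.inv inv.hyps D)
  ultimately show ?case by blast
qed

lemma alg_smooth:
  assumes B: "\<And>f. f \<in> B \<Longrightarrow> \<exists>D. has_partials S f D \<and> (\<forall>i. alg S B (D i))"
    and f: "alg S B f"
  shows "smooth_on S f"
  using f
proof (coinduction arbitrary: f)
  case (smooth_on f)
  obtain D where "has_partials S f D" "\<forall>i. alg S B (D i)" using alg_partials[OF B smooth_on] by blast
  then show ?case by (intro exI[of _ f] exI[of _ D]) auto
qed

lemma alg_smooth_on:
  assumes "alg S (Collect (smooth_on S)) f" shows "smooth_on S f"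
  by (rule alg_smooth[OF _ assms]) (auto elim!: smooth_on.cases intro: alg.base)

lemma smooth_const: "smooth_on S (\<lambda>x. c)"
  by (rule alg_smooth_on[OF alg.const])

lemma smooth_add: "smooth_on S f \<Longrightarrow> smooth_on S g \<Longrightarrow> smooth_on S (\<lambda>x. f x + g x)"
  by (rule alg_smooth_on[OF alg.add[OF alg.base alg.base]]) auto

lemma smooth_mult: "smooth_on S f \<Longrightarrow> smooth_on S g \<Longrightarrow> smooth_on S (\<lambda>x. f x * g x)"
  by (rule alg_smooth_on[OF alg.mult[OF alg.base alg.base]]) auto

lemma smooth_sum: "(\<And>j. j \<in> J \<Longrightarrow> smooth_on S (h j)) \<Longrightarrow> smooth_on S (\<lambda>x. \<Sum>j\<in>J. h j x)"
  by (rule alg_smooth_on[OF alg_sum[OF alg.base]]) auto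

lemma smooth_coord:
  fixes j :: "'n::finite" shows "smooth_on S (\<lambda>x. x $ j)"
proof (rule alg_smooth[where B = "{\<lambda>x. x $ j}"])
  have "((\<lambda>x. x $ j) has_derivative (\<lambda>h. \<Sum>i\<in>UNIV. h $ i * (if i = j then 1 else 0))) (at x)" for x :: "real^'n"
    by (rule has_derivative_eq_rhs[OF bounded_linear_imp_has_derivative[OF bounded_linear_vec_nth]])
      (simp add: if_distrib cong: if_cong)
  then show "\<exists>D. has_partials S f D \<and> (\<forall>i. alg S {\<lambda>x. x $ j} (D i))" if "f \<in> {\<lambda>x. x $ j}" for f
    using that by (intro exI[of _ "\<lambda>i x. if i = j then 1 else 0"]) (auto simp: has_partials_def intro: alg.const)
qed (auto intro: alg.base)

text \<open>It suffices to adjoin \<open>ln (f x)\<close> itself to the generators: its partial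
  derivatives \<open>inverse (f x) * D i x\<close> lie in the algebra already.\<close>

lemma smooth_ln:
  assumes f: "smooth_on S f" and pos: "\<And>x. x \<in> S \<Longrightarrow> f x > 0"
  shows "smooth_on S (\<lambda>x. ln (f x))"
proof (rule alg_smooth[where B = "insert (\<lambda>x. ln (f x)) (Collect (smooth_on S))"])
  let ?B = "insert (\<lambda>x. ln (f x)) (Collect (smooth_on S))"
  fix g assume "g \<in> ?B"
  then show "\<exists>D. has_partials S g D \<and> (\<forall>i. alg S ?B (D i))"
  proof
    assume g: "g = (\<lambda>x. ln (f x))"
    obtain D where D: "has_partials S f D" "\<And>i. smooth_on S (D i)" using f by cases auto
    have "has_partials S g (\<lambda>i x. inverse (f x) * D i x)"
      unfolding has_partials_def g
    proof
      fix x assume x: "x \<in> S"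
      have "((\<lambda>x. ln (f x)) has_derivative (\<lambda>h. (\<Sum>i\<in>UNIV. h $ i * D i x) * inverse (f x))) (at x)"
        by (rule DERIV_compose_FDERIV[where f = ln and g = f, OF DERIV_ln[OF pos[OF x]]]) (use D x in \<open>simp add: has_partials_def\<close>)
      then show "((\<lambda>x. ln (f x)) has_derivative (\<lambda>h. \<Sum>i\<in>UNIV. h $ i * (inverse (f x) * D i x))) (at x)"
        by (rule has_derivative_eq_rhs) (simp add: sum_distrib_right sum_distrib_left mult_ac)
    qed
    moreover have "alg S ?B (\<lambda>x. inverse (f x) * D i x)" for i
      using f D(2) pos by (intro alg.mult alg.inv alg.base) (auto simp: less_imp_neq[symmetric])
    ultimately show ?thesis by blast
  next
    assume "g \<in> Collect (smooth_on S)"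
    then show ?thesis by (auto elim!: smooth_on.cases intro: alg.base)
  qed
qed (auto intro: alg.base)

lemma smooth_exp_linear:
  fixes q :: "real^'n::finite" shows "smooth_on S (\<lambda>x. exp (q \<bullet> x))"
proof (rule alg_smooth[where B = "{\<lambda>x. exp (q \<bullet> x)}"])
  have "((\<lambda>x. exp (q \<bullet> x)) has_derivative (\<lambda>h. \<Sum>i\<in>UNIV. h $ i * (q $ i * exp (q \<bullet> x)))) (at x)" for x :: "real^'n"
  proof -
    have "((\<lambda>x. exp (q \<bullet> x)) has_derivative (\<lambda>h. (q \<bullet> h) * exp (q \<bullet> x))) (at x)"
      by (auto intro!: derivative_eq_intros)
    then show ?thesis
      by (rule has_derivative_eq_rhs) (simp add: inner_vec_def sum_distrib_right mult_ac)
  qed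
  then show "\<exists>D. has_partials S f D \<and> (\<forall>i. alg S {\<lambda>x. exp (q \<bullet> x)} (D i))" if "f \<in> {\<lambda>x. exp (q \<bullet> x)}" for f
    using that by (intro exI[of _ "\<lambda>i x. q $ i * exp (q \<bullet> x)"])
      (auto simp: has_partials_def intro!: alg.mult[OF alg.const alg.base])
qed (auto intro: alg.base)

section \<open>From smooth functions to the classes \<open>Cm_on\<close> and
  \<open>Cinf_on\<close>\<close>

lemma has_partials_partial_deriv:
  assumes "has_partials S f D" "x \<in> S"
  shows "partial_deriv i f x = D i x" "(f has_derivative (\<lambda>h. \<Sum>i\<in>UNIV. h $ i * D i x)) (at x)"
proof -
  show d: "(f has_derivative (\<lambda>h. \<Sum>i\<in>UNIV. h $ i * D i x)) (at x)"
    using assms by (simp add: has_partials_def)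
  have "frechet_derivative f (at x) = (\<lambda>h. \<Sum>i\<in>UNIV. h $ i * D i x)"
    using frechet_derivative_at[OF d] by simp
  then show "partial_deriv i f x = D i x"
    by (simp add: partial_deriv_def axis_def if_distrib[of "\<lambda>x. x * _"] cong: if_cong)
qed

lemma smooth_on_cong:
  assumes "open S" "\<And>x. x \<in> S \<Longrightarrow> f x = g x" "smooth_on S f"
  shows "smooth_on S g"
proof -
  obtain D where D: "has_partials S f D" "\<And>i. smooth_on S (D i)" using assms(3) by cases auto
  have "has_partials S g D"
    unfolding has_partials_def
    using has_partials_partial_deriv(2)[OF D(1)] has_derivative_transform_within_open[OF _ assms(1)] assms(2) by blast
  then show ?thesis using D(2) by (rule smooth_on.intros)
qed

lemma smooth_on_partial_deriv:
  assumes S: "open S" and f: "smooth_on S f"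
  shows "smooth_on S (partial_deriv i f)" "has_partials S f (\<lambda>i. partial_deriv i f)"
proof -
  obtain D where D: "has_partials S f D" "\<And>i. smooth_on S (D i)" using f by cases auto
  have eq: "partial_deriv i f x = D i x" if "x \<in> S" for i x by (rule has_partials_partial_deriv[OF D(1) that])
  show "smooth_on S (partial_deriv i f)" by (rule smooth_on_cong[OF S _ D(2)[of i]]) (simp add: eq)
  show "has_partials S f (\<lambda>i. partial_deriv i f)" using D(1) by (simp add: has_partials_def eq)
qed

lemma smooth_on_continuous: "smooth_on S f \<Longrightarrow> continuous_on S f"
  by (erule smooth_on.cases)
    (auto simp: has_partials_def intro!: continuous_at_imp_continuous_on dest: has_derivative_continuous)

lemma smooth_on_differentiable: "smooth_on S f \<Longrightarrow> x \<in> S \<Longrightarrow> f differentiable (at x)"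
  by (erule smooth_on.cases) (auto simp: has_partials_def differentiable_def)

lemma smooth_on_iter_partial: "open S \<Longrightarrow> smooth_on S f \<Longrightarrow> smooth_on S (iter_partial is f)"
  by (induction "is") (auto simp: iter_partial_def intro: smooth_on_partial_deriv)

lemma smooth_on_Cm_on: "open S \<Longrightarrow> smooth_on S f \<Longrightarrow> Cm_on m f S"
  unfolding Cm_on_def by (auto intro: smooth_on_differentiable smooth_on_continuous smooth_on_iter_partial)

lemma smooth_on_Cinf_on: "open S \<Longrightarrow> smooth_on S f \<Longrightarrow> Cinf_on f S"
  unfolding Cinf_on_def by (auto intro: smooth_on_Cm_on)

lemma smooth_on_subset: "smooth_on S f \<Longrightarrow> T \<subseteq> S \<Longrightarrow> smooth_on T f"
proof (coinduction arbitrary: f)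
  case (smooth_on f)
  then obtain D where "has_partials S f D" "\<And>i. smooth_on S (D i)" by (auto elim: smooth_on.cases)
  then show ?case using smooth_on by (intro exI[of _ f] exI[of _ D]) (auto simp: has_partials_def)
qed

definition dird :: "real^'n::finite \<Rightarrow> (real^'n \<Rightarrow> real) \<Rightarrow> real^'n \<Rightarrow> real" where
  "dird b f x = (\<Sum>i\<in>UNIV. b $ i * partial_deriv i f x)"

lemma smooth_on_dird: "open S \<Longrightarrow> smooth_on S f \<Longrightarrow> smooth_on S (dird b f)"
  unfolding dird_def[abs_def] by (intro smooth_sum smooth_mult smooth_const smooth_on_partial_deriv)

lemma has_derivative_dird: "open S \<Longrightarrow> smooth_on S f \<Longrightarrow> x \<in> S \<Longrightarrow> (f has_derivative (\<lambda>h. dird h f x)) (at x)"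
  using smooth_on_partial_deriv(2)[of S f] by (simp add: has_partials_def dird_def)

lemma dird_grad: "dird b f x = grad f x \<bullet> b"
  by (simp add: dird_def grad_def inner_vec_def mult.commute)

definition hess :: "(real^'n::finite \<Rightarrow> real) \<Rightarrow> real^'n \<Rightarrow> real^'n^'n" where
  "hess f x = (\<chi> i j. partial_deriv j (partial_deriv i f) x)"

lemma grad_has_derivative:
  assumes "open S" "smooth_on S f" "x \<in> S"
  shows "(grad f has_derivative (\<lambda>h. hess f x *v h)) (at x)"
proof -
  have "((\<lambda>y. partial_deriv i f y) has_derivative (\<lambda>h. (hess f x *v h) $ i)) (at x)" for i
    using has_derivative_dird[OF assms(1) smooth_on_partial_deriv(1)[OF assms(1,2)] assms(3), of i]
    by (simp add: dird_def hess_def matrix_vector_mult_def mult.commute)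
  then have "\<And>i. ((\<lambda>y. grad f y $ i) has_derivative (\<lambda>h. (hess f x *v h) $ i)) (at x)"
    by (simp add: grad_def)
  then show ?thesis
    by (subst has_derivative_componentwise_within) (auto simp: Basis_vec_def inner_axis)
qed

lemma dird_has_real_derivative:
  assumes "open S" "smooth_on S f" "x + s *\<^sub>R v \<in> S"
  shows "((\<lambda>s. f (x + s *\<^sub>R v)) has_real_derivative dird v f (x + s *\<^sub>R v)) (at s)"
proof -
  have "(f has_derivative (\<lambda>h. dird h f (x + s *\<^sub>R v))) (at (x + s *\<^sub>R v))"
    by (rule has_derivative_dird[OF assms])
  then have "((f \<circ> (\<lambda>s. x + s *\<^sub>R v)) has_derivative (\<lambda>h. dird h f (x + s *\<^sub>R v)) \<circ> (\<lambda>t. t *\<^sub>R v)) (at s)"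
    by (intro diff_chain_at) (auto intro!: derivative_eq_intros)
  moreover have "(\<lambda>h. dird h f (x + s *\<^sub>R v)) \<circ> (\<lambda>t. t *\<^sub>R v) = (\<lambda>t. dird v f (x + s *\<^sub>R v) * t)"
    by (auto simp: dird_grad)
  ultimately show ?thesis by (simp add: has_field_derivative_def o_def)
qed

lemma qform_hess: 
  assumes "open S" "smooth_on S f" "x \<in> S"
  shows "qform (hess f x) v = dird v (dird v f) x"
proof -
  have "(dird v f has_derivative (\<lambda>h. dird h (dird v f) x)) (at x)"
    by (intro has_derivative_dird[OF assms(1)] smooth_on_dird assms)
  moreover have "((\<lambda>y. grad f y \<bullet> v) has_derivative (\<lambda>h. (hess f x *v h) \<bullet> v)) (at x)"
    by (intro has_derivative_inner_left grad_has_derivative[OF assms])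
  then have "(dird v f has_derivative (\<lambda>h. (hess f x *v h) \<bullet> v)) (at x)"
    by (simp add: dird_grad[abs_def])
  ultimately have "(\<lambda>h. dird h (dird v f) x) = (\<lambda>h. (hess f x *v h) \<bullet> v)" by (rule has_derivative_unique)
  then show ?thesis by (metis inner_commute qform_def)
qed

lemma second_difference_mvt:
  fixes f :: "real^'n::finite \<Rightarrow> real"
  assumes S: "open S" and f: "smooth_on S f" and B: "cball x (2 * t) \<subseteq> S" and t: "t > 0"
  obtains y where "y \<in> cball x (2 * t)"
    "f (x + t *\<^sub>R axis i 1 + t *\<^sub>R axis j 1) - f (x + t *\<^sub>R axis i 1) - f (x + t *\<^sub>R axis j 1) + f x
      = t * t * partial_deriv j (partial_deriv i f) y"
proof -
  let ?e = "axis i 1 :: real^'n" and ?g = "axis j 1 :: real^'n"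
  have in_B: "x + a *\<^sub>R ?e + b *\<^sub>R ?g \<in> cball x (2 * t)" if "0 \<le> a" "a \<le> t" "0 \<le> b" "b \<le> t" for a b
  proof -
    have "norm (a *\<^sub>R ?e + b *\<^sub>R ?g) \<le> norm (a *\<^sub>R ?e) + norm (b *\<^sub>R ?g)" by (rule norm_triangle_ineq)
    also have "\<dots> = a + b" using that by (simp add: norm_axis_1)
    also have "\<dots> \<le> 2 * t" using that by simp
    finally show ?thesis using norm_minus_cancel[of "a *\<^sub>R ?e + b *\<^sub>R ?g"] by (simp add: dist_norm add.assoc)
  qed
  have dird_axis: "dird (axis i 1) h y = partial_deriv i h y" for i h and y :: "real^'n"
    by (simp add: dird_def axis_def if_distrib[of "\<lambda>x. x * _"] cong: if_cong)
  define F where "F s = f (x + t *\<^sub>R ?g + s *\<^sub>R ?e) - f (x + s *\<^sub>R ?e)" for s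
  have dF: "(F has_real_derivative (partial_deriv i f (x + t *\<^sub>R ?g + s *\<^sub>R ?e) - partial_deriv i f (x + s *\<^sub>R ?e))) (at s)"
    if "0 \<le> s" "s \<le> t" for s
    unfolding F_def dird_axis[symmetric]
    using in_B[of s t] in_B[of s 0] that B t
    by (intro DERIV_diff dird_has_real_derivative[OF S f]) (auto simp: algebra_simps)
  then obtain \<xi> where \<xi>: "\<xi> > 0" "\<xi> < t" "F t - F 0 = (t - 0) * (partial_deriv i f (x + t *\<^sub>R ?g + \<xi> *\<^sub>R ?e) - partial_deriv i f (x + \<xi> *\<^sub>R ?e))"
    using MVT2[OF t dF] by blast
  have dG: "((\<lambda>s. partial_deriv i f (x + \<xi> *\<^sub>R ?e + s *\<^sub>R ?g)) has_real_derivative partial_deriv j (partial_deriv i f) (x + \<xi> *\<^sub>R ?e + s *\<^sub>R ?g)) (at s)"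
    if "0 \<le> s" "s \<le> t" for s
  proof -
    have "x + \<xi> *\<^sub>R ?e + s *\<^sub>R ?g \<in> S"
      by (rule subsetD[OF B in_B]) (use that \<xi> in simp_all)
    from dird_has_real_derivative[OF S smooth_on_partial_deriv(1)[OF S f] this, of i]
    show ?thesis unfolding dird_axis .
  qed
  then obtain \<eta> where \<eta>: "\<eta> > 0" "\<eta> < t" "partial_deriv i f (x + \<xi> *\<^sub>R ?e + t *\<^sub>R ?g) - partial_deriv i f (x + \<xi> *\<^sub>R ?e + 0 *\<^sub>R ?g)
      = (t - 0) * partial_deriv j (partial_deriv i f) (x + \<xi> *\<^sub>R ?e + \<eta> *\<^sub>R ?g)"
    using MVT2[OF t dG] by blast
  show ?thesis
  proof (rule that)
    show "x + \<xi> *\<^sub>R ?e + \<eta> *\<^sub>R ?g \<in> cball x (2 * t)" using in_B \<xi> \<eta> by simp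
    show "f (x + t *\<^sub>R ?e + t *\<^sub>R ?g) - f (x + t *\<^sub>R ?e) - f (x + t *\<^sub>R ?g) + f x
      = t * t * partial_deriv j (partial_deriv i f) (x + \<xi> *\<^sub>R ?e + \<eta> *\<^sub>R ?g)"
      using \<xi>(3) \<eta>(3) by (simp add: F_def algebra_simps)
  qed
qed

text \<open>Schwarz's theorem. The mixed second difference does not depend on the order of
  \<open>i\<close> and \<open>j\<close>, and by the mean value theorem it yields both mixed
  derivatives at points arbitrarily close to \<open>x\<close>.\<close>

lemma hess_symmetric:
  assumes S: "open S" and f: "smooth_on S f" and x: "x \<in> S"
  shows "transpose (hess f x) = hess f x"
proof -
  have "partial_deriv j (partial_deriv i f) x = partial_deriv i (partial_deriv j f) x" for i j
  proof (rule ccontr)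
    let ?a = "partial_deriv j (partial_deriv i f)" and ?b = "partial_deriv i (partial_deriv j f)"
    assume "?a x \<noteq> ?b x"
    then have e: "\<bar>?a x - ?b x\<bar> / 2 > 0" by simp
    have c: "isCont ?a x" "isCont ?b x"
      using smooth_on_continuous[OF smooth_on_partial_deriv(1)[OF S smooth_on_partial_deriv(1)[OF S f]]] x S
      by (auto simp: continuous_on_eq_continuous_at)
    obtain d1 where d1: "d1 > 0" "\<And>y. dist y x < d1 \<Longrightarrow> dist (?a y) (?a x) < \<bar>?a x - ?b x\<bar> / 2"
      using c(1) e unfolding continuous_at_eps_delta by blast
    obtain d2 where d2: "d2 > 0" "\<And>y. dist y x < d2 \<Longrightarrow> dist (?b y) (?b x) < \<bar>?a x - ?b x\<bar> / 2"
      using c(2) e unfolding continuous_at_eps_delta by blast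
    obtain r where r: "r > 0" "cball x r \<subseteq> S" using S x open_contains_cball by blast
    define t where "t = min (min d1 d2) r / 4"
    have t: "t > 0" "2 * t < d1" "2 * t < d2" "2 * t \<le> r" using d1 d2 r by (auto simp: t_def)
    have B: "cball x (2 * t) \<subseteq> S" using r t by auto
    obtain y1 where y1: "y1 \<in> cball x (2 * t)"
      "f (x + t *\<^sub>R axis i 1 + t *\<^sub>R axis j 1) - f (x + t *\<^sub>R axis i 1) - f (x + t *\<^sub>R axis j 1) + f x = t * t * ?a y1"
      by (rule second_difference_mvt[OF S f B t(1), where i = i and j = j])
    obtain y2 where y2: "y2 \<in> cball x (2 * t)"
      "f (x + t *\<^sub>R axis j 1 + t *\<^sub>R axis i 1) - f (x + t *\<^sub>R axis j 1) - f (x + t *\<^sub>R axis i 1) + f x = t * t * ?b y2"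
      by (rule second_difference_mvt[OF S f B t(1), where i = j and j = i])
    have "t * t * ?a y1 = t * t * ?b y2" using y1(2) y2(2) by (simp add: algebra_simps)
    then have "?a y1 = ?b y2" using t by simp
    moreover have "dist (?a y1) (?a x) < \<bar>?a x - ?b x\<bar> / 2" using y1(1) t by (intro d1) (auto simp: dist_commute)
    moreover have "dist (?b y2) (?b x) < \<bar>?a x - ?b x\<bar> / 2" using y2(1) t by (intro d2) (auto simp: dist_commute)
    moreover have "\<bar>?a x - ?b x\<bar> \<le> \<bar>?a y1 - ?a x\<bar> + \<bar>?a y1 - ?b x\<bar>" by linarith
    ultimately show False unfolding dist_real_def by simp
  qed
  then show ?thesis by (simp add: hess_def transpose_def vec_eq_iff)
qed

section \<open>Superjets and convolution kernels\<close>

text \<open>Differentiating \<open>Du / w\<close> produces the Hessian over \<open>w\<close> minus a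
  rank-one correction along \<open>p\<close>; by \<open>Gi_Gi\<close> this is the inverse metric
  applied to the Hessian, over \<open>w\<close>.\<close>

lemma H_curv_eq:
  assumes S: "open S" and f: "smooth_on S f" and x: "x \<in> S"
  shows "H_curv k f x = sigma k (shape (grad f x) (hess f x))"
proof -
  let ?p = "grad f x" and ?X = "hess f x" and ?w = "vslope (grad f x)"
  have g: "(grad f has_derivative (\<lambda>h. ?X *v h)) (at x)" by (rule grad_has_derivative[OF S f x])
  have A: "((\<lambda>y. sqrt (1 + grad f y \<bullet> grad f y)) has_derivative (\<lambda>h. (?p \<bullet> (?X *v h)) / ?w)) (at x)"
  proof -
    have "1 + ?p \<bullet> ?p > 0" by (simp add: add_pos_nonneg)
    then have "((\<lambda>y. sqrt (1 + grad f y \<bullet> grad f y)) has_derivative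
      (\<lambda>h. (0 + (?p \<bullet> (?X *v h) + (?X *v h) \<bullet> ?p)) * (inverse (sqrt (1 + ?p \<bullet> ?p)) / 2))) (at x)"
      by (intro DERIV_compose_FDERIV[where f = sqrt] DERIV_real_sqrt has_derivative_add has_derivative_const has_derivative_inner g)
    then show ?thesis
      by (rule has_derivative_eq_rhs)
        (simp add: fun_eq_iff vslope_def power2_norm_eq_inner inner_commute divide_simps)
  qed
  have w: "sqrt (1 + ?p \<bullet> ?p) = ?w" by (simp add: vslope_def power2_norm_eq_inner)
  have B: "((\<lambda>y. inverse (sqrt (1 + grad f y \<bullet> grad f y))) has_derivative
      (\<lambda>h. - (inverse ?w * ((?p \<bullet> (?X *v h)) / ?w) * inverse ?w))) (at x)"
    by (rule has_derivative_eq_rhs[OF Deriv.has_derivative_inverse[OF _ A]]) (simp_all only: w vslope_pos not_False_eq_True)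
  have "((\<lambda>y. inverse (sqrt (1 + grad f y \<bullet> grad f y)) *\<^sub>R grad f y) has_derivative
      (\<lambda>h. inverse ?w *\<^sub>R (?X *v h) + (- (inverse ?w * ((?p \<bullet> (?X *v h)) / ?w) * inverse ?w)) *\<^sub>R ?p)) (at x)"
    by (rule has_derivative_eq_rhs[OF has_derivative_scaleR[OF B g]]) (simp only: w)
  moreover have "inverse ?w *\<^sub>R (?X *v h) + (- (inverse ?w * ((?p \<bullet> (?X *v h)) / ?w) * inverse ?w)) *\<^sub>R ?p = shape ?p ?X *v h" for h
    by (simp add: shape_mult Gi_Gi scaleR_diff_right power2_eq_square divide_inverse mult_ac)
  ultimately have "((\<lambda>y. grad f y /\<^sub>R sqrt (1 + (norm (grad f y))\<^sup>2)) has_derivative (\<lambda>h. shape ?p ?X *v h)) (at x)"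
    by (simp add: power2_norm_eq_inner)
  then have "frechet_derivative (\<lambda>y. grad f y /\<^sub>R sqrt (1 + (norm (grad f y))\<^sup>2)) (at x) = (\<lambda>h. shape ?p ?X *v h)"
    by (rule frechet_derivative_at[symmetric])
  then show ?thesis by (simp add: H_curv_def jacobian_def)
qed

text \<open>The remainder of smaller order than the square of the distance is written out with
  \<open>\<epsilon>\<close>, and the half makes \<open>X\<close> comparable with
  \<open>hess\<close>. Symmetry of \<open>X\<close> is kept as a separate hypothesis.\<close>

definition superjet :: "(real^'n::finite \<Rightarrow> real) \<Rightarrow> real^'n \<Rightarrow> real^'n \<Rightarrow> real^'n^'n \<Rightarrow> bool" where
  "superjet f x p X \<longleftrightarrow> (\<forall>\<epsilon>>0. \<exists>\<delta>>0. \<forall>y. norm (y - x) < \<delta> \<longrightarrow>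
     f y \<le> f x + p \<bullet> (y - x) + qform X (y - x) / 2 + \<epsilon> * (norm (y - x))\<^sup>2)"

lemma smooth_superjet:
  assumes S: "open S" and f: "smooth_on S f" and x: "x \<in> S"
  shows "superjet f x (grad f x) (hess f x)"
  unfolding superjet_def
proof (intro allI impI)
  fix \<epsilon> :: real assume e: "\<epsilon> > 0"
  let ?p = "grad f x" and ?X = "hess f x"
  obtain r where r: "r > 0" "ball x r \<subseteq> S" using S x open_contains_ball by blast
  obtain d where d: "d > 0" "\<And>y. norm (y - x) < d \<Longrightarrow> norm (grad f y - ?p - ?X *v (y - x)) \<le> \<epsilon> * norm (y - x)"
    using grad_has_derivative[OF S f x] e unfolding has_derivative_at_alt by blast
  show "\<exists>\<delta>>0. \<forall>y. norm (y - x) < \<delta> \<longrightarrow> f y \<le> f x + ?p \<bullet> (y - x) + qform ?X (y - x) / 2 + \<epsilon> * (norm (y - x))\<^sup>2"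
  proof (intro exI[of _ "min d r"] conjI allI impI)
    fix y assume y: "norm (y - x) < min d r"
    let ?v = "y - x"
    have nv: "norm (s *\<^sub>R ?v) \<le> norm ?v" if "0 \<le> s" "s \<le> 1" for s
      using that mult_right_mono[of s 1 "norm ?v"] by simp
    have inS: "x + s *\<^sub>R ?v \<in> S" if "0 \<le> s" "s \<le> 1" for s
      using nv[OF that] y r by (intro subsetD[OF r(2)]) (simp add: dist_norm)
    define h where "h s = f (x + s *\<^sub>R ?v) - (f x + s * (?p \<bullet> ?v) + s\<^sup>2 * (qform ?X ?v / 2))" for s
    have dh: "(h has_real_derivative (grad f (x + s *\<^sub>R ?v) \<bullet> ?v - (?p \<bullet> ?v + s * qform ?X ?v))) (at s)"
      if "0 \<le> s" "s \<le> 1" for s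
      unfolding h_def dird_grad[symmetric]
      by (rule derivative_eq_intros dird_has_real_derivative[OF S f inS[OF that]] refl)+ simp
    obtain s where s: "0 < s" "s < 1" "h 1 - h 0 = (1 - 0) * (grad f (x + s *\<^sub>R ?v) \<bullet> ?v - (?p \<bullet> ?v + s * qform ?X ?v))"
      using MVT2[OF zero_less_one dh] by blast
    have gen: "g \<bullet> v - (?p \<bullet> v + s * qform ?X v) = (g - ?p - ?X *v (s *\<^sub>R v)) \<bullet> v" for g v
      by (simp add: inner_diff_left qform_def matrix_vector_mult_scaleR inner_commute[of v])
    have "grad f (x + s *\<^sub>R ?v) \<bullet> ?v - (?p \<bullet> ?v + s * qform ?X ?v) = (grad f (x + s *\<^sub>R ?v) - ?p - ?X *v (s *\<^sub>R ?v)) \<bullet> ?v"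
      by (rule gen)
    also have "\<dots> \<le> norm (grad f (x + s *\<^sub>R ?v) - ?p - ?X *v (s *\<^sub>R ?v)) * norm ?v"
      by (rule norm_cauchy_schwarz)
    also have "\<dots> \<le> (\<epsilon> * norm (s *\<^sub>R ?v)) * norm ?v"
      using d(2)[of "x + s *\<^sub>R ?v"] nv[of s] s y by (intro mult_right_mono) auto
    also have "\<dots> \<le> (\<epsilon> * norm ?v) * norm ?v"
      using nv[of s] s e by (intro mult_right_mono mult_left_mono) auto
    finally have "h 1 - h 0 \<le> \<epsilon> * (norm ?v)\<^sup>2" using s(3) by (simp add: power2_eq_square)
    then show "f y \<le> f x + ?p \<bullet> ?v + qform ?X ?v / 2 + \<epsilon> * (norm ?v)\<^sup>2"
      by (simp add: h_def)
  qed (use d r in auto)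
qed

section \<open>Bump functions\<close>

text \<open>The powers of \<open>t\<close> make the family closed under differentiation: the
  derivative is a combination of the members \<open>m + 1\<close> and \<open>m + 2\<close>.\<close>

definition flat_exp :: "nat \<Rightarrow> real \<Rightarrow> real" where
  "flat_exp m t = (if t > 0 then exp (- (1 / t)) / t ^ m else 0)"

lemma pow_div_fact_le_exp: "0 \<le> x \<Longrightarrow> x ^ n / fact n \<le> exp (x::real)"
proof -
  assume x: "0 \<le> x"
  have "(\<Sum>k<Suc n. x ^ k /\<^sub>R fact k) \<le> exp x"
    unfolding exp_def by (rule sum_le_suminf[OF summable_exp_generic]) (use x in auto)
  moreover have "x ^ n /\<^sub>R fact n \<le> (\<Sum>k<Suc n. x ^ k /\<^sub>R fact k)"
    using x by (intro member_le_sum) auto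
  ultimately show ?thesis by (simp add: divide_inverse mult.commute)
qed

text \<open>One term of the exponential series at \<open>1 / t\<close> beats the pole. The order
  \<open>t\<^sup>2\<close> is just what makes the derivative at 0 exist and vanish.\<close>

lemma flat_exp_bound: 
  assumes t: "t > 0" shows "flat_exp m t \<le> fact (m + 2) * t\<^sup>2"
proof -
  have "(1 / t) ^ (m + 2) / fact (m + 2) \<le> exp (1 / t)"
    using t by (intro pow_div_fact_le_exp) auto
  then have "exp (- (1 / t)) * ((1 / t) ^ (m + 2) / fact (m + 2)) \<le> exp (- (1 / t)) * exp (1 / t)"
    by (rule mult_left_mono) simp
  also have "\<dots> = 1" by (simp add: exp_minus)
  also have "exp (- (1 / t)) * ((1 / t) ^ (m + 2) / fact (m + 2)) = exp (- (1 / t)) / (t ^ (m + 2) * fact (m + 2))"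
    by (simp add: power_divide del: fact_Suc)
  finally have "exp (- (1 / t)) \<le> t ^ (m + 2) * fact (m + 2)"
    using t by (simp add: pos_divide_le_eq del: fact_Suc)
  then have "exp (- (1 / t)) / t ^ m \<le> t ^ (m + 2) * fact (m + 2) / t ^ m"
    using t by (intro divide_right_mono) auto
  also have "\<dots> = fact (m + 2) * t\<^sup>2" using t by (simp add: power_add power2_eq_square del: fact_Suc)
  finally show ?thesis using t by (simp add: flat_exp_def del: fact_Suc)
qed

lemma flat_exp_deriv: "(flat_exp m has_real_derivative (flat_exp (m + 2) t - real m * flat_exp (m + 1) t)) (at t)"
proof (cases t "0::real" rule: linorder_cases)
  case less
  have "((\<lambda>t::real. 0) has_real_derivative 0) (at t)" by simp
  then have "(flat_exp m has_real_derivative 0) (at t)"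
    by (rule has_field_derivative_transform_within_open[where S = "{..<0}"]) (use less in \<open>auto simp: flat_exp_def\<close>)
  then show ?thesis using less by (simp add: flat_exp_def)
next
  case equal
  have "((\<lambda>h. flat_exp m h / h) \<longlongrightarrow> 0) (at 0)"
  proof (rule Lim_null_comparison)
    show "\<forall>\<^sub>F h in at 0. norm (flat_exp m h / h) \<le> fact (m + 2) * \<bar>h\<bar>"
    proof (rule eventually_mono[OF eventually_True], goal_cases)
      case (1 h)
      show ?case
      proof (cases "h > 0")
        case True
        have "flat_exp m h / h \<le> (fact (m + 2) * h\<^sup>2) / h"
          using flat_exp_bound[OF True] True by (intro divide_right_mono) auto
        moreover have "0 \<le> flat_exp m h / h" using True by (simp add: flat_exp_def)
        ultimately show ?thesis using True by (simp add: power2_eq_square)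
      next
        case False
        then have "flat_exp m h / h = 0" by (simp add: flat_exp_def)
        moreover have "0 \<le> fact (m + 2) * \<bar>h\<bar>" by (intro mult_nonneg_nonneg fact_ge_zero abs_ge_zero)
        ultimately show ?thesis by (simp only: norm_zero)
      qed
    qed
    have "((\<lambda>h. fact (m + 2) * \<bar>h\<bar>) \<longlongrightarrow> fact (m + 2) * \<bar>0 :: real\<bar>) (at 0)" by (intro tendsto_intros)
    then show "((\<lambda>h. fact (m + 2) * \<bar>h :: real\<bar>) \<longlongrightarrow> 0) (at 0)" by simp
  qed
  then show ?thesis using equal by (simp add: DERIV_def flat_exp_def)
next
  case greater
  have "((\<lambda>t. exp (- (1 / t)) / t ^ m) has_real_derivative (exp (- (1 / t)) / t ^ (m + 2) - real m * (exp (- (1 / t)) / t ^ (m + 1)))) (at t)"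
  proof (cases m)
    case 0
    then show ?thesis using greater
      by (auto intro!: derivative_eq_intros simp: power2_eq_square)
  next
    case (Suc l)
    have "((\<lambda>t. exp (- (1 / t)) / t ^ m) has_real_derivative
       ((exp (- (1 / t)) * (1 / t\<^sup>2)) * t ^ m - exp (- (1 / t)) * (real m * t ^ (m - 1))) / (t ^ m * t ^ m)) (at t)"
      using greater by (auto intro!: derivative_eq_intros simp: power2_eq_square)
    moreover have "((exp (- (1 / t)) * (1 / t\<^sup>2)) * t ^ m - exp (- (1 / t)) * (real m * t ^ (m - 1))) / (t ^ m * t ^ m)
       = exp (- (1 / t)) / t ^ (m + 2) - real m * (exp (- (1 / t)) / t ^ (m + 1))"
      using greater Suc by (simp add: field_simps power2_eq_square)
    ultimately show ?thesis by simp
  qed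
  then have "(flat_exp m has_real_derivative (exp (- (1 / t)) / t ^ (m + 2) - real m * (exp (- (1 / t)) / t ^ (m + 1)))) (at t)"
    by (rule has_field_derivative_transform_within_open[where S = "{0<..}"]) (use greater in \<open>auto simp: flat_exp_def\<close>)
  then show ?thesis using greater by (simp add: flat_exp_def)
qed

lemma smooth_flat_exp:
  fixes s :: real
  shows "smooth_on UNIV (\<lambda>x::real^'n::finite. flat_exp m (s - x \<bullet> x))"
proof (rule alg_smooth[where B = "Collect (smooth_on UNIV) \<union> range (\<lambda>m x. flat_exp m (s - x \<bullet> x))"])
  let ?B = "Collect (smooth_on UNIV) \<union> range (\<lambda>m (x::real^'n). flat_exp m (s - x \<bullet> x))"
  fix f :: "real^'n \<Rightarrow> real" assume "f \<in> ?B"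
  then show "\<exists>D. has_partials UNIV f D \<and> (\<forall>i. alg UNIV ?B (D i))"
  proof
    assume "f \<in> Collect (smooth_on UNIV)"
    then show ?thesis by (auto elim!: smooth_on.cases intro: alg.base)
  next
    assume "f \<in> range (\<lambda>m x. flat_exp m (s - x \<bullet> x))"
    then obtain m where f: "f = (\<lambda>x. flat_exp m (s - x \<bullet> x))" by blast
    let ?D = "\<lambda>i x. (- 2 * x $ i) * (flat_exp (m + 2) (s - x \<bullet> x) + (- real m) * flat_exp (m + 1) (s - x \<bullet> x))"
    have "has_partials UNIV f ?D"
      unfolding has_partials_def f
    proof
      fix x :: "real^'n"
      have "((\<lambda>x. flat_exp m (s - x \<bullet> x)) has_derivative (\<lambda>h. (0 - (x \<bullet> h + h \<bullet> x)) * (flat_exp (m + 2) (s - x \<bullet> x) - real m * flat_exp (m + 1) (s - x \<bullet> x)))) (at x)"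
        by (intro DERIV_compose_FDERIV[where f = "flat_exp m"] flat_exp_deriv has_derivative_diff has_derivative_const has_derivative_inner has_derivative_ident)
      moreover have "(0 - (x \<bullet> h + h \<bullet> x)) = (\<Sum>i\<in>UNIV. h $ i * (- 2 * x $ i))" for h
        unfolding inner_commute[of h x] by (simp add: inner_vec_def sum_negf sum_distrib_left mult_ac)
      ultimately show "((\<lambda>x. flat_exp m (s - x \<bullet> x)) has_derivative (\<lambda>h. \<Sum>i\<in>UNIV. h $ i * ?D i x)) (at x)"
        by (simp only: sum_distrib_right mult.assoc) simp
    qed
    moreover have "alg UNIV ?B (?D i)" for i
      by (intro alg.mult[OF alg.mult[OF alg.const alg.base] alg.add[OF alg.base alg.mult[OF alg.const alg.base]]])
        (auto intro: smooth_coord)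
    ultimately show ?thesis by blast
  qed
qed (auto intro: alg.base)

lemma integrable_mult_left_real:
  fixes f :: "'a::euclidean_space \<Rightarrow> real"
  shows "f integrable_on A \<Longrightarrow> (\<lambda>x. c * f x) integrable_on A"
  using integrable_cmul[of f A c] by simp

section \<open>Convolution with smooth kernels of compact support\<close>

definition cube :: "real \<Rightarrow> (real^'n::finite) set" where
  "cube s = cbox (\<chi> i. - s) (\<chi> i. s)"

lemma mem_cube: "x \<in> cube s \<longleftrightarrow> (\<forall>i. \<bar>x $ i\<bar> \<le> s)"
  by (simp add: cube_def mem_box_cart abs_le_iff) (metis minus_le_iff)

lemma norm_le_cube: "norm x \<le> s \<Longrightarrow> x \<in> cube s"
  by (auto simp: mem_cube intro: order_trans[OF component_le_norm_cart])

lemma closed_cube: "closed (cube s)" by (simp add: cube_def closed_cbox)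

definition kernel :: "real \<Rightarrow> (real^'n::finite \<Rightarrow> real) \<Rightarrow> bool" where
  "kernel s \<kappa> \<longleftrightarrow> smooth_on UNIV \<kappa> \<and> (\<forall>y. y \<notin> cube s \<longrightarrow> \<kappa> y = 0)"

text \<open>The integral runs over a fixed box that contains the support of the kernel, so that
  integrability follows from the continuity of \<open>f\<close>.\<close>

definition cv :: "real \<Rightarrow> (real^'n::finite \<Rightarrow> real) \<Rightarrow> (real^'n \<Rightarrow> real) \<Rightarrow> real^'n \<Rightarrow> real" where
  "cv s \<kappa> f x = integral (cube s) (\<lambda>y. \<kappa> y * f (x - y))"

lemma kernel_smooth: "kernel s \<kappa> \<Longrightarrow> smooth_on UNIV \<kappa>"
  by (simp add: kernel_def)

lemma kernel_continuous: "kernel s \<kappa> \<Longrightarrow> continuous_on A \<kappa>"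
  using smooth_on_continuous[of UNIV \<kappa>] continuous_on_subset by (auto simp: kernel_def)

lemma partial_deriv_zero:
  assumes "open S" "\<And>x. x \<in> S \<Longrightarrow> f x = 0" "x \<in> S"
  shows "partial_deriv i f x = 0"
proof -
  have "((\<lambda>x. 0) has_derivative (\<lambda>h. 0)) (at x)" by simp
  then have "(f has_derivative (\<lambda>h. 0)) (at x)"
    by (rule has_derivative_transform_within_open[OF _ assms(1,3)]) (simp add: assms(2))
  then have "frechet_derivative f (at x) = (\<lambda>h. 0)" by (rule frechet_derivative_at[symmetric])
  then show ?thesis by (simp add: partial_deriv_def)
qed

lemma kernel_partial: "kernel s \<kappa> \<Longrightarrow> kernel s (partial_deriv i \<kappa>)"
  unfolding kernel_def
  using partial_deriv_zero[of "- cube s" \<kappa>] closed_cube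
  by (auto intro: smooth_on_partial_deriv simp: open_Compl)

lemma kernel_dird: "kernel s \<kappa> \<Longrightarrow> kernel s (dird b \<kappa>)"
  using kernel_partial[of s \<kappa>] smooth_on_dird[of UNIV \<kappa> b]
  by (auto simp: kernel_def dird_def)

lemma cv_integrable:
  assumes "kernel s \<kappa>" "continuous_on UNIV f"
  shows "(\<lambda>y. \<kappa> y * f (x - y)) integrable_on cube s"
  unfolding cube_def
  by (intro integrable_continuous continuous_intros kernel_continuous[OF assms(1)]
      continuous_on_compose2[OF assms(2)]) auto

lemma smooth_integral_kernel:
  assumes \<kappa>: "smooth_on UNIV \<kappa>" and f: "continuous_on (cbox a b) f"
  shows "has_partials UNIV (\<lambda>x. integral (cbox a b) (\<lambda>y. \<kappa> (x - y) * f y))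
     (\<lambda>i x. integral (cbox a b) (\<lambda>y. partial_deriv i \<kappa> (x - y) * f y))"
  unfolding has_partials_def
proof
  fix x0 :: "real^'a"
  have c\<kappa>: "continuous_on A (\<lambda>z. h (g z))" if "smooth_on UNIV h" "continuous_on A g" for h and A :: "'c::topological_space set" and g :: "'c \<Rightarrow> real^'a"
    using continuous_on_compose2[OF smooth_on_continuous[OF that(1)] that(2)] by simp
  have sp: "smooth_on UNIV (partial_deriv i \<kappa>)" for i by (rule smooth_on_partial_deriv[OF open_UNIV \<kappa>])
  have cg: "continuous_on UNIV (grad \<kappa>)"
    using grad_has_derivative[OF open_UNIV \<kappa>] by (auto intro!: continuous_at_imp_continuous_on has_derivative_continuous)
  let ?fx = "\<lambda>x t. f t *\<^sub>R blinfun_inner_right (grad \<kappa> (x - t))"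
  have int: "continuous_on (cbox a b) (\<lambda>y. h (x - y) * f y)" if "smooth_on UNIV h" for h x
    by (intro continuous_intros c\<kappa>[OF that] f)
  have D: "((\<lambda>x. integral (cbox a b) (\<lambda>y. \<kappa> (x - y) * f y)) has_derivative integral (cbox a b) (?fx x0)) (at x0 within UNIV)"
  proof (rule leibniz_rule[where fx = ?fx])
    fix x t
    have "(\<kappa> has_derivative (\<lambda>h. grad \<kappa> (x - t) \<bullet> h)) (at (x - t))"
      using has_derivative_dird[OF open_UNIV \<kappa>] by (simp add: dird_grad)
    moreover have "((\<lambda>x. x - t) has_derivative (\<lambda>h. h)) (at x)" by (auto intro!: derivative_eq_intros)
    ultimately have "((\<lambda>x. \<kappa> (x - t)) has_derivative (\<lambda>h. grad \<kappa> (x - t) \<bullet> h)) (at x)"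
      using has_derivative_compose by blast
    then show "((\<lambda>x. \<kappa> (x - t) * f t) has_derivative blinfun_apply (?fx x t)) (at x within UNIV)"
      by (rule has_derivative_eq_rhs[OF has_derivative_mult_left]) (auto simp: blinfun.scaleR_left)
  next
    show "(\<lambda>y. \<kappa> (x - y) * f y) integrable_on cbox a b" for x
      by (intro integrable_continuous int \<kappa>)
    have "continuous_on (UNIV \<times> cbox a b) (\<lambda>z. blinfun_inner_right (grad \<kappa> (fst z - snd z)))"
      by (intro bounded_linear.continuous_on[OF bounded_linear_blinfun_inner_right]
        continuous_on_compose2[OF cg] continuous_intros) auto
    moreover have "continuous_on (UNIV \<times> cbox a b) (\<lambda>z. f (snd z))"
      by (intro continuous_on_compose2[OF f] continuous_intros) auto
    ultimately show "continuous_on (UNIV \<times> cbox a b) (\<lambda>(x, t). ?fx x t)"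
      unfolding case_prod_beta by (rule continuous_on_scaleR[rotated])
  qed auto
  have E: "blinfun_apply (integral (cbox a b) (?fx x0)) h = (\<Sum>i\<in>UNIV. h $ i * integral (cbox a b) (\<lambda>y. partial_deriv i \<kappa> (x0 - y) * f y))" for h
  proof -
    have "continuous_on (cbox a b) (\<lambda>y. blinfun_inner_right (grad \<kappa> (x0 - y)))"
      by (intro bounded_linear.continuous_on[OF bounded_linear_blinfun_inner_right]
        continuous_on_compose2[OF cg] continuous_intros) auto
    then have "?fx x0 integrable_on cbox a b"
      by (intro integrable_continuous continuous_on_scaleR[OF f])
    then have "blinfun_apply (integral (cbox a b) (?fx x0)) h = integral (cbox a b) (\<lambda>y. blinfun_apply (?fx x0 y) h)"
      by (rule blinfun_apply_integral)
    also have "\<dots> = integral (cbox a b) (\<lambda>y. \<Sum>i\<in>UNIV. h $ i * (partial_deriv i \<kappa> (x0 - y) * f y))"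
      by (intro integral_cong) (simp add: blinfun.scaleR_left grad_def inner_vec_def sum_distrib_left mult_ac)
    also have "\<dots> = (\<Sum>i\<in>UNIV. h $ i * integral (cbox a b) (\<lambda>y. partial_deriv i \<kappa> (x0 - y) * f y))"
    proof (subst integral_sum)
      show "(\<lambda>y. h $ i * (partial_deriv i \<kappa> (x0 - y) * f y)) integrable_on cbox a b" for i
        by (intro integrable_mult_left_real integrable_continuous int sp)
    qed auto
    finally show ?thesis .
  qed
  show "((\<lambda>x. integral (cbox a b) (\<lambda>y. \<kappa> (x - y) * f y)) has_derivative
     (\<lambda>h. \<Sum>i\<in>UNIV. h $ i * integral (cbox a b) (\<lambda>y. partial_deriv i \<kappa> (x0 - y) * f y))) (at x0)"
    using has_derivative_eq_rhs[OF D ext[OF E]] by simp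
qed

text \<open>Moves \<open>x\<close> from the merely continuous \<open>f\<close> into the smooth
  kernel, over a box that can be kept fixed while \<open>x\<close> varies locally. The Leibniz rule
  then applies.\<close>

lemma cv_eq_integral:
  fixes x a b :: "real^'n::finite"
  assumes \<kappa>: "kernel s \<kappa>" and f: "continuous_on UNIV f" and sub: "\<And>y. y \<in> cube s \<Longrightarrow> x - y \<in> cbox a b"
  shows "cv s \<kappa> f x = integral (cbox a b) (\<lambda>y. \<kappa> (x - y) * f y)"
proof -
  let ?g = "\<lambda>y. \<kappa> y * f (x - y)" and ?c = "(\<chi> i. s) :: real^'n"
  have box: "cube s = cbox (- ?c) ?c" by (simp add: cube_def vec_eq_iff) (metis uminus_vec_def vec_lambda_unique)
  have "(?g has_integral cv s \<kappa> f x) (cbox (- ?c) ?c)"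
    unfolding cv_def box[symmetric] by (rule integrable_integral[OF cv_integrable[OF \<kappa> f]])
  then have "((\<lambda>y. ?g ((-1) *\<^sub>R y + x)) has_integral (1 / (\<bar>-1\<bar> ^ DIM(real^'n))) *\<^sub>R cv s \<kappa> f x)
      ((\<lambda>y. (1 / (-1)) *\<^sub>R y + - ((1 / (-1)) *\<^sub>R x)) ` cbox (- ?c) ?c)"
    by (rule has_integral_affinity) simp
  then have I: "((\<lambda>y. \<kappa> (x - y) * f y) has_integral cv s \<kappa> f x) ((\<lambda>y. x - y) ` cube s)"
    by (simp add: box)
  have "((\<lambda>y. \<kappa> (x - y) * f y) has_integral cv s \<kappa> f x) (cbox a b)"
  proof (rule has_integral_on_superset[OF I])
    show "(\<lambda>y. x - y) ` cube s \<subseteq> cbox a b" using sub by auto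
    fix y assume "y \<notin> (\<lambda>y. x - y) ` cube s"
    then have "x - y \<notin> cube s" by (metis image_eqI minus_diff_eq diff_diff_eq2 add_diff_cancel_left' )
    then show "\<kappa> (x - y) * f y = 0" using \<kappa> by (simp add: kernel_def)
  qed
  then show ?thesis by (simp add: integral_unique)
qed

lemma cv_has_partials:
  fixes \<kappa> :: "real^'n::finite \<Rightarrow> real"
  assumes \<kappa>: "kernel s \<kappa>" and f: "continuous_on UNIV f"
  shows "has_partials UNIV (cv s \<kappa> f) (\<lambda>i. cv s (partial_deriv i \<kappa>) f)"
  unfolding has_partials_def
proof
  fix x :: "real^'n"
  let ?R = "norm x + 1 + s"
  let ?C = "cbox (\<chi> i. - ?R) (\<chi> i. ?R) :: (real^'n) set"
  have sub: "y - z \<in> ?C" if "y \<in> ball 0 (norm x + 1)" "z \<in> cube s" for y z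
  proof -
    have "\<bar>(y - z) $ i\<bar> \<le> ?R" for i
    proof -
      have "\<bar>y $ i\<bar> \<le> norm x + 1" using component_le_norm_cart[of y i] that(1) by simp
      moreover have "\<bar>z $ i\<bar> \<le> s" using that(2) by (simp add: mem_cube)
      ultimately show ?thesis unfolding vector_minus_component by linarith
    qed
    then show ?thesis using mem_cube[of "y - z" ?R] by (simp add: cube_def)
  qed
  have eq: "cv s \<rho> f y = integral ?C (\<lambda>z. \<rho> (y - z) * f z)" if "kernel s \<rho>" "y \<in> ball 0 (norm x + 1)" for \<rho> y
    by (rule cv_eq_integral[OF that(1) f sub[OF that(2)]])
  have x: "x \<in> ball 0 (norm x + 1)" by simp
  have "((\<lambda>x. integral ?C (\<lambda>z. \<kappa> (x - z) * f z)) has_derivative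
     (\<lambda>h. \<Sum>i\<in>UNIV. h $ i * integral ?C (\<lambda>z. partial_deriv i \<kappa> (x - z) * f z))) (at x)"
    using smooth_integral_kernel[OF kernel_smooth[OF \<kappa>] continuous_on_subset[OF f subset_UNIV]]
    by (simp add: has_partials_def)
  then have "((\<lambda>x. integral ?C (\<lambda>z. \<kappa> (x - z) * f z)) has_derivative
     (\<lambda>h. \<Sum>i\<in>UNIV. h $ i * cv s (partial_deriv i \<kappa>) f x)) (at x)"
    by (simp only: eq[OF kernel_partial[OF \<kappa>] x])
  then show "(cv s \<kappa> f has_derivative (\<lambda>h. \<Sum>i\<in>UNIV. h $ i * cv s (partial_deriv i \<kappa>) f x)) (at x)"
    by (rule has_derivative_transform_within_open[OF _ open_ball x]) (simp only: eq[OF \<kappa>])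
qed

lemma cv_smooth:
  assumes "kernel s \<kappa>" "continuous_on UNIV f"
  shows "smooth_on UNIV (cv s \<kappa> f)"
  using assms(1)
proof (coinduction arbitrary: \<kappa>)
  case (smooth_on \<kappa>)
  show ?case
    using cv_has_partials[OF smooth_on assms(2)] kernel_partial[OF smooth_on]
    by (intro exI[of _ "cv s \<kappa> f"] exI[of _ "\<lambda>i. cv s (partial_deriv i \<kappa>) f"]) auto
qed

lemma cv_dird:
  assumes "kernel s \<kappa>" "continuous_on UNIV f"
  shows "dird b (cv s \<kappa> f) = cv s (dird b \<kappa>) f"
proof
  fix x
  have "partial_deriv i (cv s \<kappa> f) x = cv s (partial_deriv i \<kappa>) f x" for i
    by (rule has_partials_partial_deriv(1)[OF cv_has_partials[OF assms]]) simp
  then have "dird b (cv s \<kappa> f) x = (\<Sum>i\<in>UNIV. b $ i * cv s (partial_deriv i \<kappa>) f x)" by (simp add: dird_def)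
  also have "\<dots> = integral (cube s) (\<lambda>y. \<Sum>i\<in>UNIV. b $ i * (partial_deriv i \<kappa> y * f (x - y)))"
    unfolding cv_def
    by (subst integral_sum) (auto intro!: integrable_mult_left_real cv_integrable kernel_partial assms)
  also have "\<dots> = cv s (dird b \<kappa>) f x"
    unfolding cv_def dird_def sum_distrib_right by (simp add: mult.assoc)
  finally show "dird b (cv s \<kappa> f) x = cv s (dird b \<kappa>) f x" .
qed

lemma cv_bound:
  assumes \<kappa>: "kernel s \<kappa>" and f: "continuous_on UNIV f" and M: "\<And>x. \<bar>f x\<bar> \<le> M"
  shows "\<bar>cv s \<kappa> f x\<bar> \<le> M * integral (cube s) (\<lambda>y. \<bar>\<kappa> y\<bar>)"
proof -
  have "norm (cv s \<kappa> f x) \<le> integral (cube s) (\<lambda>y. M * \<bar>\<kappa> y\<bar>)"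
    unfolding cv_def
  proof (rule integral_norm_bound_integral[OF cv_integrable[OF \<kappa> f]])
    show "(\<lambda>y. M * \<bar>\<kappa> y\<bar>) integrable_on cube s"
      unfolding cube_def by (intro integrable_continuous continuous_intros kernel_continuous[OF \<kappa>])
    show "norm (\<kappa> y * f (x - y)) \<le> M * \<bar>\<kappa> y\<bar>" for y
      using mult_right_mono[OF M[of "x - y"], of "\<bar>\<kappa> y\<bar>"] by (simp add: abs_mult mult.commute)
  qed
  then show ?thesis by simp
qed

lemma exists_bump:
  assumes \<sigma>: "\<sigma> > 0"
  obtains \<rho> :: "real^'n::finite \<Rightarrow> real" where "kernel \<sigma> \<rho>" "\<And>y. 0 \<le> \<rho> y" "\<And>y. \<sigma> \<le> norm y \<Longrightarrow> \<rho> y = 0"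
    "integral (cube \<sigma>) \<rho> = 1"
proof -
  define g where "g = (\<lambda>y::real^'n. flat_exp 0 (\<sigma>\<^sup>2 - y \<bullet> y))"
  have zero: "g y = 0" if "\<sigma> \<le> norm y" for y
  proof -
    have "\<sigma>\<^sup>2 \<le> (norm y)\<^sup>2" using that \<sigma> by (intro power_mono) auto
    then show ?thesis by (simp add: g_def flat_exp_def power2_norm_eq_inner)
  qed
  have nn: "0 \<le> g y" for y by (simp add: g_def flat_exp_def)
  have k: "kernel \<sigma> g"
    unfolding kernel_def
  proof (intro conjI allI impI)
    show "smooth_on UNIV g" unfolding g_def by (rule smooth_flat_exp)
    fix y :: "real^'n" assume "y \<notin> cube \<sigma>"
    then have "\<sigma> \<le> norm y" using norm_le_cube[of y \<sigma>] by linarith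
    then show "g y = 0" by (rule zero)
  qed
  have int: "g integrable_on cube \<sigma>"
    unfolding cube_def by (intro integrable_continuous kernel_continuous[OF k])
  have "integral (cube \<sigma>) g \<noteq> 0"
  proof
    assume "integral (cube \<sigma>) g = 0"
    then have "(g has_integral 0) (cbox (\<chi> i. - \<sigma>) (\<chi> i. \<sigma>))"
      using int by (metis cube_def integrable_integral)
    moreover have "(0 :: real^'n) \<in> box (\<chi> i. - \<sigma>) (\<chi> i. \<sigma>)"
      using \<sigma> by (simp add: mem_box_cart)
    then have "box (\<chi> i. - \<sigma>) (\<chi> i. \<sigma>) \<noteq> ({} :: (real^'n) set)" by blast
    moreover have "(0 :: real^'n) \<in> cbox (\<chi> i. - \<sigma>) (\<chi> i. \<sigma>)"
      using \<sigma> by (simp add: mem_box_cart)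
    ultimately have "g 0 = 0"
      using nn by (intro has_integral_0_cbox_imp_0[OF kernel_continuous[OF k]]) auto
    then show False using \<sigma> by (simp add: g_def flat_exp_def)
  qed
  moreover have "0 \<le> integral (cube \<sigma>) g" by (rule integral_nonneg[OF int]) (use nn in auto)
  ultimately have I: "integral (cube \<sigma>) g > 0" by linarith
  let ?c = "1 / integral (cube \<sigma>) g"
  show ?thesis
  proof (rule that[of "\<lambda>y. ?c * g y"])
    show "kernel \<sigma> (\<lambda>y. ?c * g y)"
      using k smooth_mult[OF smooth_const, of UNIV g ?c] by (simp add: kernel_def)
    show "integral (cube \<sigma>) (\<lambda>y. ?c * g y) = 1" using I by simp
  qed (use nn zero I in auto)
qed

lemma cv_approx:
  assumes \<kappa>: "kernel s \<rho>" and f: "continuous_on UNIV f" and nn: "\<And>y. 0 \<le> \<rho> y" and I: "integral (cube s) \<rho> = 1"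
    and e: "\<And>y. \<rho> y \<noteq> 0 \<Longrightarrow> \<bar>f (x - y) - c\<bar> \<le> e"
  shows "\<bar>cv s \<rho> f x - c\<bar> \<le> e"
proof -
  have i\<rho>: "\<rho> integrable_on cube s" 
    unfolding cube_def by (intro integrable_continuous kernel_continuous[OF \<kappa>])
  have ic: "(\<lambda>y. \<rho> y * a) integrable_on cube s" for a using integrable_mult_left_real[OF i\<rho>, of a] by (simp add: mult.commute)
  have "norm (integral (cube s) (\<lambda>y. \<rho> y * f (x - y) - \<rho> y * c)) \<le> integral (cube s) (\<lambda>y. \<rho> y * e)"
  proof (rule integral_norm_bound_integral)
    fix y
    have "norm (\<rho> y * f (x - y) - \<rho> y * c) = \<rho> y * \<bar>f (x - y) - c\<bar>"
      using nn[of y] by (simp add: abs_mult right_diff_distrib[symmetric])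
    also have "\<dots> \<le> \<rho> y * e" using e[of y] nn[of y] by (cases "\<rho> y = 0") (auto intro: mult_left_mono)
    finally show "norm (\<rho> y * f (x - y) - \<rho> y * c) \<le> \<rho> y * e" .
  qed (intro integrable_diff cv_integrable[OF \<kappa> f] ic)+
  moreover have "integral (cube s) (\<lambda>y. \<rho> y * f (x - y) - \<rho> y * c) = cv s \<rho> f x - c"
    using integral_diff[OF cv_integrable[OF \<kappa> f] ic] I by (simp add: cv_def)
  ultimately show ?thesis using I by simp
qed

lemma cv_mono:
  assumes \<kappa>: "kernel s \<kappa>" and f: "continuous_on UNIV f" "continuous_on UNIV g"
    and nn: "\<And>y. 0 \<le> \<kappa> y" and le: "\<And>x. f x \<le> g x"
  shows "cv s \<kappa> f x \<le> cv s \<kappa> g x"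
  unfolding cv_def
  by (intro integral_le cv_integrable[OF \<kappa>] f mult_left_mono le nn)

lemma cv_add:
  assumes \<kappa>: "kernel s \<kappa>" and f: "continuous_on UNIV f" "continuous_on UNIV g"
  shows "cv s \<kappa> (\<lambda>x. f x + g x) x = cv s \<kappa> f x + cv s \<kappa> g x"
  unfolding cv_def distrib_left
  by (intro integral_add cv_integrable[OF \<kappa>] f)

lemma cv_cmult: "cv s \<kappa> (\<lambda>x. c * f x) x = c * cv s \<kappa> f x"
  by (simp add: cv_def mult.left_commute)

lemma cv_const: "cv s \<kappa> (\<lambda>x. c) x = c * integral (cube s) \<kappa>"
  by (simp add: cv_def mult.commute)

section \<open>Calculus of superjets\<close>

lemma qform_add: "qform (X + Y) v = qform X v + qform Y v"
  by (simp add: qform_def matrix_vector_mult_add_rdistrib inner_add_right)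

lemma qform_cmult: "qform (c *\<^sub>R X) v = c * qform X v"
  by (simp add: qform_def scaleR_matrix_vector_assoc[symmetric])

lemma qform_zero: "qform 0 v = 0" by (simp add: qform_def)

lemma superjet_add:
  assumes "superjet f x p X" "superjet g x q Y"
  shows "superjet (\<lambda>y. f y + g y) x (p + q) (X + Y)"
  unfolding superjet_def
proof (intro allI impI)
  fix \<epsilon> :: real assume "\<epsilon> > 0"
  then have e: "\<epsilon> / 2 > 0" by simp
  obtain d1 where d1: "d1 > 0" "\<And>y. norm (y - x) < d1 \<Longrightarrow> f y \<le> f x + p \<bullet> (y - x) + qform X (y - x) / 2 + \<epsilon> / 2 * (norm (y - x))\<^sup>2"
    using assms(1) e unfolding superjet_def by meson
  obtain d2 where d2: "d2 > 0" "\<And>y. norm (y - x) < d2 \<Longrightarrow> g y \<le> g x + q \<bullet> (y - x) + qform Y (y - x) / 2 + \<epsilon> / 2 * (norm (y - x))\<^sup>2"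
    using assms(2) e unfolding superjet_def by meson
  show "\<exists>\<delta>>0. \<forall>y. norm (y - x) < \<delta> \<longrightarrow> f y + g y \<le> f x + g x + (p + q) \<bullet> (y - x) + qform (X + Y) (y - x) / 2 + \<epsilon> * (norm (y - x))\<^sup>2"
  proof (intro exI[of _ "min d1 d2"] conjI allI impI)
    fix y assume "norm (y - x) < min d1 d2"
    then show "f y + g y \<le> f x + g x + (p + q) \<bullet> (y - x) + qform (X + Y) (y - x) / 2 + \<epsilon> * (norm (y - x))\<^sup>2"
      using d1(2)[of y] d2(2)[of y] by (simp add: inner_add_left qform_add add_divide_distrib) 
  qed (use d1 d2 in auto)
qed

lemma superjet_zero: "superjet (\<lambda>y. 0) x 0 0"
  unfolding superjet_def by (auto intro: exI[of _ 1] simp: qform_zero)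

lemma superjet_cmult:
  assumes "superjet f x p X" "c \<ge> 0"
  shows "superjet (\<lambda>y. c * f y) x (c *\<^sub>R p) (c *\<^sub>R X)"
proof (cases "c = 0")
  case True
  then show ?thesis using superjet_zero by simp
next
  case False
  then have c: "c > 0" using assms(2) by simp
  show ?thesis unfolding superjet_def
  proof (intro allI impI)
    fix \<epsilon> :: real assume "\<epsilon> > 0"
    then have "\<epsilon> / c > 0" using c by simp
    then obtain d where d: "d > 0" "\<And>y. norm (y - x) < d \<Longrightarrow> f y \<le> f x + p \<bullet> (y - x) + qform X (y - x) / 2 + \<epsilon> / c * (norm (y - x))\<^sup>2"
      using assms(1) unfolding superjet_def by meson
    have "c * f y \<le> c * f x + (c *\<^sub>R p) \<bullet> (y - x) + qform (c *\<^sub>R X) (y - x) / 2 + \<epsilon> * (norm (y - x))\<^sup>2"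
      if "norm (y - x) < d" for y
      using mult_left_mono[OF d(2)[OF that] assms(2)] c by (simp add: qform_cmult distrib_left)
    then show "\<exists>\<delta>>0. \<forall>y. norm (y - x) < \<delta> \<longrightarrow> c * f y \<le> c * f x + (c *\<^sub>R p) \<bullet> (y - x) + qform (c *\<^sub>R X) (y - x) / 2 + \<epsilon> * (norm (y - x))\<^sup>2"
      using d(1) by blast
  qed
qed

lemma superjet_sum:
  "(\<And>i. i \<in> I \<Longrightarrow> superjet (f i) x (p i) (X i)) \<Longrightarrow> superjet (\<lambda>y. \<Sum>i\<in>I. f i y) x (\<Sum>i\<in>I. p i) (\<Sum>i\<in>I. X i)"
  by (induction I rule: infinite_finite_induct) (auto intro: superjet_add superjet_zero)

lemma superjet_translate: "superjet f (x + v) p X \<Longrightarrow> superjet (\<lambda>y. f (y + v)) x p X"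
  unfolding superjet_def
proof (intro allI impI)
  fix \<epsilon> :: real
  assume f: "\<forall>\<epsilon>>0. \<exists>\<delta>>0. \<forall>y. norm (y - (x + v)) < \<delta> \<longrightarrow>
     f y \<le> f (x + v) + p \<bullet> (y - (x + v)) + qform X (y - (x + v)) / 2 + \<epsilon> * (norm (y - (x + v)))\<^sup>2" and "\<epsilon> > 0"
  then obtain d where d: "d > 0" "\<And>y. norm (y - (x + v)) < d \<Longrightarrow> 
     f y \<le> f (x + v) + p \<bullet> (y - (x + v)) + qform X (y - (x + v)) / 2 + \<epsilon> * (norm (y - (x + v)))\<^sup>2" by meson
  have "f (y + v) \<le> f (x + v) + p \<bullet> (y - x) + qform X (y - x) / 2 + \<epsilon> * (norm (y - x))\<^sup>2" if "norm (y - x) < d" for y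
    using d(2)[of "y + v"] that by simp
  then show "\<exists>\<delta>>0. \<forall>y. norm (y - x) < \<delta> \<longrightarrow> f (y + v) \<le> f (x + v) + p \<bullet> (y - x) + qform X (y - x) / 2 + \<epsilon> * (norm (y - x))\<^sup>2"
    using d(1) by blast
qed

lemma superjet_touch:
  assumes "superjet g x p X" and "\<And>y. norm (y - x) < r \<Longrightarrow> f y - f x \<le> g y - g x" "r > 0"
  shows "superjet f x p X"
  unfolding superjet_def
proof (intro allI impI)
  fix \<epsilon> :: real assume "\<epsilon> > 0"
  then obtain d where d: "d > 0" "\<And>y. norm (y - x) < d \<Longrightarrow> g y \<le> g x + p \<bullet> (y - x) + qform X (y - x) / 2 + \<epsilon> * (norm (y - x))\<^sup>2"
    using assms(1) unfolding superjet_def by meson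
  have "f y \<le> f x + p \<bullet> (y - x) + qform X (y - x) / 2 + \<epsilon> * (norm (y - x))\<^sup>2" if "norm (y - x) < min d r" for y
    using d(2)[of y] assms(2)[of y] that by simp
  then show "\<exists>\<delta>>0. \<forall>y. norm (y - x) < \<delta> \<longrightarrow> f y \<le> f x + p \<bullet> (y - x) + qform X (y - x) / 2 + \<epsilon> * (norm (y - x))\<^sup>2"
    using d(1) assms(3) by (intro exI[of _ "min d r"]) auto
qed

section \<open>Second differences and the discrete heat step\<close>

lemma taylor_along_line:
  fixes F :: "real^'n::finite \<Rightarrow> real"
  assumes F: "smooth_on UNIV F" and h: "h > 0"
  shows "\<exists>y. F (x + h *\<^sub>R b) = F x + h * dird b F x + h\<^sup>2 / 2 * dird b (dird b F) y"
    and "\<exists>y. F (x + h *\<^sub>R b) = F x + h * dird b F x + h\<^sup>2 / 2 * dird b (dird b F) x + h ^ 3 / 6 * dird b (dird b (dird b F)) y"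
proof -
  define D where "D m t = (dird b ^^ m) F (x + t *\<^sub>R b)" for m t
  have sm: "smooth_on UNIV ((dird b ^^ m) F)" for m
    by (induction m) (auto intro: smooth_on_dird F)
  have D: "(D m has_real_derivative D (Suc m) t) (at t)" for m t
    unfolding D_def using dird_has_real_derivative[OF open_UNIV sm, of x t b m] by simp
  have D0: "D 0 = (\<lambda>t. F (x + t *\<^sub>R b))" by (simp add: D_def fun_eq_iff)
  obtain t where "F (x + h *\<^sub>R b) = (\<Sum>m<2. D m 0 / fact m * h ^ m) + D 2 t / fact 2 * h ^ 2"
    using Maclaurin[OF h, of 2 D, OF _ D0] D by auto
  then show "\<exists>y. F (x + h *\<^sub>R b) = F x + h * dird b F x + h\<^sup>2 / 2 * dird b (dird b F) y"
    by (intro exI[of _ "x + t *\<^sub>R b"]) (simp add: D_def numeral_2_eq_2)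
  obtain t where "F (x + h *\<^sub>R b) = (\<Sum>m<3. D m 0 / fact m * h ^ m) + D 3 t / fact 3 * h ^ 3"
    using Maclaurin[OF h, of 3 D, OF _ D0] D by auto
  then show "\<exists>y. F (x + h *\<^sub>R b) = F x + h * dird b F x + h\<^sup>2 / 2 * dird b (dird b F) x + h ^ 3 / 6 * dird b (dird b (dird b F)) y"
    by (intro exI[of _ "x + t *\<^sub>R b"]) (simp add: D_def numeral_3_eq_3 fact_numeral power2_eq_square mult_ac)
qed

lemma dird_uminus: "dird (- b) F = (\<lambda>x. - dird b F x)"
  by (simp add: dird_def fun_eq_iff sum_negf)

lemma dird_of_uminus:
  assumes "smooth_on UNIV F" shows "dird b (\<lambda>x. - F x) = (\<lambda>x. - dird b F x)"
proof
  fix x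
  have "has_partials UNIV (\<lambda>x. - F x) (\<lambda>i x. - partial_deriv i F x)"
    using smooth_on_partial_deriv(2)[OF open_UNIV assms]
    by (auto simp: has_partials_def sum_negf intro!: derivative_eq_intros)
  then have "partial_deriv i (\<lambda>x. - F x) x = - partial_deriv i F x" for i
    by (rule has_partials_partial_deriv) simp
  then show "dird b (\<lambda>x. - F x) x = - dird b F x" by (simp add: dird_def sum_negf)
qed

lemma dird_dird_uminus:
  assumes "smooth_on UNIV F" shows "dird (- b) (dird (- b) F) = dird b (dird b F)"
  using dird_of_uminus[OF smooth_on_dird[OF open_UNIV assms], of b b]
  by (simp add: dird_uminus fun_eq_iff)

lemma second_difference_bounds:
  fixes F :: "real^'n::finite \<Rightarrow> real"
  assumes F: "smooth_on UNIV F" and h: "h > 0"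
  shows "(\<And>x. \<bar>dird b (dird b F) x\<bar> \<le> M) \<Longrightarrow> \<bar>F (x + h *\<^sub>R b) + F (x - h *\<^sub>R b) - 2 * F x\<bar> \<le> M * h\<^sup>2"
    and "(\<And>x. \<bar>dird b (dird b (dird b F)) x\<bar> \<le> M) \<Longrightarrow>
      \<bar>F (x + h *\<^sub>R b) + F (x - h *\<^sub>R b) - 2 * F x - h\<^sup>2 * dird b (dird b F) x\<bar> \<le> M * h ^ 3"
proof -
  assume M: "\<And>x. \<bar>dird b (dird b F) x\<bar> \<le> M"
  obtain y z where yz: "F (x + h *\<^sub>R b) = F x + h * dird b F x + h\<^sup>2 / 2 * dird b (dird b F) y"
    "F (x + h *\<^sub>R (- b)) = F x + h * dird (- b) F x + h\<^sup>2 / 2 * dird (- b) (dird (- b) F) z"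
    using taylor_along_line(1)[OF F h] by metis
  have "F (x + h *\<^sub>R b) + F (x - h *\<^sub>R b) - 2 * F x = h\<^sup>2 / 2 * (dird b (dird b F) y + dird b (dird b F) z)"
    using yz unfolding dird_dird_uminus[OF F] by (simp add: dird_uminus algebra_simps)
  also have "\<bar>\<dots>\<bar> = h\<^sup>2 / 2 * \<bar>dird b (dird b F) y + dird b (dird b F) z\<bar>" by (simp add: abs_mult)
  also have "\<dots> \<le> h\<^sup>2 / 2 * (M + M)"
    using M[of y] M[of z] by (intro mult_left_mono) auto
  finally show "\<bar>F (x + h *\<^sub>R b) + F (x - h *\<^sub>R b) - 2 * F x\<bar> \<le> M * h\<^sup>2" by (simp add: mult.commute)
next
  assume M: "\<And>x. \<bar>dird b (dird b (dird b F)) x\<bar> \<le> M"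
  obtain y z where yz: "F (x + h *\<^sub>R b) = F x + h * dird b F x + h\<^sup>2 / 2 * dird b (dird b F) x + h ^ 3 / 6 * dird b (dird b (dird b F)) y"
    "F (x + h *\<^sub>R (- b)) = F x + h * dird (- b) F x + h\<^sup>2 / 2 * dird (- b) (dird (- b) F) x + h ^ 3 / 6 * dird (- b) (dird (- b) (dird (- b) F)) z"
    using taylor_along_line(2)[OF F h] by metis
  have "F (x + h *\<^sub>R b) + F (x - h *\<^sub>R b) - 2 * F x - h\<^sup>2 * dird b (dird b F) x
     = h ^ 3 / 6 * (dird b (dird b (dird b F)) y - dird b (dird b (dird b F)) z)"
    using yz unfolding dird_dird_uminus[OF F] dird_uminus[of b "dird b (dird b F)"] by (simp add: dird_uminus algebra_simps)
  also have "\<bar>\<dots>\<bar> = h ^ 3 / 6 * \<bar>dird b (dird b (dird b F)) y - dird b (dird b (dird b F)) z\<bar>"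
    using h by (simp add: abs_mult)
  also have "\<dots> \<le> h ^ 3 / 6 * (M + M)"
    using M[of y] M[of z] h by (intro mult_left_mono) auto
  also have "\<dots> \<le> M * h ^ 3" using M[of x] h abs_ge_zero[of "dird b (dird b (dird b F)) x"]
    by (simp add: mult.commute)
  finally show "\<bar>F (x + h *\<^sub>R b) + F (x - h *\<^sub>R b) - 2 * F x - h\<^sup>2 * dird b (dird b F) x\<bar> \<le> M * h ^ 3" .
qed

text \<open>One step of the random walk with increments \<open>h *\<^sub>R b i\<close> and their
  negatives. For smooth \<open>f\<close> the change is \<open>h\<^sup>2 / (2 n)\<close> times the
  sum of the second derivatives along the \<open>b i\<close>, up to higher order, where
  \<open>n\<close> is the dimension.\<close>

definition avg :: "('n::finite \<Rightarrow> real^'n) \<Rightarrow> real \<Rightarrow> (real^'n \<Rightarrow> real) \<Rightarrow> real^'n \<Rightarrow> real" where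
  "avg b h f x = (\<Sum>i\<in>UNIV. (f (x + h *\<^sub>R b i) + f (x - h *\<^sub>R b i)) / (2 * real CARD('n)))"

lemma avg_mono: "(\<And>x. f x \<le> g x) \<Longrightarrow> avg b h f x \<le> avg b h g x"
  unfolding avg_def by (intro sum_mono divide_right_mono add_mono) auto

lemma avg_add: "avg b h (\<lambda>x. f x + g x) x = avg b h f x + avg b h g x"
  by (simp add: avg_def sum.distrib[symmetric] add_divide_distrib algebra_simps)

lemma avg_cmult: "avg b h (\<lambda>x. c * f x) x = c * avg b h f x"
  by (simp add: avg_def sum_distrib_left algebra_simps add_divide_distrib)

lemma avg_const: "avg b h (\<lambda>x. c) x = c"
  by (simp add: avg_def)

lemma avg_continuous:
  assumes "continuous_on UNIV f" shows "continuous_on UNIV (avg b h f)"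
proof -
  have "continuous_on UNIV (\<lambda>x. f (x + v))" "continuous_on UNIV (\<lambda>x. f (x - v))" for v
    by (rule continuous_on_compose2[OF assms], auto intro: continuous_intros)+
  then show ?thesis unfolding avg_def[abs_def] by (intro continuous_on_sum continuous_on_divide continuous_on_add continuous_on_const) auto
qed

lemma cv_avg:
  assumes \<kappa>: "kernel s \<kappa>" and f: "continuous_on UNIV f"
  shows "cv s \<kappa> (avg b h f) x = avg b h (cv s \<kappa> f) x"
proof -
  let ?n = "2 * real CARD('a)"
  have i: "(\<lambda>y. (1 / ?n) * (\<kappa> y * f (z - y))) integrable_on cube s" for z
    by (intro integrable_mult_left_real cv_integrable \<kappa> f)
  have e: "\<kappa> y * avg b h f (x - y) = (\<Sum>i\<in>UNIV. (1 / ?n) * (\<kappa> y * f (x + h *\<^sub>R b i - y)) + (1 / ?n) * (\<kappa> y * f (x - h *\<^sub>R b i - y)))" for y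
  proof -
    have swap: "x - y + v = x + v - y" "x - y - v = x - v - y" for v
      by simp_all
    show ?thesis unfolding avg_def swap by (simp add: sum_distrib_left distrib_left add_divide_distrib)
  qed
  have "cv s \<kappa> (avg b h f) x = (\<Sum>i\<in>UNIV. integral (cube s) (\<lambda>y. (1 / ?n) * (\<kappa> y * f (x + h *\<^sub>R b i - y)) + (1 / ?n) * (\<kappa> y * f (x - h *\<^sub>R b i - y))))"
    unfolding cv_def e by (intro integral_sum integrable_add i finite)
  also have "\<dots> = (\<Sum>i\<in>UNIV. (1 / ?n) * cv s \<kappa> f (x + h *\<^sub>R b i) + (1 / ?n) * cv s \<kappa> f (x - h *\<^sub>R b i))"
    unfolding integral_add[OF i i] integral_mult_right cv_def ..
  also have "\<dots> = avg b h (cv s \<kappa> f) x"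
    by (simp add: avg_def add_divide_distrib)
  finally show ?thesis .
qed

text \<open>The discrete heat semigroup \<open>avg b h ^^ m\<close> is generated by \<open>\<Sum>\<^sub>i D\<^sup>2(b\<^sub>i, b\<^sub>i)\<close> up to the error controlled
  by the following invariant; \<open>N\<close> stands for the generator applied to \<open>V\<close>.\<close>

definition heat_adapted :: "('n::finite \<Rightarrow> real^'n) \<Rightarrow> real \<Rightarrow> real \<Rightarrow> (real^'n \<Rightarrow> real) \<Rightarrow> (real^'n \<Rightarrow> real) \<Rightarrow> bool" where
  "heat_adapted b h C V N \<longleftrightarrow>
     (\<forall>x. \<exists>p H. transpose H = H \<and> superjet V x p H \<and> (\<Sum>i\<in>UNIV. qform H (b i)) = N x) \<and>
     (\<forall>x. \<bar>avg b h V x - V x - h\<^sup>2 / (2 * real CARD('n)) * N x\<bar> \<le> C * h ^ 3) \<and>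
     (\<forall>x. \<bar>avg b h N x - N x\<bar> \<le> C * h\<^sup>2)"

lemma transpose_add: "transpose (A + B) = transpose A + transpose B"
  by (simp add: transpose_def vec_eq_iff)

lemma transpose_sum: "transpose (\<Sum>i\<in>I. A i) = (\<Sum>i\<in>I. transpose (A i))"
  by (induction I rule: infinite_finite_induct) (auto simp: transpose_add transpose_def vec_eq_iff)

lemma transpose_scaleR: "transpose (c *\<^sub>R A) = c *\<^sub>R transpose A"
  by (simp add: transpose_def vec_eq_iff)

lemma qform_sum_matrix: "qform (\<Sum>i\<in>I. A i) v = (\<Sum>i\<in>I. qform (A i) v)"
  by (induction I rule: infinite_finite_induct) (auto simp: qform_add qform_zero)

lemma avg_abs_le: "(\<And>x. \<bar>f x\<bar> \<le> c) \<Longrightarrow> \<bar>avg b h f x\<bar> \<le> c"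
  using avg_mono[of f "\<lambda>x. c" b h x] avg_mono[of "\<lambda>x. - c" f b h x]
  by (auto simp: avg_const abs_le_iff minus_le_iff)

text \<open>All three clauses are stable under averaging of translates, with the same
  \<open>C\<close>. Hence the errors of many steps merely add up, and smoothness matters only for
  the initial function.\<close>

lemma heat_adapted_avg:
  assumes "heat_adapted b h C V N"
  shows "heat_adapted b h C (avg b h V) (avg b h N)"
  unfolding heat_adapted_def
proof (intro conjI allI)
  fix x :: "real^'a"
  let ?n = "2 * real CARD('a)"
  obtain p H where pH: "\<And>x. transpose (H x) = H x" "\<And>x. superjet V x (p x) (H x)" "\<And>x. (\<Sum>i\<in>UNIV. qform (H x) (b i)) = N x"
    using assms unfolding heat_adapted_def by metis
  let ?p = "\<Sum>i\<in>UNIV. (1 / ?n) *\<^sub>R (p (x + h *\<^sub>R b i) + p (x + - (h *\<^sub>R b i)))"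
  let ?H = "\<Sum>i\<in>UNIV. (1 / ?n) *\<^sub>R (H (x + h *\<^sub>R b i) + H (x + - (h *\<^sub>R b i)))"
  have "superjet (\<lambda>y. \<Sum>i\<in>UNIV. (1 / ?n) * (V (y + h *\<^sub>R b i) + V (y + - (h *\<^sub>R b i)))) x ?p ?H"
    by (intro superjet_sum superjet_cmult superjet_add superjet_translate pH) simp
  then have "superjet (avg b h V) x ?p ?H" by (simp add: avg_def[abs_def])
  moreover have "transpose ?H = ?H" by (simp add: transpose_sum transpose_scaleR transpose_add pH(1))
  moreover have "(\<Sum>j\<in>UNIV. qform ?H (b j)) = avg b h N x"
  proof -
    have "(\<Sum>j\<in>UNIV. qform ?H (b j)) = (\<Sum>j\<in>UNIV. \<Sum>i\<in>UNIV. (1 / ?n) * (qform (H (x + h *\<^sub>R b i)) (b j) + qform (H (x + - (h *\<^sub>R b i))) (b j)))"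
      unfolding qform_sum_matrix qform_cmult qform_add ..
    also have "\<dots> = (\<Sum>i\<in>UNIV. \<Sum>j\<in>UNIV. (1 / ?n) * (qform (H (x + h *\<^sub>R b i)) (b j) + qform (H (x + - (h *\<^sub>R b i))) (b j)))"
      by (rule sum.swap)
    also have "\<dots> = (\<Sum>i\<in>UNIV. (1 / ?n) * (N (x + h *\<^sub>R b i) + N (x + - (h *\<^sub>R b i))))"
      unfolding sum_distrib_left[symmetric] sum.distrib pH(3) ..
    finally show ?thesis by (simp add: avg_def)
  qed
  ultimately show "\<exists>p H. transpose H = H \<and> superjet (avg b h V) x p H \<and> (\<Sum>i\<in>UNIV. qform H (b i)) = avg b h N x"
    by blast
next
  fix x :: "real^'a"
  let ?n = "2 * real CARD('a)"
  have "\<bar>avg b h V x + (-1) * V x + (- (h\<^sup>2 / ?n)) * N x\<bar> \<le> C * h ^ 3" for x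
    using assms by (simp add: heat_adapted_def)
  then have "\<bar>avg b h (\<lambda>x. avg b h V x + (-1) * V x + (- (h\<^sup>2 / ?n)) * N x) x\<bar> \<le> C * h ^ 3"
    by (rule avg_abs_le)
  then show "\<bar>avg b h (avg b h V) x - avg b h V x - h\<^sup>2 / ?n * avg b h N x\<bar> \<le> C * h ^ 3"
    unfolding avg_add avg_cmult by simp
  have "\<bar>avg b h N x + (-1) * N x\<bar> \<le> C * h\<^sup>2" for x
    using assms by (simp add: heat_adapted_def)
  then have "\<bar>avg b h (\<lambda>x. avg b h N x + (-1) * N x) x\<bar> \<le> C * h\<^sup>2"
    by (rule avg_abs_le)
  then show "\<bar>avg b h (avg b h N) x - avg b h N x\<bar> \<le> C * h\<^sup>2"
    unfolding avg_add avg_cmult by simp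
qed

lemma heat_adapted_avg_power: "heat_adapted b h C V N \<Longrightarrow> heat_adapted b h C ((avg b h ^^ m) V) ((avg b h ^^ m) N)"
  by (induction m) (auto intro: heat_adapted_avg)

lemma avg_difference: "avg b h F x - F x = (\<Sum>i\<in>UNIV. (F (x + h *\<^sub>R b i) + F (x - h *\<^sub>R b i) - 2 * F x) / (2 * real CARD('n)))"
  for b :: "'n::finite \<Rightarrow> real^'n"
  by (simp add: avg_def diff_divide_distrib sum_subtractf)

text \<open>\<open>C\<close> collects bounds of third derivatives for one heat step and of fourth
  derivatives for the change of the generator. They are finite since all derivatives fall on the
  kernel and \<open>f\<close> is bounded.\<close>

lemma heat_adapted_cv:
  fixes b :: "'n::finite \<Rightarrow> real^'n"
  assumes \<kappa>: "kernel s \<kappa>" and f: "continuous_on UNIV f" and M: "\<And>x. \<bar>f x\<bar> \<le> M"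
  obtains C where "C \<ge> 0" "\<And>h. 0 < h \<Longrightarrow> h \<le> 1 \<Longrightarrow> heat_adapted b h C (cv s \<kappa> f) (\<lambda>x. \<Sum>i\<in>UNIV. qform (hess (cv s \<kappa> f) x) (b i))"
proof -
  let ?F = "cv s \<kappa> f" and ?n = "2 * real CARD('n)"
  let ?N = "\<lambda>x. \<Sum>i\<in>UNIV. qform (hess ?F x) (b i)"
  have sm: "smooth_on UNIV ?F" by (rule cv_smooth[OF \<kappa> f])
  note dd = cv_dird[OF _ f]
  have bd: "\<exists>B. \<forall>x. \<bar>cv s \<rho> f x\<bar> \<le> B" if "kernel s \<rho>" for \<rho>
    using cv_bound[OF that f M] by blast
  have "\<forall>i. \<exists>B. \<forall>x. \<bar>dird (b i) (dird (b i) (dird (b i) ?F)) x\<bar> \<le> B"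
    using bd \<kappa> by (simp add: dd kernel_dird)
  then obtain B where B: "\<And>i x. \<bar>dird (b i) (dird (b i) (dird (b i) ?F)) x\<bar> \<le> B i" by metis
  have "\<forall>j i. \<exists>B. \<forall>x. \<bar>dird (b j) (dird (b j) (dird (b i) (dird (b i) ?F))) x\<bar> \<le> B"
    using bd \<kappa> by (simp add: dd kernel_dird)
  then obtain B' where B': "\<And>j i x. \<bar>dird (b j) (dird (b j) (dird (b i) (dird (b i) ?F))) x\<bar> \<le> B' j i" by metis
  define C where "C = (\<Sum>i\<in>UNIV. \<bar>B i\<bar>) + (\<Sum>i\<in>UNIV. \<Sum>j\<in>UNIV. \<bar>B' j i\<bar>)"
  have C0: "0 \<le> C" "(\<Sum>i\<in>UNIV. \<bar>B i\<bar>) \<le> C" "(\<Sum>i\<in>UNIV. \<Sum>j\<in>UNIV. \<bar>B' j i\<bar>) \<le> C"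
    by (auto simp: C_def intro!: add_nonneg_nonneg sum_nonneg)
  have n1: "1 \<le> ?n" using zero_less_card_finite[where 'a = 'n] by linarith
  have N: "?N x = (\<Sum>i\<in>UNIV. dird (b i) (dird (b i) ?F) x)" for x
    by (simp add: qform_hess[OF open_UNIV sm])
  have "heat_adapted b h C ?F ?N" if h: "0 < h" "h \<le> 1" for h
    unfolding heat_adapted_def
  proof (intro conjI allI)
    show "\<exists>p H. transpose H = H \<and> superjet ?F x p H \<and> (\<Sum>i\<in>UNIV. qform H (b i)) = ?N x" for x
      using hess_symmetric[OF open_UNIV sm] smooth_superjet[OF open_UNIV sm] by blast
    fix x
    have eq: "avg b h ?F x - ?F x - h\<^sup>2 / ?n * ?N x
      = (\<Sum>i\<in>UNIV. (?F (x + h *\<^sub>R b i) + ?F (x - h *\<^sub>R b i) - 2 * ?F x - h\<^sup>2 * dird (b i) (dird (b i) ?F) x) / ?n)"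
      unfolding avg_difference N by (simp add: sum_distrib_left sum_divide_distrib sum_subtractf[symmetric] diff_divide_distrib)
    have "\<bar>avg b h ?F x - ?F x - h\<^sup>2 / ?n * ?N x\<bar> \<le> (\<Sum>i\<in>UNIV. \<bar>B i\<bar> * h ^ 3)"
      unfolding eq
    proof (rule order_trans[OF sum_abs], rule sum_mono)
      fix i
      let ?e = "?F (x + h *\<^sub>R b i) + ?F (x - h *\<^sub>R b i) - 2 * ?F x - h\<^sup>2 * dird (b i) (dird (b i) ?F) x"
      have "\<bar>?e\<bar> \<le> B i * h ^ 3" by (rule second_difference_bounds(2)[OF sm h(1) B])
      moreover have "\<bar>?e / ?n\<bar> \<le> \<bar>?e\<bar>" using n1 by (simp add: abs_divide divide_le_eq mult_le_cancel_left1)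
      moreover have "B i * h ^ 3 \<le> \<bar>B i\<bar> * h ^ 3" using h by (intro mult_right_mono) auto
      ultimately show "\<bar>?e / ?n\<bar> \<le> \<bar>B i\<bar> * h ^ 3" by linarith
    qed
    also have "\<dots> \<le> C * h ^ 3" unfolding sum_distrib_right[symmetric] using h C0 by (intro mult_right_mono) auto
    finally show "\<bar>avg b h ?F x - ?F x - h\<^sup>2 / ?n * ?N x\<bar> \<le> C * h ^ 3" .
    have eq: "avg b h ?N x - ?N x = (\<Sum>i\<in>UNIV. avg b h (dird (b i) (dird (b i) ?F)) x - dird (b i) (dird (b i) ?F) x)"
    proof -
      have avg_sum: "avg b h (\<lambda>x. \<Sum>i\<in>I. g i x) x = (\<Sum>i\<in>I. avg b h (g i) x)" for I :: "'n set" and g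
        by (induction I rule: infinite_finite_induct) (auto simp: avg_add avg_const)
      have "?N = (\<lambda>x. \<Sum>i\<in>UNIV. dird (b i) (dird (b i) ?F) x)" by (rule ext) (rule N)
      then have "avg b h ?N x = (\<Sum>i\<in>UNIV. avg b h (dird (b i) (dird (b i) ?F)) x)"
        by (rule ssubst) (rule avg_sum)
      then show ?thesis unfolding N[of x] sum_subtractf by (rule arg_cong2[where f = "(-)", OF _ refl])
    qed
    have "\<bar>avg b h ?N x - ?N x\<bar> \<le> (\<Sum>i\<in>UNIV. \<Sum>j\<in>UNIV. \<bar>B' j i\<bar> * h\<^sup>2)"
      unfolding eq
    proof (rule order_trans[OF sum_abs], rule sum_mono)
      fix i
      let ?G = "dird (b i) (dird (b i) ?F)"
      have sG: "smooth_on UNIV ?G" by (intro smooth_on_dird open_UNIV sm)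
      show "\<bar>avg b h ?G x - ?G x\<bar> \<le> (\<Sum>j\<in>UNIV. \<bar>B' j i\<bar> * h\<^sup>2)"
        unfolding avg_difference
      proof (rule order_trans[OF sum_abs], rule sum_mono)
        fix j
        let ?e = "?G (x + h *\<^sub>R b j) + ?G (x - h *\<^sub>R b j) - 2 * ?G x"
        have "\<bar>?e\<bar> \<le> B' j i * h\<^sup>2" by (rule second_difference_bounds(1)[OF sG h(1) B'])
        moreover have "\<bar>?e / ?n\<bar> \<le> \<bar>?e\<bar>" using n1 by (simp add: abs_divide divide_le_eq mult_le_cancel_left1)
        moreover have "B' j i * h\<^sup>2 \<le> \<bar>B' j i\<bar> * h\<^sup>2" by (intro mult_right_mono) auto
        ultimately show "\<bar>?e / ?n\<bar> \<le> \<bar>B' j i\<bar> * h\<^sup>2" by linarith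
      qed
    qed
    also have "\<dots> \<le> C * h\<^sup>2" unfolding sum_distrib_right[symmetric] using C0 by (intro mult_right_mono) auto
    finally show "\<bar>avg b h ?N x - ?N x\<bar> \<le> C * h\<^sup>2" .
  qed
  then show ?thesis using that C0(1) by blast
qed

section \<open>Viscosity subsolutions of linear equations\<close>

text \<open>A discrete comparison principle. Where \<open>f - ?V\<close> is largest, the superjet of
  \<open>?V\<close> is one of \<open>f\<close>, so the generator is at least \<open>- c\<close>
  there. Hence the averaging step has lowered \<open>V\<close> by at most the stated error at this
  point, and the bound there passes to all points.\<close>

lemma heat_step:
  fixes f :: "real^'n::finite \<Rightarrow> real"
  assumes f: "continuous_on UNIV f" "\<And>x. r < norm x \<Longrightarrow> f x = 0" and r: "0 \<le> r"
    and visc: "\<And>x p X. transpose X = X \<Longrightarrow> superjet f x p X \<Longrightarrow> - c \<le> (\<Sum>i\<in>UNIV. qform X (b i))"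
    and h: "0 < h" "h \<le> 1" and C: "0 \<le> C" and c: "0 \<le> c" and D: "0 \<le> D"
    and V: "continuous_on UNIV V" "\<And>x. 0 \<le> V x" and heat_adapted: "heat_adapted b h C V N"
    and le: "\<And>x. f x \<le> V x + D"
  shows "f x \<le> avg b h V x + (D + (h\<^sup>2 / (2 * real CARD('n)) * c + 2 * C * h ^ 3))"
proof -
  let ?n = "2 * real CARD('n)" and ?V = "avg b h V" and ?N = "avg b h N"
  let ?E = "h\<^sup>2 / ?n * c + 2 * C * h ^ 3"
  have n1: "1 \<le> ?n" using zero_less_card_finite[where 'a = 'n] by linarith
  have E: "0 \<le> ?E" using h C c by simp
  have V0: "0 \<le> ?V y" for y using avg_mono[of "\<lambda>_. 0" V b h y] V(2) by (simp add: avg_const)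
  have cV: "continuous_on UNIV ?V" by (rule avg_continuous[OF V(1)])
  have "continuous_on (cball 0 r) (\<lambda>x. f x - ?V x)"
    by (intro continuous_on_diff continuous_on_subset[OF f(1)] continuous_on_subset[OF cV]) auto
  then obtain x1 where x1: "x1 \<in> cball 0 r" "\<And>y. y \<in> cball 0 r \<Longrightarrow> f y - ?V y \<le> f x1 - ?V x1"
    using continuous_attains_sup[of "cball (0::real^'n) r" "\<lambda>x. f x - ?V x"] r by auto
  show ?thesis
  proof (cases "f x1 - ?V x1 \<le> 0")
    case True
    then have "f x \<le> ?V x"
      using x1(2)[of x] f(2)[of x] V0[of x] by (cases "x \<in> cball 0 r") (auto simp: not_le)
    then show ?thesis using E D by linarith
  next
    case False
    \<comment> \<open>Outside the ball \<open>f\<close> vanishes and \<open>?V\<close> is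
      nonnegative, so a positive maximum over the ball is global. This is needed because
      \<open>x1\<close> may lie on the boundary of the ball.\<close>
    have glob: "f y - ?V y \<le> f x1 - ?V x1" for y
      using x1(2)[of y] f(2)[of y] V0[of y] False by (cases "y \<in> cball 0 r") (auto simp: not_le)
    obtain p H where pH: "transpose H = H" "superjet ?V x1 p H" "(\<Sum>i\<in>UNIV. qform H (b i)) = ?N x1"
      using heat_adapted_avg[OF heat_adapted] unfolding heat_adapted_def by blast
    have "f y - f x1 \<le> ?V y - ?V x1" for y using glob[of y] by linarith
    then have "superjet f x1 p H" by (intro superjet_touch[OF pH(2), where r = 1]) auto
    then have "- c \<le> ?N x1" using visc[OF pH(1)] pH(3) by simp
    moreover have "\<bar>?N x1 - N x1\<bar> \<le> C * h\<^sup>2" "\<bar>?V x1 - V x1 - h\<^sup>2 / ?n * N x1\<bar> \<le> C * h ^ 3"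
      using heat_adapted by (auto simp: heat_adapted_def)
    ultimately have N1: "- c - C * h\<^sup>2 \<le> N x1" and V1: "V x1 + h\<^sup>2 / ?n * N x1 - C * h ^ 3 \<le> ?V x1"
      by linarith+
    have "h\<^sup>2 / ?n * (C * h\<^sup>2) \<le> 1 * (C * h ^ 3)"
    proof -
      have "h\<^sup>2 / ?n \<le> h\<^sup>2" using n1 by (simp add: divide_le_eq mult_le_cancel_left1)
      then have "h\<^sup>2 / ?n * (C * h\<^sup>2) \<le> h\<^sup>2 * (C * h\<^sup>2)" using C by (intro mult_right_mono) auto
      also have "\<dots> = C * h ^ 3 * h" by (simp add: power2_eq_square power3_eq_cube)
      also have "\<dots> \<le> C * h ^ 3 * 1" using h C by (intro mult_left_mono) auto
      finally show ?thesis by simp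
    qed
    moreover have "h\<^sup>2 / ?n * (- c - C * h\<^sup>2) \<le> h\<^sup>2 / ?n * N x1" by (intro mult_left_mono N1) simp
    ultimately have "- ?E \<le> h\<^sup>2 / ?n * N x1 - C * h ^ 3" by (simp add: right_diff_distrib)
    then have "V x1 - ?E \<le> ?V x1" using V1 by linarith
    then show ?thesis using glob[of x] le[of x1] by linarith
  qed
qed

lemma heat_iterate:
  fixes f :: "real^'n::finite \<Rightarrow> real"
  assumes f: "continuous_on UNIV f" "\<And>x. r < norm x \<Longrightarrow> f x = 0" and r: "0 \<le> r"
    and visc: "\<And>x p X. transpose X = X \<Longrightarrow> superjet f x p X \<Longrightarrow> - c \<le> (\<Sum>i\<in>UNIV. qform X (b i))"
    and h: "0 < h" "h \<le> 1" and C: "0 \<le> C" and c: "0 \<le> c" and D: "0 \<le> D"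
    and V: "continuous_on UNIV V" "\<And>x. 0 \<le> V x" and heat_adapted: "heat_adapted b h C V N"
    and le: "\<And>x. f x \<le> V x + D"
  shows "f x \<le> (avg b h ^^ m) V x + (D + real m * (h\<^sup>2 / (2 * real CARD('n)) * c + 2 * C * h ^ 3))"
proof (induction m arbitrary: x)
  case 0
  then show ?case using le by simp
next
  case (Suc m)
  let ?E = "h\<^sup>2 / (2 * real CARD('n)) * c + 2 * C * h ^ 3"
  have E: "0 \<le> ?E" using h C c by simp
  have cont: "continuous_on UNIV ((avg b h ^^ m) V)"
    by (induction m) (auto intro: V avg_continuous)
  have nn: "0 \<le> (avg b h ^^ m) V y" for y
  proof (induction m arbitrary: y)
    case (Suc m)
    then show ?case using avg_mono[of "\<lambda>_. 0" "(avg b h ^^ m) V" b h y] by (simp add: avg_const)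
  qed (simp add: V)
  have "f x \<le> avg b h ((avg b h ^^ m) V) x + ((D + real m * ?E) + ?E)"
    by (rule heat_step[OF f r visc h C c _ cont nn heat_adapted_avg_power[OF heat_adapted] Suc.IH]) (use D E in auto)
  also have "(D + real m * ?E) + ?E = D + real (Suc m) * ?E" by (simp only: of_nat_Suc distrib_right) simp
  finally show ?case by (simp only: funpow.simps o_apply)
qed

lemma compact_support_uniform:
  fixes f :: "real^'n::finite \<Rightarrow> real"
  assumes f: "continuous_on UNIV f" "\<And>x. r < norm x \<Longrightarrow> f x = 0" and e: "e > 0"
  obtains \<sigma> where "0 < \<sigma>" "\<And>x y. norm y < \<sigma> \<Longrightarrow> \<bar>f (x - y) - f x\<bar> \<le> e"
proof -
  have "uniformly_continuous_on (cball 0 (r + 2)) f"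
    by (intro compact_uniformly_continuous continuous_on_subset[OF f(1)]) auto
  then obtain d where d: "d > 0" "\<And>x x'. x \<in> cball 0 (r + 2) \<Longrightarrow> x' \<in> cball 0 (r + 2) \<Longrightarrow> dist x' x < d \<Longrightarrow> dist (f x') (f x) < e"
    using e unfolding uniformly_continuous_on_def by blast
  show ?thesis
  proof (rule that[of "min d 1"])
    fix x y :: "real^'n" assume y: "norm y < min d 1"
    show "\<bar>f (x - y) - f x\<bar> \<le> e"
    proof (cases "norm x \<le> r + 1")
      case True
      then have "norm (x - y) \<le> r + 2" using norm_triangle_ineq4[of x y] y by simp
      then show ?thesis using d(2)[of x "x - y"] True y
        by (simp add: mem_cball_0 dist_norm[of "f _"] dist_norm[of "x - y"] del: mem_cball)
    next
      case False
      then have "r < norm (x - y)" "r < norm x" using norm_triangle_ineq2[of x y] y by auto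
      then show ?thesis using f(2) e by simp
    qed
  qed (use d in auto)
qed

lemma avg_power_mono: "(\<And>x. f x \<le> g x) \<Longrightarrow> (avg b h ^^ m) f x \<le> (avg b h ^^ m) g x"
  by (induction m arbitrary: x) (auto intro: avg_mono)

lemma avg_power_add_const: "(avg b h ^^ m) (\<lambda>x. f x + c) = (\<lambda>x. (avg b h ^^ m) f x + c)"
  by (induction m) (auto simp: avg_add avg_const)

text \<open>The evolution is started from a mollification within \<open>e / 2\<close> of
  \<open>f\<close>, since \<open>f\<close> need not be smooth; this costs \<open>e / 2\<close> at
  the start and \<open>e / 2\<close> at the end. \<open>C\<close> may depend on \<open>e\<close>,
  but not on \<open>h\<close> or \<open>m\<close>, so \<open>h\<close> can tend to 0 with
  \<open>m * h\<^sup>2\<close> fixed.\<close>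

lemma heat_subsolution:
  fixes f :: "real^'n::finite \<Rightarrow> real"
  assumes f: "continuous_on UNIV f" "\<And>x. r < norm x \<Longrightarrow> f x = 0" "\<And>x. 0 \<le> f x" and r: "0 \<le> r"
    and visc: "\<And>x p X. transpose X = X \<Longrightarrow> superjet f x p X \<Longrightarrow> - c \<le> (\<Sum>i\<in>UNIV. qform X (b i))"
    and c: "0 \<le> c" and e: "0 < e"
  shows "\<exists>C\<ge>0. \<forall>h m x. 0 < h \<longrightarrow> h \<le> 1 \<longrightarrow>
    f x \<le> (avg b h ^^ m) f x + (e + real m * (h\<^sup>2 / (2 * real CARD('n)) * c + 2 * C * h ^ 3))"
proof -
  obtain \<sigma> where \<sigma>: "\<sigma> > 0" "\<And>x y. norm y < \<sigma> \<Longrightarrow> \<bar>f (x - y) - f x\<bar> \<le> e / 2"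
    using compact_support_uniform[OF f(1,2), of r "e / 2"] e by auto
  obtain \<rho> :: "real^'n \<Rightarrow> real" where \<rho>: "kernel \<sigma> \<rho>" "\<And>y. 0 \<le> \<rho> y" "\<And>y. \<sigma> \<le> norm y \<Longrightarrow> \<rho> y = 0" "integral (cube \<sigma>) \<rho> = 1"
    by (rule exists_bump[OF \<sigma>(1)]) blast
  let ?g = "cv \<sigma> \<rho> f"
  have close: "\<bar>?g x - f x\<bar> \<le> e / 2" for x
    by (rule cv_approx[OF \<rho>(1) f(1) \<rho>(2,4)]) (use \<sigma>(2) \<rho>(3) not_le in blast)
  have cg: "continuous_on UNIV ?g" by (rule smooth_on_continuous[OF cv_smooth[OF \<rho>(1) f(1)]])
  have g0: "0 \<le> ?g x" for x
    using cv_mono[OF \<rho>(1) continuous_on_const f(1) \<rho>(2), of 0 x] f(3) by (simp add: cv_def)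
  obtain M where M: "\<And>x. \<bar>f x\<bar> \<le> M"
  proof -
    have "compact (f ` cball 0 r)"
      by (intro compact_continuous_image continuous_on_subset[OF f(1)]) auto
    then obtain B where B: "\<And>y. y \<in> cball 0 r \<Longrightarrow> \<bar>f y\<bar> \<le> B"
      using compact_imp_bounded bounded_real by (metis (no_types, lifting) imageI)
    have "\<bar>f x\<bar> \<le> \<bar>B\<bar>" for x using B[of x] f(2)[of x] by (cases "norm x \<le> r") auto
    then show ?thesis using that by blast
  qed
  obtain C where C: "C \<ge> 0" "\<And>h. 0 < h \<Longrightarrow> h \<le> 1 \<Longrightarrow> heat_adapted b h C ?g (\<lambda>x. \<Sum>i\<in>UNIV. qform (hess ?g x) (b i))"
    using heat_adapted_cv[OF \<rho>(1) f(1) M, of b] by blast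
  show ?thesis
  proof (intro exI[of _ C] conjI C(1) allI impI)
    fix h m x assume h: "0 < h" "h \<le> (1::real)"
    have "f y \<le> ?g y + e / 2" for y using close[of y] by linarith
    then have "f x \<le> (avg b h ^^ m) ?g x + (e / 2 + real m * (h\<^sup>2 / (2 * real CARD('n)) * c + 2 * C * h ^ 3))"
      using e by (intro heat_iterate[OF f(1,2) r visc h C(1) c _ cg g0 C(2)[OF h]]) auto
    moreover have "?g y \<le> f y + e / 2" for y using close[of y] by linarith
    then have "(avg b h ^^ m) ?g x \<le> (avg b h ^^ m) (\<lambda>y. f y + e / 2) x"
      by (rule avg_power_mono)
    ultimately show "f x \<le> (avg b h ^^ m) f x + (e + real m * (h\<^sup>2 / (2 * real CARD('n)) * c + 2 * C * h ^ 3))"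
      by (simp add: avg_power_add_const)
  qed
qed

text \<open>A viscosity subsolution of a constant-coefficient equation stays a subsolution after convolution
  with a nonnegative kernel: it lies below its heat evolution, and this inequality survives convolution.\<close>

lemma convolution_subsolution:
  fixes f :: "real^'n::finite \<Rightarrow> real" and b :: "'n \<Rightarrow> real^'n"
  assumes f: "continuous_on UNIV f" "\<And>x. r < norm x \<Longrightarrow> f x = 0" "\<And>x. 0 \<le> f x" and r: "0 \<le> r"
    and visc: "\<And>x p X. transpose X = X \<Longrightarrow> superjet f x p X \<Longrightarrow> - c \<le> (\<Sum>i\<in>UNIV. qform X (b i))"
    and c: "0 \<le> c" and \<kappa>: "kernel s \<kappa>" "\<And>y. 0 \<le> \<kappa> y"
  shows "- c * integral (cube s) \<kappa> \<le> (\<Sum>i\<in>UNIV. qform (hess (cv s \<kappa> f) x) (b i))"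
proof (rule ccontr)
  let ?G = "cv s \<kappa> f" and ?n = "2 * real CARD('n)" and ?I = "integral (cube s) \<kappa>"
  let ?N = "\<lambda>x. \<Sum>i\<in>UNIV. qform (hess ?G x) (b i)"
  have n0: "0 < ?n" by simp
  have I0: "0 \<le> ?I" 
    by (rule integral_nonneg) (use \<kappa> in \<open>auto simp: cube_def intro!: integrable_continuous kernel_continuous\<close>)
  assume neg: "\<not> - c * ?I \<le> ?N x"
  define \<eta> where "\<eta> = - (?N x + c * ?I)"
  have \<eta>: "\<eta> > 0" "?N x + c * ?I = - \<eta>"
    using neg unfolding \<eta>_def mult_minus_left by linarith+
  obtain M where M: "\<And>x. \<bar>f x\<bar> \<le> M"
  proof -
    have "compact (f ` cball 0 r)"
      by (intro compact_continuous_image continuous_on_subset[OF f(1)]) auto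
    then obtain B where B: "\<And>y. y \<in> cball 0 r \<Longrightarrow> \<bar>f y\<bar> \<le> B"
      using compact_imp_bounded bounded_real by (metis (no_types, lifting) imageI)
    have "\<bar>f x\<bar> \<le> \<bar>B\<bar>" for x using B[of x] f(2)[of x] by (cases "norm x \<le> r") auto
    then show ?thesis using that by blast
  qed
  obtain C where C: "C \<ge> 0" "\<And>h. 0 < h \<Longrightarrow> h \<le> 1 \<Longrightarrow> heat_adapted b h C ?G ?N"
    using heat_adapted_cv[OF \<kappa>(1) f(1) M, of b] by blast
  \<comment> \<open>The total heat time \<open>m * h\<^sup>2\<close>, short enough that the
    generator at \<open>x\<close> grows by at most \<open>\<eta> / 4\<close> during the
    evolution.\<close>
  define t where "t = \<eta> / (4 * (C + 1))"
  have t: "t > 0" using \<eta> C by (simp add: t_def)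
  have Ct: "C * t \<le> \<eta> / 4" using \<eta> C by (simp add: t_def field_simps)
  \<comment> \<open>Chosen after \<open>t\<close>: the error from mollifying \<open>f\<close> may
    use up only a quarter of the deficit \<open>\<eta>\<close> accumulated in time
    \<open>t\<close>.\<close>
  define e where "e = (t / ?n) * (\<eta> / 4) / (?I + 1)"
  have e: "e > 0" unfolding e_def using t \<eta> I0 n0 by (intro divide_pos_pos mult_pos_pos) auto
  have Ie: "?I * e \<le> (t / ?n) * (\<eta> / 4)"
  proof -
    have "?I * e \<le> (?I + 1) * e" using e by (intro mult_right_mono) auto
    also have "\<dots> = (t / ?n) * (\<eta> / 4)" unfolding e_def using I0 by simp
    finally show ?thesis .
  qed
  have "\<exists>C'\<ge>0. \<forall>h m x. 0 < h \<longrightarrow> h \<le> 1 \<longrightarrow>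
    f x \<le> (avg b h ^^ m) f x + (e + real m * (h\<^sup>2 / ?n * c + 2 * C' * h ^ 3))"
    by (rule heat_subsolution[where b = b, OF f r visc c e])
  then obtain C' where C': "0 \<le> C'" "\<And>h m x. 0 < h \<Longrightarrow> h \<le> 1 \<Longrightarrow>
    f x \<le> (avg b h ^^ m) f x + (e + real m * (h\<^sup>2 / ?n * c + 2 * C' * h ^ 3))"
    by blast
  \<comment> \<open>Bounds the coefficients of all errors of size \<open>m * h ^ 3\<close>, which
    equal \<open>t * h\<close> and vanish with the step size.\<close>
  define Q where "Q = t * C + 2 * ?I * C' * t + 1"
  have Q: "Q > 0" unfolding Q_def using t C C' I0 by (intro add_nonneg_pos add_nonneg_nonneg mult_nonneg_nonneg) auto
  define h0 where "h0 = min 1 ((t / ?n) * (\<eta> / 4) / Q)"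
  have h0: "h0 > 0" unfolding h0_def using t \<eta> Q n0 by simp
  \<comment> \<open>The number of steps is chosen first; \<open>h = sqrt (t / m)\<close> then gives
    \<open>m * h\<^sup>2 = t\<close> exactly and lies below \<open>h0\<close>.\<close>
  obtain m :: nat where m: "t / h0\<^sup>2 < real m" using reals_Archimedean2 by blast
  have m0: "real m > 0" using m t h0 by (smt (verit) divide_pos_pos zero_less_power)
  define h where "h = sqrt (t / real m)"
  have h: "h > 0" using t m0 by (simp add: h_def)
  have mh: "real m * h\<^sup>2 = t" using t m0 by (simp add: h_def)
  have "t < real m * h0\<^sup>2" using m h0 by (simp add: pos_divide_less_eq)
  then have "h\<^sup>2 < h0\<^sup>2" using mh m0 by (metis mult_less_cancel_left_pos)
  then have hh0: "h < h0" using h0 by (simp add: power2_less_imp_less)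
  have h1: "h \<le> 1" using hh0 by (simp add: h0_def)
  have hQ: "h * Q \<le> (t / ?n) * (\<eta> / 4)"
  proof -
    have "h \<le> (t / ?n) * (\<eta> / 4) / Q" using hh0 by (simp add: h0_def)
    then show ?thesis using pos_le_divide_eq[OF Q] by blast
  qed
  note heat_adapted = C(2)[OF h h1]
  have cavg: "continuous_on UNIV ((avg b h ^^ l) f)" for l
    by (induction l) (auto intro: f avg_continuous)
  \<comment> \<open>Here the inequality between \<open>f\<close> and its evolution is carried over
    to the convolution, for which the generator is an honest second derivative.\<close>
  have cvavg: "cv s \<kappa> ((avg b h ^^ l) f) y = (avg b h ^^ l) ?G y" for l y
  proof (induction l arbitrary: y)
    case (Suc l)
    have "(avg b h ^^ l) ?G = cv s \<kappa> ((avg b h ^^ l) f)" by (rule ext) (simp add: Suc)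
    then show ?case using cv_avg[OF \<kappa>(1) cavg, of b h l y] by simp
  qed simp
  let ?E = "e + real m * (h\<^sup>2 / ?n * c + 2 * C' * h ^ 3)"
  have "?G x \<le> cv s \<kappa> (\<lambda>y. (avg b h ^^ m) f y + ?E) x"
    by (intro cv_mono[OF \<kappa>(1) f(1)] continuous_on_add continuous_on_const cavg \<kappa>(2) C'(2) h h1)
  also have "\<dots> = (avg b h ^^ m) ?G x + ?E * ?I"
    using cv_add[OF \<kappa>(1) cavg continuous_on_const, of m ?E x] by (simp add: cvavg cv_const)
  finally have GE: "?G x \<le> (avg b h ^^ m) ?G x + ?E * ?I" .
  have Nl: "(avg b h ^^ l) ?N x \<le> ?N x + real l * (C * h\<^sup>2)" for l
  proof (induction l)
    case (Suc l)
    have "\<bar>avg b h ((avg b h ^^ l) ?N) x - (avg b h ^^ l) ?N x\<bar> \<le> C * h\<^sup>2"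
      using heat_adapted_avg_power[OF heat_adapted, of l] by (simp add: heat_adapted_def)
    then show ?case using Suc by (simp add: algebra_simps)
  qed simp
  have Gl: "(avg b h ^^ l) ?G x \<le> ?G x + real l * (h\<^sup>2 / ?n * (?N x + real m * (C * h\<^sup>2)) + C * h ^ 3)" if "l \<le> m" for l
    using that
  proof (induction l)
    case (Suc l)
    have "\<bar>avg b h ((avg b h ^^ l) ?G) x - (avg b h ^^ l) ?G x - h\<^sup>2 / ?n * (avg b h ^^ l) ?N x\<bar> \<le> C * h ^ 3"
      using heat_adapted_avg_power[OF heat_adapted, of l] by (simp add: heat_adapted_def)
    moreover have "real l * (C * h\<^sup>2) \<le> real m * (C * h\<^sup>2)" using Suc C by (intro mult_right_mono) auto
    then have "h\<^sup>2 / ?n * (avg b h ^^ l) ?N x \<le> h\<^sup>2 / ?n * (?N x + real m * (C * h\<^sup>2))"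
      using Nl[of l] by (intro mult_left_mono) auto
    ultimately have "(avg b h ^^ Suc l) ?G x \<le> (avg b h ^^ l) ?G x + (h\<^sup>2 / ?n * (?N x + real m * (C * h\<^sup>2)) + C * h ^ 3)"
      by simp
    then show ?case using Suc by (simp add: distrib_right)
  qed simp
  have mC: "real m * (C * h\<^sup>2) = C * t" using mh by (simp add: mult.left_commute)
  have h3: "real m * (A * h ^ 3) = A * t * h" for A
  proof -
    have "real m * (A * h ^ 3) = A * (real m * h\<^sup>2) * h" by (simp add: power3_eq_cube power2_eq_square)
    then show ?thesis by (simp add: mh)
  qed
  have h2: "real m * (h\<^sup>2 / ?n * A) = t / ?n * A" for A
  proof -
    have "real m * (h\<^sup>2 / ?n * A) = (real m * h\<^sup>2) / ?n * A" by simp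
    then show ?thesis by (simp only: mh)
  qed
  have "(avg b h ^^ m) ?G x \<le> ?G x + (t / ?n * (?N x + C * t) + C * t * h)"
    using Gl[of m] unfolding distrib_left[of "real m"] h2 h3 mC by simp
  then have "0 \<le> t / ?n * (?N x + C * t) + C * t * h + ?E * ?I" using GE by linarith
  also have "?E * ?I = ?I * e + (t / ?n * (c * ?I) + 2 * ?I * C' * t * h)"
    unfolding distrib_left[of "real m"] h2 h3 mult.assoc[of 2 C'] using h3[of 1]
    by (simp add: algebra_simps)
  finally have "0 \<le> t / ?n * (?N x + c * ?I + C * t) + ?I * e + (C * t * h + 2 * ?I * C' * t * h)"
    by (simp add: distrib_left)
  also have "C * t * h + 2 * ?I * C' * t * h \<le> h * Q" using h by (simp add: Q_def algebra_simps)
  also have "?N x + c * ?I + C * t = - \<eta> + C * t" using \<eta> by simp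
  finally have "0 \<le> t / ?n * (- \<eta> + C * t) + (t / ?n) * (\<eta> / 4) + (t / ?n) * (\<eta> / 4)"
    using Ie hQ by linarith
  also have "\<dots> = t / ?n * (- \<eta> / 2 + C * t)" by (simp only: distrib_left[symmetric] add.assoc) simp
  also have "\<dots> < 0" using t n0 Ct \<eta> by (intro mult_pos_neg divide_pos_pos) auto
  finally show False by simp
qed

section \<open>Localisation to a ball\<close>

lemma qform_bound: "\<exists>C\<ge>0. \<forall>v. \<bar>qform X v\<bar> \<le> C * (norm v)\<^sup>2"
proof -
  obtain K where K: "\<And>v. norm (X *v v) \<le> norm v * K"
    using bounded_linear.bounded[OF matrix_vector_mul_bounded_linear[of X]] by blast
  have "\<bar>qform X v\<bar> \<le> \<bar>K\<bar> * (norm v)\<^sup>2" for v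
  proof -
    have "\<bar>qform X v\<bar> \<le> norm v * norm (X *v v)" unfolding qform_def by (rule Cauchy_Schwarz_ineq2)
    also have "\<dots> \<le> norm v * (norm v * \<bar>K\<bar>)"
      using order_trans[OF K[of v] mult_left_mono[of K "\<bar>K\<bar>" "norm v"]] by (intro mult_left_mono) auto
    finally show ?thesis by (simp add: power2_eq_square mult_ac)
  qed
  then show ?thesis by (intro exI[of _ "\<bar>K\<bar>"]) auto
qed

text \<open>Adding the superjet inequalities at \<open>x + t *\<^sub>R v\<close> and
  \<open>x - t *\<^sub>R v\<close> cancels the linear term.\<close>

lemma superjet_local_min:
  assumes sj: "superjet f x p X" and r: "r > 0" and min: "\<And>y. norm (y - x) < r \<Longrightarrow> f x \<le> f y"
  shows "0 \<le> qform X v"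
proof (rule ccontr)
  assume "\<not> 0 \<le> qform X v"
  then have neg: "qform X v < 0" by simp
  then have v: "v \<noteq> 0" by (auto simp: qform_def)
  define \<epsilon> where "\<epsilon> = - qform X v / (4 * (norm v)\<^sup>2)"
  have e: "\<epsilon> > 0" unfolding \<epsilon>_def using neg v by (intro divide_pos_pos) auto
  obtain d where d: "d > 0" "\<And>y. norm (y - x) < d \<Longrightarrow> f y \<le> f x + p \<bullet> (y - x) + qform X (y - x) / 2 + \<epsilon> * (norm (y - x))\<^sup>2"
    using sj e unfolding superjet_def by meson
  define t where "t = min d r / (2 * norm v)"
  have t: "t > 0" using d r v by (simp add: t_def)
  have tn: "norm (t *\<^sub>R v) < d" "norm (t *\<^sub>R v) < r" using d r v by (auto simp: t_def min_def)
  have "f x \<le> f x + t * (p \<bullet> v) + t\<^sup>2 * qform X v / 2 + \<epsilon> * (t\<^sup>2 * (norm v)\<^sup>2)"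
    using d(2)[of "x + t *\<^sub>R v"] min[of "x + t *\<^sub>R v"] tn t by (simp add: qform_scaleR power_mult_distrib)
  moreover have "f x \<le> f x - t * (p \<bullet> v) + t\<^sup>2 * qform X v / 2 + \<epsilon> * (t\<^sup>2 * (norm v)\<^sup>2)"
    using d(2)[of "x + (- t) *\<^sub>R v"] min[of "x + (- t) *\<^sub>R v"] tn t
    by (simp add: qform_scaleR[of X "- t" v, simplified] power_mult_distrib)
  ultimately have "0 \<le> t\<^sup>2 * qform X v + 2 * (\<epsilon> * (t\<^sup>2 * (norm v)\<^sup>2))" by linarith
  also have "\<dots> = t\<^sup>2 * (qform X v / 2)" using v by (simp add: \<epsilon>_def field_simps)
  also have "\<dots> < 0" using t neg by (simp add: mult_pos_neg)
  finally show False by simp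
qed

lemma norm_add_sq: "(norm (a + b))\<^sup>2 = (norm a)\<^sup>2 + 2 * (a \<bullet> b) + (norm b)\<^sup>2"
  by (simp add: power2_norm_eq_inner inner_add_left inner_add_right inner_commute)

lemma superjet_quadratic:
  "superjet (\<lambda>y. N * ((norm (y - x0))\<^sup>2 - c) + m) x ((2 * N) *\<^sub>R (x - x0)) ((2 * N) *\<^sub>R mat 1)"
proof -
  have eq: "N * ((norm (y - x0))\<^sup>2 - c) + m = N * ((norm (x - x0))\<^sup>2 - c) + m + ((2 * N) *\<^sub>R (x - x0)) \<bullet> (y - x)
      + qform ((2 * N) *\<^sub>R mat 1) (y - x) / 2" for y
  proof -
    have "(norm (y - x0))\<^sup>2 = (norm (x - x0 + (y - x)))\<^sup>2" by simp
    also have "\<dots> = (norm (x - x0))\<^sup>2 + 2 * ((x - x0) \<bullet> (y - x)) + (norm (y - x))\<^sup>2"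
      by (rule norm_add_sq)
    moreover have "qform ((2 * N) *\<^sub>R mat 1) (y - x) = 2 * N * (norm (y - x))\<^sup>2"
      by (simp add: qform_cmult) (simp add: qform_def power2_norm_eq_inner)
    ultimately show ?thesis by (simp only: inner_scaleR_left) (simp add: algebra_simps)
  qed
  show ?thesis unfolding superjet_def
  proof (intro allI impI exI[of _ 1] conjI)
    fix \<epsilon> :: real and y assume "\<epsilon> > 0"
    then have "0 \<le> \<epsilon> * (norm (y - x))\<^sup>2" by simp
    then show "N * ((norm (y - x0))\<^sup>2 - c) + m \<le> N * ((norm (x - x0))\<^sup>2 - c) + m + ((2 * N) *\<^sub>R (x - x0)) \<bullet> (y - x)
      + qform ((2 * N) *\<^sub>R mat 1) (y - x) / 2 + \<epsilon> * (norm (y - x))\<^sup>2"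
      using eq[of y] by linarith
  qed simp
qed

lemma smooth_on_line_derivs:
  assumes "smooth_on UNIV g"
  shows "((\<lambda>t. g (x + t *\<^sub>R b)) has_real_derivative dird b g (x + t *\<^sub>R b)) (at t)"
    "((\<lambda>t. dird b g (x + t *\<^sub>R b)) has_real_derivative dird b (dird b g) (x + t *\<^sub>R b)) (at t)"
  using dird_has_real_derivative[OF open_UNIV assms, of x t b]
    dird_has_real_derivative[OF open_UNIV smooth_on_dird[OF open_UNIV assms], of x t b b]
  by auto

text \<open>Obtained by differentiating the identity twice in \<open>t\<close>. It serves to compute
  the second derivatives of a convolved paraboloid, whose second differences are exactly
  quadratic.\<close>

lemma second_difference_hess:
  assumes g: "smooth_on UNIV g" and eq: "\<And>t. g (x + t *\<^sub>R b) + g (x - t *\<^sub>R b) - 2 * g x = A * t\<^sup>2"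
  shows "dird b (dird b g) x = A"
proof -
  note D = smooth_on_line_derivs[OF g, where x = x and b = b]
  have m: "((\<lambda>t::real. - t) has_real_derivative -1) (at t)" for t by (auto intro!: derivative_eq_intros)
  have "((\<lambda>t. g (x + t *\<^sub>R b) + g (x + (- t) *\<^sub>R b) - 2 * g x) has_real_derivative
      dird b g (x + t *\<^sub>R b) + dird b g (x + (- t) *\<^sub>R b) * (- 1) - 0) (at t)" for t
    by (intro DERIV_diff DERIV_add D DERIV_const DERIV_chain2[where f = "\<lambda>s. g (x + s *\<^sub>R b)" and g = "\<lambda>t. - t", OF D(1) m])
  moreover have "(\<lambda>t. g (x + t *\<^sub>R b) + g (x + (- t) *\<^sub>R b) - 2 * g x) = (\<lambda>t. A * t\<^sup>2)"
    using eq by (simp add: fun_eq_iff)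
  moreover have "((\<lambda>t. A * t\<^sup>2) has_real_derivative 2 * A * t) (at t)" for t
    by (auto intro!: derivative_eq_intros)
  ultimately have D1: "dird b g (x + t *\<^sub>R b) + dird b g (x + (- t) *\<^sub>R b) * (- 1) = 2 * A * t" for t
    using DERIV_unique by fastforce
  have d2: "((\<lambda>t. dird b g (x + (- t) *\<^sub>R b)) has_real_derivative dird b (dird b g) (x + (- t) *\<^sub>R b) * (- 1)) (at t)" for t
    by (rule DERIV_chain2[where f = "\<lambda>s. dird b g (x + s *\<^sub>R b)" and g = "\<lambda>t. - t", OF D(2) m])
  have E1: "((\<lambda>t. dird b g (x + t *\<^sub>R b) + dird b g (x + (- t) *\<^sub>R b) * (- 1)) has_real_derivative
      dird b (dird b g) (x + 0 *\<^sub>R b) + (dird b (dird b g) (x + (- 0) *\<^sub>R b) * (- 1)) * (- 1)) (at 0)"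
    by (rule DERIV_add[OF D(2)[of 0] DERIV_cmult_right[OF d2[of 0], of "- 1"]])
  have E2: "((\<lambda>t. 2 * A * t) has_real_derivative 2 * A) (at 0)"
    by (auto intro!: derivative_eq_intros)
  have "dird b (dird b g) x + dird b (dird b g) x = 2 * A"
    using DERIV_unique[OF E1[unfolded D1] E2] by simp
  then show ?thesis by simp
qed

lemma dird_add:
  assumes "smooth_on UNIV f" "smooth_on UNIV g"
  shows "dird b (\<lambda>x. f x + g x) = (\<lambda>x. dird b f x + dird b g x)"
proof
  fix x
  have "has_partials UNIV (\<lambda>x. f x + g x) (\<lambda>i x. partial_deriv i f x + partial_deriv i g x)"
    using smooth_on_partial_deriv(2)[OF open_UNIV assms(1)] smooth_on_partial_deriv(2)[OF open_UNIV assms(2)]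
    by (auto simp: has_partials_def sum.distrib distrib_left intro!: derivative_eq_intros)
  then have "partial_deriv i (\<lambda>x. f x + g x) x = partial_deriv i f x + partial_deriv i g x" for i
    by (rule has_partials_partial_deriv) simp
  then show "dird b (\<lambda>x. f x + g x) x = dird b f x + dird b g x" by (simp add: dird_def distrib_left sum.distrib)
qed

lemma dird_cong_open:
  assumes S: "open S" and f: "smooth_on S f" and eq: "\<And>x. x \<in> S \<Longrightarrow> f x = g x" and x: "x \<in> S"
  shows "dird b g x = dird b f x"
proof -
  have "has_partials S g (\<lambda>i. partial_deriv i f)"
    unfolding has_partials_def
  proof
    fix y assume y: "y \<in> S"
    show "(g has_derivative (\<lambda>h. \<Sum>i\<in>UNIV. h $ i * partial_deriv i f y)) (at y)"
      by (rule has_derivative_transform_within_open[OF _ S y eq])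
        (use smooth_on_partial_deriv(2)[OF S f] y in \<open>auto simp: has_partials_def\<close>)
  qed
  then have "partial_deriv i g x = partial_deriv i f x" for i by (rule has_partials_partial_deriv(1)[OF _ x])
  then show ?thesis by (simp add: dird_def)
qed

text \<open>Localisation of the preceding lemma: \<open>F\<close> is glued to a large paraboloid \<open>Q\<close> outside a neighbourhood
  of \<open>x\<^sub>0\<close>, and the compactly supported function \<open>max (F - Q) 0\<close> is convolved.\<close>

lemma local_convolution_subsolution:
  fixes F :: "real^'n::finite \<Rightarrow> real" and b :: "'n \<Rightarrow> real^'n"
  assumes F: "continuous_on UNIV F" and R: "R > 0"
    and visc: "\<And>x p X. norm (x - x0) < R \<Longrightarrow> transpose X = X \<Longrightarrow> superjet F x p X \<Longrightarrow> 0 \<le> (\<Sum>i\<in>UNIV. qform X (b i))"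
    and \<kappa>: "kernel s \<kappa>" "\<And>y. 0 \<le> \<kappa> y" "\<And>y. R / 4 \<le> norm y \<Longrightarrow> \<kappa> y = 0"
  shows "0 \<le> (\<Sum>i\<in>UNIV. qform (hess (cv s \<kappa> F) x0) (b i))"
proof -
  have cF: "continuous_on (cball x0 R) F" by (rule continuous_on_subset[OF F]) simp
  have ne: "cball x0 R \<noteq> {}" using R by simp
  obtain ym where ym: "\<And>y. y \<in> cball x0 R \<Longrightarrow> F ym \<le> F y"
    using continuous_attains_inf[OF compact_cball ne cF] by blast
  obtain yM where yM: "yM \<in> cball x0 R" "\<And>y. y \<in> cball x0 R \<Longrightarrow> F y \<le> F yM"
    using continuous_attains_sup[OF compact_cball ne cF] by blast
  \<comment> \<open>With \<open>N * R\<^sup>2 = 4 * (M - m)\<close> the paraboloid \<open>Q\<close>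
    lies below the minimum \<open>m\<close> of \<open>F\<close> on the ball of radius
    \<open>R / 2\<close> and above its maximum \<open>M\<close> from radius \<open>3 * R / 4\<close>
    on.\<close>
  define m M N where "m = F ym" and "M = F yM" and "N = 4 * (M - m) / R\<^sup>2"
  have mM: "m \<le> M" using ym[OF yM(1)] by (simp add: m_def M_def)
  have N: "N \<ge> 0" using mM by (simp add: N_def)
  have NR: "N * R\<^sup>2 = 4 * (M - m)" using R by (simp add: N_def)
  define Q where "Q y = N * ((norm (y - x0))\<^sup>2 - R\<^sup>2 / 4) + m" for y
  have Qin: "Q y \<le> F y" if "norm (y - x0) \<le> R / 2" for y
  proof -
    have "(norm (y - x0))\<^sup>2 \<le> (R / 2)\<^sup>2" using that by (intro power_mono) auto
    then have "N * ((norm (y - x0))\<^sup>2 - R\<^sup>2 / 4) \<le> 0" using N by (intro mult_nonneg_nonpos) (auto simp: power_divide)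
    moreover have "m \<le> F y" unfolding m_def using that R by (intro ym) (simp add: dist_norm norm_minus_commute)
    ultimately show ?thesis by (simp add: Q_def)
  qed
  have Qout: "F y \<le> Q y" if "3 * R / 4 \<le> norm (y - x0)" "norm (y - x0) \<le> R" for y
  proof -
    have "(3 * R / 4)\<^sup>2 \<le> (norm (y - x0))\<^sup>2" using that R by (intro power_mono) auto
    then have "R\<^sup>2 / 4 \<le> (norm (y - x0))\<^sup>2 - R\<^sup>2 / 4"
    proof -
      have "(3 * R / 4)\<^sup>2 = 9 * R\<^sup>2 / 16" by (simp add: power_divide power_mult_distrib)
      then show ?thesis using \<open>(3 * R / 4)\<^sup>2 \<le> (norm (y - x0))\<^sup>2\<close> zero_le_power2[of "norm (y - x0)"] by linarith
    qed
    then have "N * (R\<^sup>2 / 4) \<le> N * ((norm (y - x0))\<^sup>2 - R\<^sup>2 / 4)" using N by (intro mult_left_mono)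
    then have "M \<le> Q y" using NR by (simp add: Q_def)
    moreover have "F y \<le> M" unfolding M_def using that by (intro yM) (simp add: dist_norm norm_minus_commute)
    ultimately show ?thesis by simp
  qed
  define f where "f y = (if norm (y - x0) < R then max (F y - Q y) 0 else 0)" for y
  have f0: "0 \<le> f y" for y by (simp add: f_def)
  have fout: "f y = 0" if "3 * R / 4 \<le> norm (y - x0)" for y
    using Qout[OF that] by (auto simp: f_def)
  have fin: "f y = F y - Q y" if "norm (y - x0) \<le> R / 2" for y
    using Qin[OF that] that R by (simp add: f_def)
  have cQ: "continuous_on UNIV Q" unfolding Q_def[abs_def] by (intro continuous_intros)
  have cf: "continuous_on UNIV f"
  proof -
    have "continuous_on (ball x0 R) (\<lambda>y. max (F y - Q y) 0)"
      by (intro continuous_on_max continuous_on_diff continuous_on_const continuous_on_subset[OF F] continuous_on_subset[OF cQ]) auto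
    then have "continuous_on (ball x0 R) f"
      by (rule continuous_on_eq) (simp add: f_def dist_norm norm_minus_commute)
    moreover have "continuous_on (- cball x0 (3 * R / 4)) f"
      by (rule continuous_on_eq[OF continuous_on_const[of _ 0]]) (auto simp: dist_norm norm_minus_commute fout)
    ultimately have "continuous_on (ball x0 R \<union> - cball x0 (3 * R / 4)) f"
      by (intro continuous_on_open_Un) auto
    moreover have "ball x0 R \<union> - cball x0 (3 * R / 4) = UNIV" using R by auto
    ultimately show ?thesis by simp
  qed
  \<comment> \<open>The contribution of the Hessian of \<open>Q\<close>. Subtracting
    \<open>Q\<close> weakens the subsolution property by \<open>c\<close>; adding the convolved
    \<open>Q\<close> back returns exactly \<open>c\<close> times the mass of the kernel.\<close>
  define c where "c = (\<Sum>i\<in>UNIV. 2 * N * (norm (b i))\<^sup>2)"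
  have c: "0 \<le> c" unfolding c_def using N by (intro sum_nonneg) auto
  have fvisc: "- c \<le> (\<Sum>i\<in>UNIV. qform X (b i))" if X: "transpose X = X" and sj: "superjet f x p X" for x p X
  \<comment> \<open>At zeros of \<open>f\<close> nothing is known about \<open>F\<close>, but
    \<open>f\<close> is minimal there, and the superjets of a minimum are nonnegative.\<close>
  proof (cases "f x = 0")
    case True
    then have "0 \<le> qform X (b i)" for i
      by (intro superjet_local_min[OF sj zero_less_one]) (simp add: f0)
    then have "0 \<le> (\<Sum>i\<in>UNIV. qform X (b i))" by (rule sum_nonneg)
    then show ?thesis using c by linarith
  next
    case False
    then have xR: "norm (x - x0) < R" and fx: "f x = F x - Q x" by (auto simp: f_def max_def split: if_splits)
    have "superjet (\<lambda>y. f y + Q y) x (p + (2 * N) *\<^sub>R (x - x0)) (X + (2 * N) *\<^sub>R mat 1)"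
      unfolding Q_def[abs_def] by (rule superjet_add[OF sj superjet_quadratic])
    moreover have "F y - F x \<le> (f y + Q y) - (f x + Q x)" if "norm (y - x) < R - norm (x - x0)" for y
    proof -
      have "norm (y - x0) < R" using norm_triangle_ineq[of "y - x" "x - x0"] that by simp
      then show ?thesis by (simp add: f_def[of y] fx)
    qed
    ultimately have "superjet F x (p + (2 * N) *\<^sub>R (x - x0)) (X + (2 * N) *\<^sub>R mat 1)"
      by (rule superjet_touch) (use xR in auto)
    then have "0 \<le> (\<Sum>i\<in>UNIV. qform (X + (2 * N) *\<^sub>R mat 1) (b i))"
      by (rule visc[OF xR, rotated]) (simp add: transpose_add X transpose_scaleR)
    also have "\<dots> = (\<Sum>i\<in>UNIV. qform X (b i)) + c"
      by (simp add: qform_add qform_cmult sum.distrib c_def) (simp add: qform_def power2_norm_eq_inner)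
    finally show ?thesis by simp
  qed
  have "f y = 0" if "norm x0 + R < norm y" for y
    using norm_triangle_ineq2[of y x0] that R by (intro fout) auto
  then have "- c * integral (cube s) \<kappa> \<le> (\<Sum>i\<in>UNIV. qform (hess (cv s \<kappa> f) x0) (b i))"
    by (rule convolution_subsolution[OF cf _ f0 _ fvisc c \<kappa>(1,2)]) (use R in \<open>auto simp: add_nonneg_nonneg\<close>)
  also have "\<dots> = (\<Sum>i\<in>UNIV. qform (hess (cv s \<kappa> F) x0) (b i)) - c * integral (cube s) \<kappa>"
  proof -
    let ?f = "cv s \<kappa> f" and ?Q = "cv s \<kappa> Q" and ?F = "cv s \<kappa> F"
    note sm = cv_smooth[OF \<kappa>(1) cf] cv_smooth[OF \<kappa>(1) cQ] cv_smooth[OF \<kappa>(1) F]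
    have eq: "?F x = ?f x + ?Q x" if "x \<in> ball x0 (R / 4)" for x
    proof -
      have "\<kappa> y * F (x - y) = \<kappa> y * f (x - y) + \<kappa> y * Q (x - y)" for y
      proof (cases "\<kappa> y = 0")
        case False
        then have "norm y < R / 4" using \<kappa>(3) not_le by blast
        then have "norm (x - y - x0) \<le> R / 2"
          using norm_triangle_ineq4[of "x - x0" y] that by (simp add: dist_norm norm_minus_commute algebra_simps)
        then show ?thesis by (simp add: fin algebra_simps)
      qed simp
      then have "?F x = cv s \<kappa> (\<lambda>x. f x + Q x) x" unfolding cv_def by (simp add: distrib_left)
      then show ?thesis by (simp add: cv_add[OF \<kappa>(1) cf cQ])
    qed
    have sQ: "dird v (dird v ?Q) x0 = 2 * N * (norm v)\<^sup>2 * integral (cube s) \<kappa>" for v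
    proof (rule second_difference_hess[OF sm(2)])
      fix t
      have q: "Q (y + t *\<^sub>R v) + Q (y - t *\<^sub>R v) = 2 * Q y + 2 * N * (norm v)\<^sup>2 * t\<^sup>2" for y
      proof -
        have "(norm (y - x0 + t *\<^sub>R v))\<^sup>2 + (norm (y - x0 - t *\<^sub>R v))\<^sup>2 = 2 * (norm (y - x0))\<^sup>2 + 2 * (t\<^sup>2 * (norm v)\<^sup>2)"
          unfolding power2_norm_eq_inner by (simp add: inner_add_left inner_add_right inner_diff_left inner_diff_right power2_eq_square algebra_simps)
        moreover have "Q (y + t *\<^sub>R v) + Q (y - t *\<^sub>R v)
          = N * ((norm (y - x0 + t *\<^sub>R v))\<^sup>2 + (norm (y - x0 - t *\<^sub>R v))\<^sup>2) + 2 * (m - N * (R\<^sup>2 / 4))"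
          by (simp add: Q_def algebra_simps)
        ultimately show ?thesis by (simp add: Q_def algebra_simps)
      qed
      have "?Q (x0 + t *\<^sub>R v) + ?Q (x0 - t *\<^sub>R v) = integral (cube s) (\<lambda>y. \<kappa> y * Q (x0 + t *\<^sub>R v - y) + \<kappa> y * Q (x0 - t *\<^sub>R v - y))"
        unfolding cv_def by (rule integral_add[symmetric]) (intro cv_integrable \<kappa>(1) cQ)+
      also have "\<dots> = integral (cube s) (\<lambda>y. \<kappa> y * (2 * Q (x0 - y) + 2 * N * (norm v)\<^sup>2 * t\<^sup>2))"
      proof (rule integral_cong)
        fix y
        show "\<kappa> y * Q (x0 + t *\<^sub>R v - y) + \<kappa> y * Q (x0 - t *\<^sub>R v - y) = \<kappa> y * (2 * Q (x0 - y) + 2 * N * (norm v)\<^sup>2 * t\<^sup>2)"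
          using q[of "x0 - y"] by (simp add: distrib_left[symmetric] algebra_simps)
      qed
      also have "\<dots> = cv s \<kappa> (\<lambda>x. 2 * Q x + 2 * N * (norm v)\<^sup>2 * t\<^sup>2) x0" by (simp add: cv_def)
      also have "\<dots> = 2 * ?Q x0 + 2 * N * (norm v)\<^sup>2 * t\<^sup>2 * integral (cube s) \<kappa>"
        by (subst cv_add[OF \<kappa>(1)]) (auto intro!: continuous_intros cQ simp: cv_cmult cv_const)
      finally show "?Q (x0 + t *\<^sub>R v) + ?Q (x0 - t *\<^sub>R v) - 2 * ?Q x0 = 2 * N * (norm v)\<^sup>2 * integral (cube s) \<kappa> * t\<^sup>2"
        by (simp add: algebra_simps)
    qed
    have "qform (hess ?F x0) v = qform (hess ?f x0) v + 2 * N * (norm v)\<^sup>2 * integral (cube s) \<kappa>" for v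
    proof -
      let ?B = "ball x0 (R / 4)"
      note smB = smooth_on_subset[OF smooth_add[OF sm(1,2)] subset_UNIV, of ?B]
      have x0: "x0 \<in> ?B" using R by simp
      have "dird v (dird v ?F) x0 = dird v (dird v (\<lambda>x. ?f x + ?Q x)) x0"
      proof (rule dird_cong_open[OF open_ball smooth_on_dird[OF open_ball smB] _ x0])
        fix x assume "x \<in> ?B"
        then show "dird v (\<lambda>x. ?f x + ?Q x) x = dird v ?F x"
          using dird_cong_open[OF open_ball smB, of ?F x v] eq by simp
      qed
      also have "\<dots> = dird v (dird v ?f) x0 + dird v (dird v ?Q) x0"
        using sm by (simp add: dird_add smooth_on_dird)
      finally show ?thesis
        by (simp only: sQ qform_hess[OF open_UNIV sm(1) UNIV_I] qform_hess[OF open_UNIV sm(3) UNIV_I])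
    qed
    then show ?thesis by (simp add: sum.distrib c_def sum_distrib_right)
  qed
  finally show ?thesis by simp
qed

section \<open>Regularisation of strictly admissible functions\<close>

text \<open>The difference of the two sides has derivative \<open>s ^ 3 / (1 + s)\<close>, which has
  the sign of \<open>s\<close>, so its minimum is at 0.\<close>

lemma ln_third_order_le:
  fixes s :: real assumes "-1 < s"
  shows "ln (1 + s) \<le> s - s\<^sup>2 / 2 + s ^ 3 / 3"
proof -
  define h where "h s = s - s\<^sup>2 / 2 + s ^ 3 / 3 - ln (1 + s)" for s :: real
  have D: "(h has_real_derivative (s ^ 3 / (1 + s))) (at s)" if "-1 < s" for s
  proof -
    have "((\<lambda>s. s - s\<^sup>2 / 2 + s ^ 3 / 3 - ln (1 + s)) has_real_derivative
        1 - (2 * s) / 2 + (3 * s\<^sup>2) / 3 - (1 / (1 + s)) * (0 + 1)) (at s)"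
      using that by (intro DERIV_diff DERIV_add DERIV_cdivide DERIV_ident DERIV_chain2[where f = ln] DERIV_const)
        (auto intro!: derivative_eq_intros simp: divide_inverse)
    then have "(h has_real_derivative (1 - s + s\<^sup>2 - 1 / (1 + s))) (at s)"
      unfolding h_def[abs_def] by simp
    moreover have "1 - s + s\<^sup>2 - 1 / (1 + s) = s ^ 3 / (1 + s)"
      using that by (simp add: field_simps power2_eq_square power3_eq_cube)
    ultimately show ?thesis by simp
  qed
  have "0 \<le> h s"
  proof (cases "0 \<le> s")
    case True
    have "h 0 \<le> h s"
    proof (rule DERIV_nonneg_imp_nondecreasing[OF True])
      fix x assume x: "0 \<le> x" "x \<le> s"
      then have "0 \<le> x ^ 3 / (1 + x)" by (intro divide_nonneg_pos) auto
      then show "\<exists>y. (h has_real_derivative y) (at x) \<and> 0 \<le> y"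
        using D[of x] x by (intro exI[of _ "x ^ 3 / (1 + x)"]) auto
    qed
    then show ?thesis by (simp add: h_def)
  next
    case False
    have "h 0 \<le> h s"
    proof (rule DERIV_nonpos_imp_nonincreasing[of s 0])
      show "s \<le> 0" using False by simp
      fix x assume x: "s \<le> x" "x \<le> 0"
      have "x ^ 3 \<le> 0" using x by (simp add: power3_eq_cube mult_nonneg_nonpos)
      then show "\<exists>y. (h has_real_derivative y) (at x) \<and> y \<le> 0"
        using D[of x] x assms by (intro exI[of _ "x ^ 3 / (1 + x)"] conjI divide_nonpos_pos) auto
    qed
    then show ?thesis by (simp add: h_def)
  qed
  then show ?thesis by (simp add: h_def)
qed

definition outer :: "real^'n::finite \<Rightarrow> real^'n^'n" where
  "outer p = (\<chi> i j. p $ i * p $ j)"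

lemma qform_outer: "qform (outer p) v = (p \<bullet> v)\<^sup>2"
proof -
  have "outer p *v v = (p \<bullet> v) *\<^sub>R p"
    by (simp add: outer_def matrix_vector_mult_def vec_eq_iff inner_vec_def sum_distrib_left sum_distrib_right mult_ac)
  then show ?thesis by (simp add: qform_def power2_eq_square inner_commute)
qed

lemma transpose_outer: "transpose (outer p) = outer p"
  by (simp add: outer_def transpose_def vec_eq_iff mult.commute)

lemma transpose_zero: "transpose 0 = 0"
  by (simp add: transpose_def vec_eq_iff)

text \<open>The second-order chain rule survives for superjets because \<open>ln\<close> is
  increasing. Its concavity produces the \<open>outer p\<close> term, which the covariance of the
  gradients compensates later.\<close>

lemma superjet_ln:
  assumes sj: "superjet F x p X" and pos: "\<And>y. F y > 0"
  shows "superjet (\<lambda>y. ln (F y)) x ((1 / F x) *\<^sub>R p) ((1 / F x) *\<^sub>R X + (- 1 / (F x)\<^sup>2) *\<^sub>R outer p)"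
  unfolding superjet_def
proof (intro allI impI)
  fix \<epsilon> :: real assume \<epsilon>: "\<epsilon> > 0"
  define a where "a = F x"
  have a: "a > 0" using pos by (simp add: a_def)
  obtain C where C: "C \<ge> 0" "\<And>v. \<bar>qform X v\<bar> \<le> C * (norm v)\<^sup>2" using qform_bound by blast
  define e where "e = \<epsilon> * a / 2"
  have e: "e > 0" using \<epsilon> a by (simp add: e_def)
  obtain d0 where d0: "d0 > 0" "\<And>y. norm (y - x) < d0 \<Longrightarrow> F y \<le> a + p \<bullet> (y - x) + qform X (y - x) / 2 + e * (norm (y - x))\<^sup>2"
    using sj e unfolding superjet_def a_def by meson
  \<comment> \<open>With \<open>n\<close> the distance to \<open>x\<close>, the relative increment
    of \<open>F\<close> has a linear part of size \<open>P * n\<close> and a remainder of size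
    \<open>B * n\<^sup>2\<close>; \<open>Q\<close> bounds the cubic errors in the expansion of the
    logarithm.\<close>
  define B where "B = (C + e) / a"
  define P where "P = norm p / a"
  have B: "B \<ge> 0" and P: "P \<ge> 0" using C e a by (auto simp: B_def P_def)
  define Q where "Q = P * B + (P + B) ^ 3 / 3 + 1"
  have Q: "Q > 0" using B P by (auto simp: Q_def intro!: add_nonneg_pos add_nonneg_nonneg)
  define d where "d = min (min d0 1) (\<epsilon> / (2 * Q))"
  have d: "d > 0" using d0 \<epsilon> Q by (simp add: d_def)
  show "\<exists>\<delta>>0. \<forall>y. norm (y - x) < \<delta> \<longrightarrow> ln (F y) \<le> ln (F x) + ((1 / F x) *\<^sub>R p) \<bullet> (y - x)
     + qform ((1 / F x) *\<^sub>R X + (- 1 / (F x)\<^sup>2) *\<^sub>R outer p) (y - x) / 2 + \<epsilon> * (norm (y - x))\<^sup>2"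
  proof (intro exI[of _ d] conjI d allI impI)
    fix y assume y: "norm (y - x) < d"
    define v n where "v = y - x" and "n = norm (y - x)"
    have n: "0 \<le> n" "n \<le> 1" "n < d0" "n * Q \<le> \<epsilon> / 2"
    proof -
      show "0 \<le> n" "n \<le> 1" "n < d0" using y by (auto simp: n_def d_def)
      have "n \<le> \<epsilon> / (2 * Q)" using y by (simp add: n_def d_def)
      then show "n * Q \<le> \<epsilon> / 2" using Q by (simp add: field_simps)
    qed
    define L where "L = (p \<bullet> v) / a"
    define r where "r = (qform X v / 2 + e * n\<^sup>2) / a"
    define s where "s = L + r"
    have "a * r = qform X v / 2 + e * n\<^sup>2" "a * L = p \<bullet> v" using a by (simp_all add: r_def L_def)
    then have "a * (1 + s) = a + p \<bullet> v + qform X v / 2 + e * n\<^sup>2"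
      by (simp add: s_def distrib_left)
    then have Fy: "F y \<le> a * (1 + s)"
      using d0(2)[of y] n by (simp add: v_def n_def)
    then have s1: "-1 < s" using pos[of y] a by (smt (verit) mult_nonneg_nonpos)
    have L: "\<bar>L\<bar> \<le> P * n"
      using Cauchy_Schwarz_ineq2[of p v] a by (simp add: L_def P_def n_def v_def abs_divide divide_right_mono)
    have r: "\<bar>r\<bar> \<le> B * n\<^sup>2"
    proof -
      have "\<bar>qform X v / 2 + e * n\<^sup>2\<bar> \<le> \<bar>qform X v\<bar> + \<bar>e * n\<^sup>2\<bar>" by linarith
      also have "\<dots> \<le> (C + e) * n\<^sup>2" using C(2)[of v] e by (simp add: v_def n_def distrib_right)
      finally show ?thesis using a by (simp add: r_def B_def abs_divide divide_right_mono)
    qed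
    have "B * n\<^sup>2 \<le> B * n" using n B by (intro mult_left_mono) (auto simp: power2_eq_square mult_left_le)
    then have s: "\<bar>s\<bar> \<le> (P + B) * n" using L r by (simp add: s_def distrib_right)
    have Lr: "- (L * r) \<le> P * B * n ^ 3"
    proof -
      have "- (L * r) \<le> \<bar>L\<bar> * \<bar>r\<bar>" by (metis abs_ge_minus_self abs_mult)
      also have "\<dots> \<le> (P * n) * (B * n\<^sup>2)" using L r P B n by (intro mult_mono) auto
      finally show ?thesis by (simp add: power2_eq_square power3_eq_cube mult_ac)
    qed
    have s3: "s ^ 3 \<le> (P + B) ^ 3 * n ^ 3"
    proof -
      have "s ^ 3 \<le> \<bar>s\<bar> ^ 3" by (metis abs_ge_self power_abs)
      also have "\<dots> \<le> ((P + B) * n) ^ 3" by (rule power_mono[OF s]) simp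
      finally show ?thesis by (simp add: power_mult_distrib)
    qed
    have "F y > 0" by (rule pos)
    then have "ln (F y) \<le> ln (a * (1 + s))" using Fy by (intro ln_mono) auto
    also have "\<dots> = ln a + ln (1 + s)" using a s1 by (simp add: ln_mult)
    also have "\<dots> \<le> ln a + (s - s\<^sup>2 / 2 + s ^ 3 / 3)" using ln_third_order_le[OF s1] by simp
    also have "s - s\<^sup>2 / 2 = L + r - (L\<^sup>2 / 2 + L * r + r\<^sup>2 / 2)"
      by (simp add: s_def power2_eq_square algebra_simps add_divide_distrib)
    also have "ln a + (L + r - (L\<^sup>2 / 2 + L * r + r\<^sup>2 / 2) + s ^ 3 / 3) \<le> ln a + L + r - L\<^sup>2 / 2 + (P * B + (P + B) ^ 3 / 3) * n ^ 3"
    proof -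
      have "(P * B + (P + B) ^ 3 / 3) * n ^ 3 = P * B * n ^ 3 + ((P + B) ^ 3 * n ^ 3) / 3" by (simp add: distrib_right)
      then show ?thesis using Lr s3 zero_le_power2[of r] by linarith
    qed
    also have "(P * B + (P + B) ^ 3 / 3) * n ^ 3 \<le> \<epsilon> / 2 * n\<^sup>2"
    proof -
      have "(P * B + (P + B) ^ 3 / 3) * n ^ 3 \<le> Q * n ^ 3" using n by (intro mult_right_mono) (auto simp: Q_def)
      also have "\<dots> = (n * Q) * n\<^sup>2" by (simp add: power2_eq_square power3_eq_cube)
      also have "\<dots> \<le> \<epsilon> / 2 * n\<^sup>2" using n by (intro mult_right_mono) auto
      finally show ?thesis .
    qed
    also have "r = qform X v / (2 * a) + \<epsilon> / 2 * n\<^sup>2" using a by (simp add: r_def e_def add_divide_distrib)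
    finally have "ln (F y) \<le> ln a + L + qform X v / (2 * a) - L\<^sup>2 / 2 + \<epsilon> * n\<^sup>2" by simp
    moreover have "((1 / F x) *\<^sub>R p) \<bullet> v = L" by (simp add: L_def a_def)
    moreover have "qform ((1 / F x) *\<^sub>R X + (- 1 / (F x)\<^sup>2) *\<^sub>R outer p) v = qform X v / a - L\<^sup>2"
      by (simp only: qform_add qform_cmult qform_outer) (simp add: L_def a_def power_divide)
    ultimately show "ln (F y) \<le> ln (F x) + ((1 / F x) *\<^sub>R p) \<bullet> (y - x)
     + qform ((1 / F x) *\<^sub>R X + (- 1 / (F x)\<^sup>2) *\<^sub>R outer p) (y - x) / 2 + \<epsilon> * (norm (y - x))\<^sup>2"
      unfolding n_def[symmetric] unfolding v_def[symmetric] a_def[symmetric] by (simp add: diff_divide_distrib)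
  qed
qed

lemma superjet_linear: "superjet (\<lambda>y. p \<bullet> y) x p 0"
  unfolding superjet_def by (auto intro!: exI[of _ 1] simp: inner_diff_right qform_zero)

text \<open>Tested at \<open>x - (t / norm p) *\<^sub>R p\<close>, where the superjet decreases at
  the rate \<open>norm p\<close> to first order.\<close>

lemma superjet_gradient_bound:
  assumes sj: "superjet f x p X" and d: "d > 0" and lip: "\<And>y. norm (y - x) < d \<Longrightarrow> f x - P * norm (y - x) \<le> f y"
    and P: "0 \<le> P"
  shows "norm p \<le> P"
proof (cases "p = 0")
  case True
  then show ?thesis using P by simp
next
  case False
  show ?thesis
  proof (rule field_le_epsilon)
    fix e :: real assume e: "e > 0"
    obtain C where C: "C \<ge> 0" "\<And>v. \<bar>qform X v\<bar> \<le> C * (norm v)\<^sup>2" using qform_bound by blast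
    obtain d1 where d1: "d1 > 0" "\<And>y. norm (y - x) < d1 \<Longrightarrow> f y \<le> f x + p \<bullet> (y - x) + qform X (y - x) / 2 + 1 * (norm (y - x))\<^sup>2"
      using sj zero_less_one unfolding superjet_def by meson
    define t where "t = min (min d d1) (e / (C + 1)) / 2"
    have t: "t > 0" "t < d" "t < d1" using d d1 e C by (auto simp: t_def)
    have te: "(C + 1) * t \<le> e"
    proof -
      have "min (min d d1) (e / (C + 1)) = 2 * t" by (simp add: t_def)
      then have "t \<le> e / (C + 1)" using t(1) min.cobounded2[of "min d d1" "e / (C + 1)"] by linarith
      then show ?thesis using C by (simp add: field_simps)
    qed
    define v where "v = - (t / norm p) *\<^sub>R p"
    have nv: "norm v = t" using False t by (simp add: v_def)
    have pv: "p \<bullet> v = - t * norm p"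
      using False by (simp add: v_def power2_norm_eq_inner[symmetric] power2_eq_square)
    have "f (x + v) \<le> f x - t * norm p + qform X v / 2 + t\<^sup>2"
      using d1(2)[of "x + v"] nv pv t by simp
    moreover have "f x - P * t \<le> f (x + v)" using lip[of "x + v"] nv t by simp
    moreover have "qform X v \<le> C * t\<^sup>2" using C(2)[of v] nv by simp
    moreover have "0 \<le> C * t\<^sup>2" using C by simp
    ultimately have "t * norm p \<le> P * t + (C * t\<^sup>2 + t\<^sup>2)" by linarith
    also have "\<dots> = t * (P + (C + 1) * t)" by (simp add: power2_eq_square algebra_simps)
    finally have "norm p \<le> P + (C + 1) * t" using t by simp
    then show "norm p \<le> P + e" using te by linarith
  qed
qed

lemma cv_mono_on:
  assumes \<kappa>: "kernel s \<kappa>" and f: "continuous_on UNIV f" "continuous_on UNIV g"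
    and nn: "\<And>y. 0 \<le> \<kappa> y" and le: "\<And>y. \<kappa> y \<noteq> 0 \<Longrightarrow> f (x - y) \<le> g (x' - y)"
  shows "cv s \<kappa> f x \<le> cv s \<kappa> g x'"
  unfolding cv_def
proof (intro integral_le cv_integrable[OF \<kappa>] f)
  fix y
  show "\<kappa> y * f (x - y) \<le> \<kappa> y * g (x' - y)"
    using le[of y] nn[of y] by (cases "\<kappa> y = 0") (auto intro: mult_left_mono)
qed

lemma grad_norm_le:
  assumes S: "open S" and f: "smooth_on S f" and x: "x \<in> S" and d: "d > 0"
    and le: "\<And>y. norm (y - x) < d \<Longrightarrow> f y \<le> f x + P * norm (y - x)"
    and P: "0 \<le> P"
  shows "norm (grad f x) \<le> P"
proof (rule ccontr)
  let ?g = "grad f x"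
  assume "\<not> norm ?g \<le> P"
  then have gP: "P < norm ?g" by simp
  show False
  proof (cases "?g = 0")
    case True
    then show ?thesis using gP P by simp
  next
    case False
    let ?c = "P * norm ?g" 
    have D: "((\<lambda>t. f (x + t *\<^sub>R ?g)) has_real_derivative ?g \<bullet> ?g) (at 0)"
      using dird_has_real_derivative[OF S f, of x 0 ?g] x by (simp add: dird_grad)
    have "((\<lambda>t. f (x + t *\<^sub>R ?g) - ?c * t) has_real_derivative ?g \<bullet> ?g - ?c) (at 0)"
      by (intro DERIV_diff D) (auto intro!: derivative_eq_intros)
    moreover have "?g \<bullet> ?g - ?c > 0" using gP False by (simp add: power2_norm_eq_inner[symmetric] power2_eq_square)
    ultimately obtain e where e: "e > 0" "\<And>h. 0 < h \<Longrightarrow> h < e \<Longrightarrow> f (x + 0 *\<^sub>R ?g) - ?c * 0 < f (x + (0 + h) *\<^sub>R ?g) - ?c * (0 + h)"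
      using DERIV_pos_inc_right[of "\<lambda>t. f (x + t *\<^sub>R ?g) - ?c * t" "?g \<bullet> ?g - ?c" 0] by auto
    define h where "h = min e (d / norm ?g) / 2"
    have h: "0 < h" "h < e" "h * norm ?g < d" using e d False by (auto simp: h_def min_def field_simps)
    have "f (x + h *\<^sub>R ?g) \<le> f x + P * (h * norm ?g)"
      using le[of "x + h *\<^sub>R ?g"] h by simp
    then show False using e(2)[OF h(1,2)] by (simp add: mult_ac)
  qed
qed

lemma dird_eq:
  assumes "(f has_derivative f') (at x)" shows "dird b f x = f' b"
proof -
  have lin: "linear f'" using assms by (rule has_derivative_linear)
  have "partial_deriv i f x = f' (axis i 1)" for i
    using frechet_derivative_at[OF assms] by (simp add: partial_deriv_def)
  then have "dird b f x = (\<Sum>i\<in>UNIV. b $ i * f' (axis i 1))" by (simp add: dird_def)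
  also have "\<dots> = f' (\<Sum>i\<in>UNIV. b $ i *\<^sub>R axis i 1)"
    by (simp add: linear_sum[OF lin] linear_scale[OF lin])
  also have "(\<Sum>i\<in>UNIV. b $ i *\<^sub>R axis i 1) = b"
    using basis_expansion[of b] by (simp add: scalar_mult_eq_scaleR)
  finally show ?thesis .
qed

text \<open>The Hopf--Cole type regularisation \<open>\<tau> ln (\<rho> * exp (w / \<tau>))\<close>: its Hessian is the weighted average of the
  Hessians of the translates of \<open>w\<close> plus \<open>1 / \<tau>\<close> times the covariance of their gradients.\<close>

lemma hopf_cole_regularisation:
  fixes w :: "real^'n::finite \<Rightarrow> real"
  assumes k: "1 \<le> k" "k \<le> CARD('n)" and w: "continuous_on UNIV w" and R: "R < R1"
    and P: "0 \<le> P" and lip: "\<And>x y. x \<in> ball z R1 \<Longrightarrow> y \<in> ball z R1 \<Longrightarrow> \<bar>w x - w y\<bar> \<le> P * norm (x - y)"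
    and c: "c > 0" and K: "K \<ge> 0"
    and sub: "\<And>x p X. x \<in> ball z R1 \<Longrightarrow> transpose X = X \<Longrightarrow> superjet w x p X \<Longrightarrow>
      (\<forall>v. - K * (norm v)\<^sup>2 \<le> qform X v) \<and> adm k p (X - c *\<^sub>R mat 1)"
    and e: "e > 0"
  shows "\<exists>v. smooth_on (ball z R) v \<and> (\<forall>x\<in>ball z R. (\<forall>j\<le>k. 0 \<le> H_curv j v x) \<and> \<bar>v x - w x\<bar> \<le> e)"
proof -
  obtain \<tau> where \<tau>: "\<tau> > 0" and D: "\<forall>(p :: real^'n) p' X q a. norm p \<le> P \<and> norm p' \<le> P \<and> transpose X = X \<and>
      (\<forall>v. - K * (norm v)\<^sup>2 \<le> qform X v) \<and> adm k p (X - c *\<^sub>R mat 1) \<and> q \<in> frames \<and> a \<in> dcone k \<longrightarrow>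
      0 \<le> (\<Sum>i\<in>UNIV. a $ i * (qform X (Gi p' (q $ i)) + ((p - p') \<bullet> Gi p' (q $ i))\<^sup>2 / \<tau>))"
    using convexity_defect_inequality[OF k c K, of P] by blast
  note defect = D[rule_format, OF conjI[OF _ conjI[OF _ conjI[OF _ conjI[OF _ conjI[OF _ conjI]]]]]]
  \<comment> \<open>The approximation error is governed by \<open>\<sigma>\<close> alone, while
    \<open>\<tau>\<close> stays fixed. The first bound keeps the support inside the larger ball and
    meets the radius condition of \<open>local_convolution_subsolution\<close> for
    \<open>R1 - R\<close>; the second makes the oscillation of \<open>w\<close> over the support at
    most \<open>e\<close>.\<close>
  define \<sigma> where "\<sigma> = min ((R1 - R) / 4) (e / (P + 1))"
  have \<sigma>: "\<sigma> > 0" using R e P by (auto simp: \<sigma>_def)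
  have \<sigma>R: "\<sigma> \<le> (R1 - R) / 4" unfolding \<sigma>_def by (rule min.cobounded1)
  have P\<sigma>: "P * \<sigma> \<le> e"
  proof -
    have "P * \<sigma> \<le> P * (e / (P + 1))" using P by (intro mult_left_mono) (auto simp: \<sigma>_def)
    also have "\<dots> \<le> e" using P e by (simp add: field_simps)
    finally show ?thesis .
  qed
  obtain \<rho> :: "real^'n \<Rightarrow> real" where \<rho>: "kernel \<sigma> \<rho>" "\<And>y. 0 \<le> \<rho> y" "\<And>y. \<sigma> \<le> norm y \<Longrightarrow> \<rho> y = 0" "integral (cube \<sigma>) \<rho> = 1"
    by (rule exists_bump[OF \<sigma>]) blast
  have \<rho>n: "norm y < \<sigma>" if "\<rho> y \<noteq> 0" for y using \<rho>(3)[of y] that by fastforce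
  define E where "E y = exp (w y / \<tau>)" for y
  have cE: "continuous_on UNIV E" unfolding E_def by (intro continuous_intros w) (use \<tau> in auto)
  let ?G = "cv \<sigma> \<rho> E" and ?B = "ball z R"
  have inB: "x - y \<in> ball z R1" if "x \<in> ?B" "norm y < \<sigma>" for x y
  proof -
    have "norm (x - y - z) \<le> norm (x - z) + norm y" using norm_triangle_ineq4[of "x - z" y] by (simp add: algebra_simps)
    moreover have "norm (x - z) < R" using that by (simp add: dist_norm norm_minus_commute)
    moreover have "\<sigma> \<le> (R1 - R) / 4" by (rule \<sigma>R)
    ultimately show ?thesis using that R by (simp add: dist_norm norm_minus_commute)
  qed
  have sub_B: "?B \<subseteq> ball z R1" using R by auto
  have Gb: "exp ((w x - e) / \<tau>) \<le> ?G x \<and> ?G x \<le> exp ((w x + e) / \<tau>)" if x: "x \<in> ?B" for x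
  proof -
    let ?l = "exp ((w x - e) / \<tau>)" and ?u = "exp ((w x + e) / \<tau>)"
    \<comment> \<open>The bounds \<open>?l\<close> and \<open>?u\<close> are coded by their
      midpoint, because \<open>cv_approx\<close> estimates the distance to a single number.\<close>
    have "\<bar>E (x - y) - (?l + ?u) / 2\<bar> \<le> (?u - ?l) / 2" if "\<rho> y \<noteq> 0" for y
    proof -
      have "\<bar>w (x - y) - w x\<bar> \<le> P * norm y"
        using lip[OF inB[OF x \<rho>n[OF that]] subsetD[OF sub_B x]] by simp
      also have "\<dots> \<le> P * \<sigma>" using P \<rho>n[OF that] by (intro mult_left_mono) auto
      finally have "\<bar>w (x - y) - w x\<bar> \<le> e" using P\<sigma> by linarith
      then have "?l \<le> E (x - y)" "E (x - y) \<le> ?u" using \<tau> by (auto simp: E_def divide_right_mono)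
      then show ?thesis unfolding abs_le_iff by (auto simp: field_simps)
    qed
    then have "\<bar>?G x - (?l + ?u) / 2\<bar> \<le> (?u - ?l) / 2" by (rule cv_approx[OF \<rho>(1) cE \<rho>(2,4)])
    then show ?thesis unfolding abs_le_iff by (auto simp: field_simps)
  qed
  have Gpos: "?G x > 0" if "x \<in> ?B" for x using Gb[OF that] exp_gt_zero less_le_trans by blast
  define v where "v x = \<tau> * ln (?G x)" for x
  have smG: "smooth_on UNIV ?G" by (rule cv_smooth[OF \<rho>(1) cE])
  have smv: "smooth_on ?B v"
    unfolding v_def using Gpos smooth_on_subset[OF smG] by (intro smooth_mult smooth_const smooth_ln) auto
  have close: "\<bar>v x - w x\<bar> \<le> e" if x: "x \<in> ?B" for x
  proof -
    have "ln (exp ((w x - e) / \<tau>)) \<le> ln (?G x)" "ln (?G x) \<le> ln (exp ((w x + e) / \<tau>))"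
      using Gb[OF x] Gpos[OF x] by (auto simp del: ln_exp intro!: ln_mono)
    then have "(w x - e) / \<tau> \<le> ln (?G x)" "ln (?G x) \<le> (w x + e) / \<tau>" by simp_all
    then have "w x - e \<le> v x" "v x \<le> w x + e" using \<tau> by (simp_all add: v_def field_simps)
    then show ?thesis by (simp add: abs_le_iff)
  qed
  have H: "0 \<le> H_curv j v x0" if x0: "x0 \<in> ?B" and j: "j \<le> k" for x0 j
  proof -
    define p' where "p' = grad v x0"
    have p'P: "norm p' \<le> P"
      unfolding p'_def
    proof (rule grad_norm_le[OF open_ball smv x0 _ _ P])
      show "R - norm (x0 - z) > 0" using x0 by (simp add: dist_norm norm_minus_commute)
      fix y assume "norm (y - x0) < R - norm (x0 - z)"
      then have y: "y \<in> ?B" using norm_triangle_ineq[of "y - x0" "x0 - z"] by (simp add: dist_norm norm_minus_commute)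
      have "?G y \<le> cv \<sigma> \<rho> (\<lambda>u. exp (P * norm (y - x0) / \<tau>) * E u) x0"
      proof (rule cv_mono_on[OF \<rho>(1) cE _ \<rho>(2)])
        fix u assume "\<rho> u \<noteq> 0"
        then have u: "norm u < \<sigma>" by (rule \<rho>n)
        have "\<bar>w (y - u) - w (x0 - u)\<bar> \<le> P * norm ((y - u) - (x0 - u))"
          by (rule lip[OF inB[OF y u] inB[OF x0 u]])
        then have "w (y - u) \<le> P * norm (y - x0) + w (x0 - u)" by simp
        then have "w (y - u) / \<tau> \<le> (P * norm (y - x0) + w (x0 - u)) / \<tau>" using \<tau> by (intro divide_right_mono) auto
        then show "E (y - u) \<le> exp (P * norm (y - x0) / \<tau>) * E (x0 - u)"
          by (simp add: E_def exp_add[symmetric] add_divide_distrib)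
      qed (intro continuous_intros cE)
      also have "\<dots> = exp (P * norm (y - x0) / \<tau>) * ?G x0" by (rule cv_cmult)
      finally have "ln (?G y) \<le> ln (exp (P * norm (y - x0) / \<tau>) * ?G x0)" using Gpos[OF y] by (intro ln_mono) auto
      also have "\<dots> = P * norm (y - x0) / \<tau> + ln (?G x0)" using Gpos[OF x0] by (simp add: ln_mult)
      finally show "v y \<le> v x0 + P * norm (y - x0)" using \<tau> by (simp add: v_def field_simps)
    qed
    \<comment> \<open>The tilt by \<open>p'\<close> removes the gradient of \<open>v\<close> at
      \<open>x0\<close>, so that only differences \<open>p - p'\<close> appear in the
      superjets.\<close>
    define F where "F y = exp ((w y - p' \<bullet> y) / \<tau>)" for y
    have cF: "continuous_on UNIV F" unfolding F_def by (intro continuous_intros w) (use \<tau> in auto)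
    have Fpos: "F y > 0" for y by (simp add: F_def)
    have adm: "adm k p' (hess v x0)"
      unfolding adm_def
    proof (intro ballI)
      fix q :: "real^'n^'n" and a :: "real^'n" assume q: "q \<in> frames" and a: "a \<in> dcone k"
      \<comment> \<open>The weights are absorbed into the vectors, because the linear equation was
        treated with unit coefficients.\<close>
      define b where "b i = sqrt (a $ i) *\<^sub>R Gi p' (q $ i)" for i
      have qb: "qform X (b i) = a $ i * qform X (Gi p' (q $ i))" for X i
        using dcone_nonneg[OF a, of i] by (simp add: b_def qform_scaleR)
      have visc: "0 \<le> (\<Sum>i\<in>UNIV. qform X (b i))"
        if x: "norm (x - x0) < R1 - R" and X: "transpose X = X" and sj: "superjet F x p X" for x p X
      proof -
        let ?p = "\<tau> *\<^sub>R ((1 / F x) *\<^sub>R p) + p'" and ?X = "\<tau> *\<^sub>R ((1 / F x) *\<^sub>R X + (- 1 / (F x)\<^sup>2) *\<^sub>R outer p) + 0"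
        have "superjet (\<lambda>y. \<tau> * ln (F y) + p' \<bullet> y) x ?p ?X"
          using \<tau> by (intro superjet_add superjet_cmult superjet_ln superjet_linear sj Fpos) auto
        moreover have "(\<lambda>y. \<tau> * ln (F y) + p' \<bullet> y) = w" using \<tau> by (simp add: F_def fun_eq_iff)
        ultimately have sw: "superjet w x ?p ?X" by simp
        have xB: "x \<in> ball z R1"
        proof -
          have "norm (x - z) \<le> norm (x - x0) + norm (x0 - z)" using norm_triangle_ineq[of "x - x0" "x0 - z"] by simp
          then show ?thesis using x x0 by (simp add: dist_norm norm_minus_commute)
        qed
        have tX: "transpose ?X = ?X" by (simp only: transpose_add transpose_scaleR transpose_outer X transpose_zero)
        have pP: "norm ?p \<le> P"
        proof (rule superjet_gradient_bound[OF sw _ _ P])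
          show "R1 - norm (x - z) > 0" using xB by (simp add: dist_norm norm_minus_commute)
          fix y assume "norm (y - x) < R1 - norm (x - z)"
          then have "y \<in> ball z R1" using norm_triangle_ineq[of "y - x" "x - z"] by (simp add: dist_norm norm_minus_commute)
          then show "w x - P * norm (y - x) \<le> w y" using lip[OF _ xB] by fastforce
        qed
        have "0 \<le> (\<Sum>i\<in>UNIV. a $ i * (qform ?X (Gi p' (q $ i)) + ((?p - p') \<bullet> Gi p' (q $ i))\<^sup>2 / \<tau>))"
          by (rule defect[OF pP p'P tX _ _ q a]) (use sub[OF xB tX sw] in auto)
        \<comment> \<open>The quadratic term of the defect inequality cancels the
          \<open>outer p\<close> term of the logarithm exactly, as \<open>?p - p'\<close> is
          \<open>\<tau> / F x\<close> times \<open>p\<close>. What remains is linear in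
          \<open>X\<close>.\<close>
        also have "\<dots> = (\<Sum>i\<in>UNIV. (\<tau> / F x) * qform X (b i))"
        proof (rule sum.cong[OF refl])
          fix i
          let ?u = "Gi p' (q $ i)"
          have "qform ?X ?u = \<tau> * (qform X ?u / F x - (p \<bullet> ?u)\<^sup>2 / (F x)\<^sup>2)"
            by (simp only: qform_add qform_cmult qform_outer qform_zero) simp
          moreover have "((?p - p') \<bullet> ?u)\<^sup>2 / \<tau> = \<tau> * ((p \<bullet> ?u)\<^sup>2 / (F x)\<^sup>2)"
            using \<tau> by (simp add: power_mult_distrib power_divide) (simp add: power2_eq_square)
          ultimately show "a $ i * (qform ?X ?u + ((?p - p') \<bullet> ?u)\<^sup>2 / \<tau>) = (\<tau> / F x) * qform X (b i)"
            by (simp add: qb right_diff_distrib)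
        qed
        finally have "0 \<le> (\<tau> / F x) * (\<Sum>i\<in>UNIV. qform X (b i))" by (simp only: sum_distrib_left)
        moreover have "\<tau> / F x > 0" using \<tau> Fpos by simp
        ultimately show ?thesis by (simp only: zero_le_mult_iff) linarith
      qed
      \<comment> \<open>The exponential weight undoes the tilt: convolving \<open>F\<close> with
        \<open>\<kappa>\<close> gives \<open>?G\<close> times an explicit exponential factor, as
        \<open>gG\<close> records.\<close>
      define \<kappa> where "\<kappa> y = \<rho> y * exp ((- (1 / \<tau>) *\<^sub>R p') \<bullet> y)" for y
      have \<kappa>: "kernel \<sigma> \<kappa>" "\<And>y. 0 \<le> \<kappa> y" "\<And>y. (R1 - R) / 4 \<le> norm y \<Longrightarrow> \<kappa> y = 0"
      proof -
        have "smooth_on UNIV \<kappa>"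
          unfolding \<kappa>_def by (rule smooth_mult[OF kernel_smooth[OF \<rho>(1)] smooth_exp_linear])
        then show "kernel \<sigma> \<kappa>" using \<rho>(1) by (simp add: kernel_def \<kappa>_def)
        show "0 \<le> \<kappa> y" for y using \<rho>(2) by (simp add: \<kappa>_def)
        show "\<kappa> y = 0" if "(R1 - R) / 4 \<le> norm y" for y using \<rho>(3)[of y] order_trans[OF \<sigma>R that] by (simp add: \<kappa>_def)
      qed
      let ?g = "cv \<sigma> \<kappa> F"
      have smg: "smooth_on UNIV ?g" by (rule cv_smooth[OF \<kappa>(1) cF])
      have pos: "0 \<le> (\<Sum>i\<in>UNIV. qform (hess ?g x0) (b i))"
        by (rule local_convolution_subsolution[OF cF _ visc \<kappa>]) (use R in auto)
      have gG: "?g x = exp (- (p' \<bullet> x) / \<tau>) * ?G x" for x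
      proof -
        have "\<kappa> y * F (x - y) = exp (- (p' \<bullet> x) / \<tau>) * (\<rho> y * E (x - y))" for y
          by (simp add: \<kappa>_def F_def E_def exp_add[symmetric] inner_diff_right diff_divide_distrib add_divide_distrib mult_ac)
        then show ?thesis by (simp add: cv_def)
      qed
      have gpos: "?g x > 0" if "x \<in> ?B" for x using Gpos[OF that] by (simp add: gG)
      have vg: "v x = p' \<bullet> x + \<tau> * ln (?g x)" if "x \<in> ?B" for x
        using Gpos[OF that] \<tau> by (simp add: gG v_def ln_mult right_diff_distrib)
      have Dg: "(?g has_derivative (\<lambda>h. dird h ?g x)) (at x)" for x
        using has_derivative_dird[OF open_UNIV smg] by simp
      have dv: "dird u v x = p' \<bullet> u + \<tau> * (dird u ?g x * inverse (?g x))" if x: "x \<in> ?B" for u x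
      proof -
        have "((\<lambda>x. p' \<bullet> x + \<tau> * ln (?g x)) has_derivative (\<lambda>h. p' \<bullet> h + \<tau> * (dird h ?g x * inverse (?g x)))) (at x)"
          by (intro has_derivative_add has_derivative_inner_right has_derivative_mult_right has_derivative_ident
             DERIV_compose_FDERIV[where f = ln] DERIV_ln gpos x Dg)
        then have "(v has_derivative (\<lambda>h. p' \<bullet> h + \<tau> * (dird h ?g x * inverse (?g x)))) (at x)"
          by (rule has_derivative_transform_within_open[OF _ open_ball x]) (simp add: vg)
        then show ?thesis by (rule dird_eq)
      qed
      \<comment> \<open>By the choice of \<open>p'\<close> the tilted convolution is critical at
        \<open>x0\<close>. Hence \<open>hess v x0\<close> is a positive multiple of
        \<open>hess ?g x0\<close>, without a gradient term.\<close>
      have dg0: "dird u ?g x0 = 0" for u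
      proof -
        have "p' \<bullet> u = p' \<bullet> u + \<tau> * (dird u ?g x0 * inverse (?g x0))"
          using dv[OF x0, of u] by (simp add: dird_grad[of u v] p'_def)
        then show ?thesis using \<tau> gpos[OF x0] by simp
      qed
      have hv: "qform (hess v x0) u = (\<tau> / ?g x0) * qform (hess ?g x0) u" for u
      proof -
        have nz: "?g x0 \<noteq> 0" using gpos[OF x0] by simp
        have "(dird u ?g has_derivative (\<lambda>h. dird h (dird u ?g) x0)) (at x0)"
          using has_derivative_dird[OF open_UNIV smooth_on_dird[OF open_UNIV smg]] by simp
        then have "((\<lambda>x. p' \<bullet> u + \<tau> * (dird u ?g x * inverse (?g x))) has_derivative
            (\<lambda>h. 0 + \<tau> * (dird u ?g x0 * (- (inverse (?g x0) * dird h ?g x0 * inverse (?g x0))) + dird h (dird u ?g) x0 * inverse (?g x0)))) (at x0)"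
          by (intro has_derivative_add has_derivative_const has_derivative_mult_right has_derivative_mult
              Deriv.has_derivative_inverse nz Dg)
        then have "(dird u v has_derivative
            (\<lambda>h. 0 + \<tau> * (dird u ?g x0 * (- (inverse (?g x0) * dird h ?g x0 * inverse (?g x0))) + dird h (dird u ?g) x0 * inverse (?g x0)))) (at x0)"
          by (rule has_derivative_transform_within_open[OF _ open_ball x0]) (simp add: dv)
        then have "dird u (dird u v) x0 = 0 + \<tau> * (dird u ?g x0 * (- (inverse (?g x0) * dird u ?g x0 * inverse (?g x0))) + dird u (dird u ?g) x0 * inverse (?g x0))"
          by (rule dird_eq)
        then show ?thesis
          by (simp add: qform_hess[OF open_ball smv x0] qform_hess[OF open_UNIV smg UNIV_I] dg0 divide_inverse)
      qed
      have "(\<Sum>i\<in>UNIV. a $ i * qform (hess v x0) (Gi p' (q $ i))) = (\<tau> / ?g x0) * (\<Sum>i\<in>UNIV. qform (hess ?g x0) (b i))"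
        unfolding sum_distrib_left hv qb by (simp only: mult.left_commute)
      also have "\<dots> \<ge> 0" using pos \<tau> gpos[OF x0] by simp
      finally show "0 \<le> (\<Sum>i\<in>UNIV. a $ i * qform (hess v x0) (Gi p' (q $ i)))" .
    qed
    show ?thesis
      unfolding H_curv_eq[OF open_ball smv x0] p'_def[symmetric]
      by (rule adm_sigma_nonneg[OF k(2) hess_symmetric[OF open_ball smv x0] adm j])
  qed
  show ?thesis using smv H close by blast
qed

section \<open>Sup-convolution\<close>

lemma conj_form:
  assumes X: "transpose X = X" and T: "linear T" "linear T'" and adj: "\<And>u v. T' u \<bullet> v = u \<bullet> T v"
  obtains Z :: "real^'n^'n::finite" where "transpose Z = Z" "\<And>v. qform Z v = qform X (T v)"
proof -
  let ?Z = "matrix (\<lambda>v. T' (X *v T v))"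
  have "linear (\<lambda>v. T' (X *v T v))"
    by (intro linear_compose[unfolded o_def, OF _ T(2)] linear_compose[unfolded o_def, OF T(1)] matrix_vector_mul_linear)
  then have Z: "?Z *v v = T' (X *v T v)" for v by (simp add: matrix_works)
  have "u \<bullet> (?Z *v v) = (?Z *v u) \<bullet> v" for u v
  proof -
    have "u \<bullet> (?Z *v v) = (X *v T v) \<bullet> T u" by (simp add: Z adj inner_commute[of u])
    also have "\<dots> = T v \<bullet> (X *v T u)" by (rule sym_inner[OF X])
    also have "\<dots> = (?Z *v u) \<bullet> v" by (simp add: Z adj inner_commute[of "T v"])
    finally show ?thesis .
  qed
  then have "?Z *v v = transpose ?Z *v v" for v
    by (metis dot_lmul_matrix transpose_matrix_vector vector_eq_rdot)
  then have "transpose ?Z = ?Z" by (metis matrix_eq)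
  moreover have "qform ?Z v = qform X (T v)" for v
    by (simp add: qform_def Z inner_commute[of v] adj) (simp add: inner_commute)
  ultimately show ?thesis using that by blast
qed

lemma vslope_lipschitz: "\<bar>vslope p - vslope p'\<bar> \<le> norm (p - p')"
proof -
  let ?w = "vslope p" and ?w' = "vslope p'"
  have ge: "norm p \<le> ?w" "norm p' \<le> ?w'" by (auto simp: vslope_def real_le_rsqrt)
  have "(?w - ?w') * (?w + ?w') = (norm p - norm p') * (norm p + norm p')"
    using vslope_sq[of p] vslope_sq[of p'] by (simp add: power2_norm_eq_inner[symmetric] power2_eq_square algebra_simps)
  then have "\<bar>?w - ?w'\<bar> * (?w + ?w') = \<bar>norm p - norm p'\<bar> * (norm p + norm p')"
    by (metis abs_mult abs_of_nonneg abs_of_pos add_nonneg_nonneg add_pos_pos norm_ge_zero vslope_pos(1))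
  also have "\<dots> \<le> norm (p - p') * (?w + ?w')"
    using ge norm_triangle_ineq3[of p p'] by (intro mult_mono) auto
  finally show ?thesis using vslope_pos(1)[of p] vslope_pos(1)[of p'] by (meson add_pos_pos mult_le_cancel_right_pos)
qed

text \<open>Measures how far the transport map between the metrics of two nearby gradients is from
  the identity. The constant is crude but depends on \<open>P\<close> only.\<close>

lemma Gp_lipschitz:
  assumes p: "norm p \<le> P" "norm p' \<le> P"
  shows "norm (Gp p h - Gp p' h) \<le> (P\<^sup>2 + P) * norm (p - p') * norm h"
proof -
  let ?w = "1 + vslope p" and ?w' = "1 + vslope p'"
  have P: "P \<ge> 0" using p(1) norm_ge_zero order_trans by blast
  have s: "\<bar>1 / ?w - 1 / ?w'\<bar> \<le> norm (p - p')"
  proof -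
    have "1 / ?w - 1 / ?w' = (vslope p' - vslope p) / (?w * ?w')" by (simp add: diff_divide_eq_iff divide_diff_eq_iff)
    also have "\<bar>\<dots>\<bar> = \<bar>vslope p' - vslope p\<bar> / (?w * ?w')"
      using vslope_ge_1[of p] vslope_ge_1[of p'] by (simp add: abs_divide abs_mult)
    also have "\<dots> \<le> \<bar>vslope p' - vslope p\<bar> / 1"
      using vslope_ge_1[of p] vslope_ge_1[of p'] mult_mono[of 1 ?w 1 ?w'] by (intro divide_left_mono) auto
    finally show ?thesis using vslope_lipschitz[of p p'] by (simp add: abs_minus_commute)
  qed
  have s': "\<bar>1 / ?w'\<bar> \<le> 1 / 2" using vslope_ge_1[of p'] by simp
  have "Gp p h - Gp p' h = ((1 / ?w - 1 / ?w') * (p \<bullet> h)) *\<^sub>R p + (1 / ?w') *\<^sub>R (((p - p') \<bullet> h) *\<^sub>R p + (p' \<bullet> h) *\<^sub>R (p - p'))"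
    by (simp add: Gp_def algebra_simps inner_diff_left divide_inverse)
  also have "norm \<dots> \<le> norm (((1 / ?w - 1 / ?w') * (p \<bullet> h)) *\<^sub>R p) + norm ((1 / ?w') *\<^sub>R (((p - p') \<bullet> h) *\<^sub>R p + (p' \<bullet> h) *\<^sub>R (p - p')))"
    by (rule norm_triangle_ineq)
  also have "\<dots> \<le> norm (p - p') * (P * norm h) * P + 1 / 2 * (norm (p - p') * norm h * P + P * norm h * norm (p - p'))"
  proof (intro add_mono)
    have ph: "\<bar>p \<bullet> h\<bar> \<le> P * norm h" "\<bar>p' \<bullet> h\<bar> \<le> P * norm h"
      using order_trans[OF Cauchy_Schwarz_ineq2 mult_right_mono[OF p(1)]] order_trans[OF Cauchy_Schwarz_ineq2 mult_right_mono[OF p(2)]] by auto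
    show "norm (((1 / ?w - 1 / ?w') * (p \<bullet> h)) *\<^sub>R p) \<le> norm (p - p') * (P * norm h) * P"
      unfolding norm_scaleR abs_mult using s ph p P by (intro mult_mono) auto
    have "norm (((p - p') \<bullet> h) *\<^sub>R p + (p' \<bullet> h) *\<^sub>R (p - p')) \<le> norm (((p - p') \<bullet> h) *\<^sub>R p) + norm ((p' \<bullet> h) *\<^sub>R (p - p'))"
      by (rule norm_triangle_ineq)
    also have "\<dots> \<le> norm (p - p') * norm h * P + P * norm h * norm (p - p')"
      unfolding norm_scaleR using Cauchy_Schwarz_ineq2[of "p - p'" h] ph p P by (intro add_mono mult_mono) auto
    finally show "norm ((1 / ?w') *\<^sub>R (((p - p') \<bullet> h) *\<^sub>R p + (p' \<bullet> h) *\<^sub>R (p - p')))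
       \<le> 1 / 2 * (norm (p - p') * norm h * P + P * norm h * norm (p - p'))"
      unfolding norm_scaleR using s' by (intro mult_mono) auto
  qed
  also have "\<dots> = (P\<^sup>2 + P) * norm (p - p') * norm h" by (simp add: power2_eq_square algebra_simps)
  finally show ?thesis .
qed

section \<open>The comparison principle read on superjets\<close>

definition quadr :: "real \<Rightarrow> real^'n::finite \<Rightarrow> real^'n^'n \<Rightarrow> real^'n \<Rightarrow> real^'n \<Rightarrow> real" where
  "quadr a p X x0 y = a + p \<bullet> (y - x0) + qform X (y - x0) / 2"

lemma smooth_quadr: "smooth_on UNIV (quadr a p X x0)"
proof -
  have "quadr a p X x0 = (\<lambda>y. (a + (\<Sum>i\<in>UNIV. p $ i * (y $ i + - x0 $ i))) + (1 / 2) * (\<Sum>i\<in>UNIV. (y $ i + - x0 $ i) * (\<Sum>j\<in>UNIV. X $ i $ j * (y $ j + - x0 $ j))))"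
    by (simp add: quadr_def fun_eq_iff qform_def inner_vec_def matrix_vector_mult_def)
  then show ?thesis
    by (simp only:) (intro smooth_add smooth_mult smooth_sum smooth_const smooth_coord)
qed

lemma quadr_grad_hess:
  assumes X: "transpose X = X"
  shows "grad (quadr a p X x0) y = p + X *v (y - x0)" "hess (quadr a p X x0) y = X"
proof -
  have g: "grad (quadr a p X x0) y = p + X *v (y - x0)" for y
  proof -
    have "(quadr a p X x0 has_derivative (\<lambda>h. 0 + p \<bullet> (h - 0) + ((y - x0) \<bullet> (X *v (h - 0)) + (h - 0) \<bullet> (X *v (y - x0))) / 2)) (at y)"
      unfolding quadr_def[abs_def] qform_def
      by (intro has_derivative_add has_derivative_const has_derivative_inner_right has_derivative_diff has_derivative_ident
          bounded_linear.has_derivative[OF bounded_linear_divide] has_derivative_inner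
          bounded_linear.has_derivative[OF matrix_vector_mul_bounded_linear])
    then have "(quadr a p X x0 has_derivative (\<lambda>h. (p + X *v (y - x0)) \<bullet> h)) (at y)"
      proof (rule has_derivative_eq_rhs, intro ext)
      fix h
      show "0 + p \<bullet> (h - 0) + ((y - x0) \<bullet> (X *v (h - 0)) + (h - 0) \<bullet> (X *v (y - x0))) / 2 = (p + X *v (y - x0)) \<bullet> h"
        using sym_inner[OF X, of h "y - x0"] inner_commute[of h "X *v (y - x0)"] inner_commute[of "X *v h" "y - x0"]
        by (simp add: inner_add_left)
    qed
    then have "grad (quadr a p X x0) y \<bullet> h = (p + X *v (y - x0)) \<bullet> h" for h
      using dird_eq[of "quadr a p X x0" _ y h] by (simp add: dird_grad)
    then show ?thesis by (metis vector_eq_rdot)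
  qed
  then show "grad (quadr a p X x0) y = p + X *v (y - x0)" .
  have "(grad (quadr a p X x0) has_derivative (\<lambda>h. hess (quadr a p X x0) y *v h)) (at y)"
    by (rule grad_has_derivative[OF open_UNIV smooth_quadr]) simp
  moreover have "((\<lambda>y. p + X *v (y - x0)) has_derivative (\<lambda>h. 0 + X *v (h - 0))) (at y)"
    by (intro has_derivative_add has_derivative_const has_derivative_diff has_derivative_ident
          bounded_linear.has_derivative[OF matrix_vector_mul_bounded_linear])
  then have "(grad (quadr a p X x0) has_derivative (\<lambda>h. X *v h)) (at y)" by (simp add: g[abs_def])
  ultimately have "(\<lambda>h. hess (quadr a p X x0) y *v h) = (\<lambda>h. X *v h)" by (rule has_derivative_unique)
  then show "hess (quadr a p X x0) y = X" by (metis matrix_eq)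
qed

lemma continuous_sigma_shape:
  assumes g: "continuous_on UNIV g"
  shows "continuous_on UNIV (\<lambda>x. sigma k (shape (g x) X))"
proof -
  have v: "continuous_on UNIV (\<lambda>x. vslope (g x))" unfolding vslope_def by (intro continuous_intros g)
  have nz: "\<forall>x\<in>UNIV. vslope (g x) \<noteq> 0" by simp
  have e: "shape p X $ i $ j = (1 / vslope p) * ((X *v axis j 1) $ i - (p \<bullet> (X *v axis j 1)) / (vslope p)\<^sup>2 * p $ i)" for p i j
  proof -
    have "shape p X $ i $ j = (shape p X *v axis j 1) $ i"
      by (simp add: matrix_vector_mult_def axis_def if_distrib[of "\<lambda>x. _ * x"] cong: if_cong)
    then show ?thesis by (simp add: shape_mult Gi_Gi)
  qed
  have "continuous_on UNIV (\<lambda>x. shape (g x) X $ i $ j)" for i j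
    unfolding e by (intro continuous_on_mult continuous_on_divide continuous_on_diff continuous_on_const continuous_on_power
        continuous_on_inner continuous_on_component g v) (use nz in auto)
  then show ?thesis unfolding sigma_def principal_minor_def
    by (intro continuous_on_sum continuous_on_mult continuous_on_const continuous_on_prod) auto
qed

text \<open>If the jet is inadmissible, the paraboloid with the Hessian \<open>X'\<close> of
  \<open>not_adm_witness\<close> has negative \<open>H_curv k\<close> near \<open>x0\<close> and
  lies above \<open>u\<close> on a small sphere, even after its vertex has been moved below
  \<open>u x0\<close>.\<close>

lemma SH_superjet:
  assumes u: "u \<in> SH k \<Omega>" and \<Omega>: "open \<Omega>" "x0 \<in> \<Omega>" and ux: "u x0 = ereal a" and X: "transpose X = X"
    and sj: "\<And>\<epsilon>. \<epsilon> > 0 \<Longrightarrow> \<exists>\<delta>>0. \<forall>y. norm (y - x0) < \<delta> \<longrightarrow> u y \<le> ereal (a + p \<bullet> (y - x0) + qform X (y - x0) / 2 + \<epsilon> * (norm (y - x0))\<^sup>2)"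
  shows "adm k p X"
proof (rule ccontr)
  assume "\<not> adm k p X"
  then obtain X' m where X': "transpose X' = X'" "m > 0" "\<And>v. qform X v + m * (norm v)\<^sup>2 \<le> qform X' v"
    "sigma k (shape p X') < 0"
    using not_adm_witness[OF X] by blast
  have "m / 4 > 0" using X'(2) by simp
  then obtain d where d: "d > 0" "\<And>y. norm (y - x0) < d \<Longrightarrow> u y \<le> ereal (a + p \<bullet> (y - x0) + qform X (y - x0) / 2 + m / 4 * (norm (y - x0))\<^sup>2)"
    using sj by meson
  have H: "H_curv k (quadr c p X' x0) y = sigma k (shape (p + X' *v (y - x0)) X')" for c y
    unfolding H_curv_eq[OF open_UNIV smooth_quadr UNIV_I] quadr_grad_hess[OF X'(1)] ..
  have "continuous_on UNIV (\<lambda>y. sigma k (shape (p + X' *v (y - x0)) X'))"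
    by (intro continuous_sigma_shape continuous_intros)
  then have "open {y. sigma k (shape (p + X' *v (y - x0)) X') < 0}"
    by (intro open_Collect_less continuous_on_const)
  moreover have "x0 \<in> {y. sigma k (shape (p + X' *v (y - x0)) X') < 0}" using X'(4) by simp
  ultimately obtain r1 where r1: "r1 > 0" "ball x0 r1 \<subseteq> {y. sigma k (shape (p + X' *v (y - x0)) X') < 0}"
    using open_contains_ball by meson
  obtain r2 where r2: "r2 > 0" "cball x0 r2 \<subseteq> \<Omega>" using \<Omega> open_contains_cball by blast
  define r where "r = min (min d r1) r2 / 2"
  have r: "r > 0" "r < d" "r < r1" "r < r2" using d r1 r2 by (auto simp: r_def)
  \<comment> \<open>On the sphere the Hessian margin gains \<open>m * r\<^sup>2 / 2\<close> and the
    superjet error costs \<open>m * r\<^sup>2 / 4\<close>; the rest pays for lowering the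
    vertex.\<close>
  define c where "c = a - m * r\<^sup>2 / 4"
  let ?h = "quadr c p X' x0" and ?w = "ball x0 r"
  have it: "continuous_on A (iter_partial is ?h)" for A "is"
    using smooth_on_continuous[OF smooth_on_iter_partial[OF open_UNIV smooth_quadr]] continuous_on_subset by blast
  have "Cm_on_closure 2 ?h ?w"
    unfolding Cm_on_closure_def
  proof (intro conjI allI impI)
    show "Cm_on 2 ?h ?w" by (rule smooth_on_Cm_on[OF open_ball smooth_on_subset[OF smooth_quadr subset_UNIV]])
    show "continuous_on (closure ?w) ?h" using it[of _ "[]"] by (simp add: iter_partial_def)
    show "\<exists>g. continuous_on (closure ?w) g \<and> (\<forall>x\<in>?w. g x = iter_partial is ?h x)" for "is"
      using it by blast
  qed
  moreover have "\<forall>x\<in>?w. H_curv k ?h x \<le> 0"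
  proof
    fix x assume "x \<in> ?w"
    then have "x \<in> ball x0 r1" using r by auto
    then show "H_curv k ?h x \<le> 0" using r1(2) unfolding H by (auto simp: less_imp_le)
  qed
  moreover have "\<forall>x\<in>frontier ?w. u x \<le> ereal (?h x)"
  proof
    fix y assume "y \<in> frontier ?w"
    then have y: "norm (y - x0) = r" using r by (simp add: dist_norm norm_minus_commute)
    then have "u y \<le> ereal (a + p \<bullet> (y - x0) + qform X (y - x0) / 2 + m / 4 * r\<^sup>2)" using d(2)[of y] r by simp
    also have "a + p \<bullet> (y - x0) + qform X (y - x0) / 2 + m / 4 * r\<^sup>2 \<le> ?h y"
      using X'(3)[of "y - x0"] y by (simp add: quadr_def c_def)
    finally show "u y \<le> ereal (?h y)" by simp
  qed
  moreover have "closure ?w \<subseteq> \<Omega>" using r2 r by auto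
  moreover have "compact (closure ?w)" using r by simp
  ultimately have "\<forall>x\<in>?w. u x \<le> ereal (?h x)" using u open_ball unfolding SH_def mem_Collect_eq by blast
  then have "u x0 \<le> ereal (?h x0)" using r by simp
  moreover have "m * r\<^sup>2 > 0" using X'(2) r by simp
  ultimately show False using ux by (simp add: quadr_def c_def qform_def)
qed

text \<open>Stands in for the maximum of an upper semicontinuous function on a compact set.
  \<open>Q\<close> lets one argument give both an upper bound and, with \<open>c < M\<close> for
  \<open>Q\<close>, the contradiction behind attainment. It is preserved since the largest of
  finitely many constants is one of them.\<close>

lemma usc_finite_cover:
  fixes u :: "real^'n::finite \<Rightarrow> ereal"
  assumes usc: "usc_on \<Omega> u" and D: "compact D" "D \<subseteq> \<Omega>" "D \<noteq> {}" and \<phi>: "continuous_on UNIV \<phi>"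
    and c: "\<And>y. y \<in> D \<Longrightarrow> \<exists>c. Q c \<and> u y < ereal (c + \<phi> y)"
  shows "\<exists>c. Q c \<and> (\<forall>y\<in>D. u y \<le> ereal (c + \<phi> y))"
proof -
  have "\<forall>y\<in>D. \<exists>c U. Q c \<and> open U \<and> y \<in> U \<and> (\<forall>x\<in>U \<inter> \<Omega>. u x \<le> ereal (c + \<phi> x))"
  proof
    fix y assume y: "y \<in> D"
    then obtain c where c: "Q c" "u y < ereal (c + \<phi> y)" using assms(6) by blast
    then obtain s where s: "u y < ereal s" "ereal s < ereal (c + \<phi> y)" using ereal_dense2 by blast
    obtain U where U: "open U" "{x\<in>\<Omega>. u x < ereal s} = \<Omega> \<inter> U"
      using usc unfolding usc_on_def openin_open by meson
    have V: "open {x. s < c + \<phi> x}" by (intro open_Collect_less continuous_intros \<phi>)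
    have "y \<in> U \<inter> {x. s < c + \<phi> x}" using U(2) s y D(2) by auto
    moreover have "u x \<le> ereal (c + \<phi> x)" if "x \<in> (U \<inter> {x. s < c + \<phi> x}) \<inter> \<Omega>" for x
    proof -
      have "u x < ereal s" using that U(2) by blast
      also have "\<dots> \<le> ereal (c + \<phi> x)" using that by simp
      finally show ?thesis by simp
    qed
    ultimately show "\<exists>c U. Q c \<and> open U \<and> y \<in> U \<and> (\<forall>x\<in>U \<inter> \<Omega>. u x \<le> ereal (c + \<phi> x))"
      using c(1) U(1) V by (intro exI[of _ c] exI[of _ "U \<inter> {x. s < c + \<phi> x}"]) auto
  qed
  then obtain C U where CU: "\<And>y. y \<in> D \<Longrightarrow> Q (C y) \<and> open (U y) \<and> y \<in> U y \<and> (\<forall>x\<in>U y \<inter> \<Omega>. u x \<le> ereal (C y + \<phi> x))"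
    by metis
  obtain F where F: "F \<subseteq> D" "finite F" "D \<subseteq> (\<Union>y\<in>F. U y)"
    by (rule compactE_image[OF D(1), of D U]) (use CU in auto)
  have ne: "F \<noteq> {}" using F D by auto
  let ?c = "Max (C ` F)"
  have "?c \<in> C ` F" using F ne by (intro Max_in) auto
  then have "Q ?c" using CU F by auto
  moreover have "u x \<le> ereal (?c + \<phi> x)" if x: "x \<in> D" for x
  proof -
    obtain y where y: "y \<in> F" "x \<in> U y" using F x by blast
    then have "u x \<le> ereal (C y + \<phi> x)" using CU F D x by blast
    also have "\<dots> \<le> ereal (?c + \<phi> x)" using y F by simp
    finally show ?thesis .
  qed
  ultimately show ?thesis by blast
qed

text \<open>The maximum of \<open>u y - (norm (x - y))\<^sup>2 / \<epsilon>\<close> over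
  \<open>D\<close>, expressed by an upper bound and its attainment. In this form \<open>w\<close> is
  real-valued although \<open>u\<close> may be \<open>-\<infinity>\<close>, and no subtraction in
  \<open>ereal\<close> occurs.\<close>

definition supconv :: "(real^'n::finite \<Rightarrow> ereal) \<Rightarrow> (real^'n) set \<Rightarrow> real \<Rightarrow> (real^'n \<Rightarrow> real) \<Rightarrow> bool" where
  "supconv u D \<epsilon> w \<longleftrightarrow> (\<forall>x. (\<forall>y\<in>D. u y \<le> ereal (w x + (norm (x - y))\<^sup>2 / \<epsilon>)) \<and>
     (\<exists>y\<in>D. u y = ereal (w x + (norm (x - y))\<^sup>2 / \<epsilon>)))"

text \<open>The value is the infimum of all constants that work. If it were attained nowhere, the
  inequality would be strict on the compact set \<open>D\<close>, and a smaller constant would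
  do.\<close>

lemma supconv_exists:
  fixes u :: "real^'n::finite \<Rightarrow> ereal"
  assumes usc: "usc_on \<Omega> u" and D: "compact D" "D \<subseteq> \<Omega>" and fin: "\<And>x. x \<in> \<Omega> \<Longrightarrow> u x \<noteq> \<infinity>"
    and y1: "y1 \<in> D" "u y1 \<noteq> -\<infinity>"
  shows "\<exists>w. supconv u D \<epsilon> w"
proof -
  have "\<exists>M. (\<forall>y\<in>D. u y \<le> ereal (M + (norm (x - y))\<^sup>2 / \<epsilon>)) \<and> (\<exists>y\<in>D. u y = ereal (M + (norm (x - y))\<^sup>2 / \<epsilon>))" for x
  proof -
    let ?\<phi> = "\<lambda>y. (norm (x - y))\<^sup>2 / \<epsilon>"
    have c\<phi>: "continuous_on UNIV ?\<phi>" unfolding divide_inverse by (intro continuous_intros)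
    let ?A = "{c. \<forall>y\<in>D. u y \<le> ereal (c + ?\<phi> y)}"
    have ne: "D \<noteq> {}" using y1 by auto
    have "\<exists>c. True \<and> (\<forall>y\<in>D. u y \<le> ereal (c + ?\<phi> y))"
    proof (rule usc_finite_cover[OF usc D ne c\<phi>])
      fix y assume "y \<in> D"
      then have "u y < \<infinity>" using fin D by auto
      then obtain s where "u y < ereal s" using ereal_dense2 by blast
      then show "\<exists>c. True \<and> u y < ereal (c + ?\<phi> y)" by (intro exI[of _ "s - ?\<phi> y"]) simp
    qed
    then have A: "?A \<noteq> {}" by blast
    obtain b where b: "u y1 = ereal b" using y1 fin D by (cases "u y1") auto
    have bd: "b - ?\<phi> y1 \<le> c" if "c \<in> ?A" for c
    proof -
      have "u y1 \<le> ereal (c + ?\<phi> y1)" using that y1 by blast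
      then show ?thesis using b by simp
    qed
    then have bdd: "bdd_below ?A" by (rule bdd_belowI)
    let ?M = "Inf ?A"
    have M: "u y \<le> ereal (?M + ?\<phi> y)" if y: "y \<in> D" for y
    proof (cases "u y")
      case (real s)
      have "s - ?\<phi> y \<le> ?M"
        by (rule cInf_greatest[OF A]) (use y real in fastforce)
      then show ?thesis using real by simp
    qed (use y fin D in auto)
    moreover have "\<exists>y\<in>D. u y = ereal (?M + ?\<phi> y)"
    proof (rule ccontr)
      assume "\<not> ?thesis"
      then have lt: "u y < ereal (?M + ?\<phi> y)" if "y \<in> D" for y using M[OF that] that by (auto simp: less_le)
      have "\<exists>c. c < ?M \<and> (\<forall>y\<in>D. u y \<le> ereal (c + ?\<phi> y))"
      proof (rule usc_finite_cover[OF usc D ne c\<phi>])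
        fix y assume "y \<in> D"
        then obtain s where s: "u y < ereal s" "ereal s < ereal (?M + ?\<phi> y)" using ereal_dense2[OF lt] by blast
        then show "\<exists>c. c < ?M \<and> u y < ereal (c + ?\<phi> y)" by (intro exI[of _ "s - ?\<phi> y"]) simp
      qed
      then obtain c where "c < ?M" "c \<in> ?A" by blast
      then show False using cInf_lower[OF _ bdd, of c] by simp
    qed
    ultimately show ?thesis by blast
  qed
  then show ?thesis unfolding supconv_def by metis
qed

lemma supconv_lipschitz:
  assumes w: "supconv u (cball z R') \<epsilon> w" and \<epsilon>: "\<epsilon> > 0"
  shows "\<bar>w x - w x'\<bar> \<le> norm (x - x') * (norm (x - z) + norm (x' - z) + 2 * R') / \<epsilon>"
proof -
  have *: "w x - w x' \<le> norm (x - x') * (norm (x - z) + norm (x' - z) + 2 * R') / \<epsilon>" for x x'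
  proof -
    obtain y where y: "y \<in> cball z R'" "u y = ereal (w x + (norm (x - y))\<^sup>2 / \<epsilon>)" using w unfolding supconv_def by blast
    have "u y \<le> ereal (w x' + (norm (x' - y))\<^sup>2 / \<epsilon>)" using w y(1) unfolding supconv_def by blast
    then have "w x - w x' \<le> ((norm (x' - y))\<^sup>2 - (norm (x - y))\<^sup>2) / \<epsilon>" using y(2) by (simp add: diff_divide_distrib)
    also have "\<dots> \<le> norm (x - x') * (norm (x - z) + norm (x' - z) + 2 * R') / \<epsilon>"
    proof (rule divide_right_mono)
      have "(norm (x' - y))\<^sup>2 - (norm (x - y))\<^sup>2 = (norm (x' - y) - norm (x - y)) * (norm (x' - y) + norm (x - y))"
        by (simp add: power2_eq_square algebra_simps)
      also have "\<dots> \<le> norm (x - x') * (norm (x' - y) + norm (x - y))"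
        using norm_triangle_ineq3[of "x' - y" "x - y"] by (intro mult_right_mono) (auto simp: norm_minus_commute)
      also have "\<dots> \<le> norm (x - x') * (norm (x - z) + norm (x' - z) + 2 * R')"
        using y(1) norm_triangle_ineq[of "x' - z" "z - y"] norm_triangle_ineq[of "x - z" "z - y"]
        by (intro mult_left_mono) (auto simp: dist_norm)
      finally show "(norm (x' - y))\<^sup>2 - (norm (x - y))\<^sup>2 \<le> norm (x - x') * (norm (x - z) + norm (x' - z) + 2 * R')" .
    qed (use \<epsilon> in simp)
    finally show ?thesis .
  qed
  show ?thesis using *[of x x'] *[of x' x] by (simp add: abs_le_iff norm_minus_commute add.commute add.left_commute)
qed

lemma supconv_continuous:
  assumes w: "supconv u (cball z R') \<epsilon> w" and \<epsilon>: "\<epsilon> > 0"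
  shows "continuous_on UNIV w"
proof (rule continuous_at_imp_continuous_on, rule ballI)
  fix x
  let ?b = "\<lambda>y. norm (y - x) * (norm (y - z) + norm (x - z) + 2 * R') / \<epsilon>"
  have "((\<lambda>y. w y - w x) \<longlongrightarrow> 0) (at x)"
  proof (rule Lim_null_comparison)
    show "\<forall>\<^sub>F y in at x. norm (w y - w x) \<le> ?b y"
      using supconv_lipschitz[OF w \<epsilon>] by (intro always_eventually) auto
    have "(?b \<longlongrightarrow> norm (x - x) * (norm (x - z) + norm (x - z) + 2 * R') / \<epsilon>) (at x)"
      by (intro tendsto_intros) (use \<epsilon> in auto)
    then show "(?b \<longlongrightarrow> 0) (at x)" by simp
  qed
  then show "isCont w x" unfolding isCont_def by (rule LIM_zero_cancel)
qed

lemma qform_mat: "qform (c *\<^sub>R mat 1) v = c * (norm v)\<^sup>2"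
  by (simp add: qform_cmult) (simp add: qform_def power2_norm_eq_inner)

text \<open>Near the maximiser, \<open>u\<close> is tested along \<open>x + T d\<close> instead of
  the usual translate \<open>x + d\<close>, so that admissibility at gradient \<open>py\<close>
  becomes admissibility at \<open>p\<close>. The added quadratic raises the Hessian by
  \<open>2 * \<eta>\<close>: half of it pays for the difference between \<open>T\<close> and the
  identity, half remains as strictness.\<close>

lemma supconv_superjet:
  fixes u :: "real^'n::finite \<Rightarrow> ereal"
  assumes u: "u \<in> SH k \<Omega>" and \<Omega>: "open \<Omega>" "cball z R' \<subseteq> \<Omega>" and \<epsilon>: "\<epsilon> > 0" and \<eta>: "\<eta> > 0"
    and w: "supconv u (cball z R') \<epsilon> w"
    and y0: "norm (y0 - z) < R'" "u y0 = ereal (w x + (norm (x - y0))\<^sup>2 / \<epsilon>)"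
    and x: "norm (x - z) \<le> R'"
    and sj: "superjet (\<lambda>x. w x + \<eta> * (norm (x - z))\<^sup>2) x p X" and X: "transpose X = X"
    and P: "norm p \<le> P" "4 * R' / \<epsilon> \<le> P"
    and small: "2 * \<eta> * ((P\<^sup>2 + P) * (1 + P) * (2 * R'))\<^sup>2 \<le> \<epsilon>"
  shows "(\<forall>v. - (2 / \<epsilon>) * (norm v)\<^sup>2 \<le> qform X v) \<and> adm k p (X - \<eta> *\<^sub>R mat 1)"
proof
  have upper: "u y \<le> ereal (w x' + (norm (x' - y))\<^sup>2 / \<epsilon>)" if "norm (y - z) \<le> R'" for x' y
    using w that unfolding supconv_def by (simp add: dist_norm norm_minus_commute)
  have P0: "P \<ge> 0" using P(1) norm_ge_zero order_trans by blast
  let ?b = "w x + (norm (x - y0))\<^sup>2 / \<epsilon>"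
  define py where "py = p - (2 * \<eta>) *\<^sub>R (x - z)"
  \<comment> \<open>The quadratic is removed and the squared distance to \<open>y0\<close> is added,
    in the form that \<open>superjet_quadratic\<close> expects. The result is minimal at
    \<open>x\<close>, which yields both the relation between \<open>p\<close> and \<open>y0\<close>
    and the lower bound on \<open>X\<close>.\<close>
  let ?f = "\<lambda>x. (w x + \<eta> * (norm (x - z))\<^sup>2) + (- \<eta> * ((norm (x - z))\<^sup>2 - 0) + 0) + (1 / \<epsilon> * ((norm (x - y0))\<^sup>2 - 0) + 0)"
  have f: "?f x' = w x' + (norm (x' - y0))\<^sup>2 / \<epsilon>" for x' by simp
  have sf: "superjet ?f x (p + (2 * - \<eta>) *\<^sub>R (x - z) + (2 * (1 / \<epsilon>)) *\<^sub>R (x - y0))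
      (X + (2 * - \<eta>) *\<^sub>R mat 1 + (2 * (1 / \<epsilon>)) *\<^sub>R mat 1)"
    by (rule superjet_add[OF superjet_add[OF sj superjet_quadratic] superjet_quadratic])
  have mn: "?f x \<le> ?f x'" for x'
    using upper[of y0 x'] y0 unfolding f by simp
  have "norm (p + (2 * - \<eta>) *\<^sub>R (x - z) + (2 * (1 / \<epsilon>)) *\<^sub>R (x - y0)) \<le> 0"
    by (rule superjet_gradient_bound[OF sf zero_less_one]) (use mn in auto)
  then have "p + (2 * - \<eta>) *\<^sub>R (x - z) + (2 * (1 / \<epsilon>)) *\<^sub>R (x - y0) = 0" by simp
  then have "py + (2 / \<epsilon>) *\<^sub>R (x - y0) = 0" by (simp add: py_def)
  then have py: "py = (2 / \<epsilon>) *\<^sub>R (y0 - x)" by (simp add: algebra_simps add_eq_0_iff)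
  have q0: "0 \<le> qform (X + (2 * - \<eta>) *\<^sub>R mat 1 + (2 * (1 / \<epsilon>)) *\<^sub>R mat 1) v" for v
    by (rule superjet_local_min[OF sf zero_less_one]) (rule mn)
  show "\<forall>v. - (2 / \<epsilon>) * (norm v)\<^sup>2 \<le> qform X v"
  proof
    fix v
    have "0 \<le> qform X v - 2 * \<eta> * (norm v)\<^sup>2 + 2 / \<epsilon> * (norm v)\<^sup>2" using q0[of v, unfolded qform_add qform_mat] by simp
    moreover have "0 \<le> 2 * \<eta> * (norm v)\<^sup>2" using \<eta> by simp
    ultimately show "- (2 / \<epsilon>) * (norm v)\<^sup>2 \<le> qform X v" by linarith
  qed
  have nxy: "norm (y0 - x) \<le> 2 * R'"
    using norm_triangle_ineq4[of "y0 - z" "x - z"] y0(1) x by simp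
  have npy: "norm py \<le> P"
  proof -
    have "norm py \<le> 2 / \<epsilon> * (2 * R')" unfolding py norm_scaleR using nxy \<epsilon> by (intro mult_mono) auto
    then show ?thesis using P(2) by simp
  qed
  have npp: "norm (py - p) \<le> 2 * \<eta> * R'"
    unfolding py_def using x \<eta> by (simp add: mult_left_mono)
  \<comment> \<open>The linear isometry from the metric of \<open>py\<close> to the metric of
    \<open>p\<close>.\<close>
  define T where "T = (\<lambda>d. Gi p (Gp py d))"
  have lT: "linear T" unfolding T_def by (rule linear_compose[OF linear_Gp linear_Gi, unfolded o_def])
  have lT': "linear (\<lambda>d. Gp py (Gi p d))" by (rule linear_compose[OF linear_Gi linear_Gp, unfolded o_def])
  have adj: "Gp py (Gi p a) \<bullet> b = a \<bullet> T b" for a b by (simp add: T_def Gp_adjoint Gi_adjoint)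
  let ?X = "X - \<eta> *\<^sub>R mat 1"
  have qX: "qform ?X v = qform X v - \<eta> * (norm v)\<^sup>2" for v
    using qform_add[of X "(- \<eta>) *\<^sub>R mat 1" v] qform_mat[of "- \<eta>" v] by simp
  have "transpose ?X = ?X"
    using transpose_add[of X "(- \<eta>) *\<^sub>R mat 1", unfolded transpose_scaleR transpose_mat X] by simp
  then obtain Z where Z: "transpose Z = Z" "\<And>v. qform Z v = qform ?X (T v)"
    using conj_form[OF _ lT lT' adj] by blast
  define A where "A = (P\<^sup>2 + P) * (1 + P) * (2 * R')"
  \<comment> \<open>The gradients differ only by the derivative of the added quadratic, so
    \<open>T d - d\<close> is of size \<open>\<eta>\<close>. Its square over
    \<open>\<epsilon>\<close> is of order \<open>\<eta>\<^sup>2 / \<epsilon>\<close>, and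
    \<open>small\<close> makes it at most half of the gain.\<close>
  have Td: "(norm (T d - d))\<^sup>2 / \<epsilon> \<le> \<eta> / 2 * (norm (T d))\<^sup>2" for d
  proof -
    have "norm d \<le> norm (Gp p (T d))" using norm_Gp_ge[of d py] by (simp add: T_def)
    also have "\<dots> \<le> vslope p * norm (T d)" by (rule norm_Gp_le)
    also have "\<dots> \<le> (1 + P) * norm (T d)"
    proof (rule mult_right_mono)
      have "vslope p \<le> 1 + norm p" unfolding vslope_def
        by (rule real_le_lsqrt) (auto simp: power2_eq_square algebra_simps)
      then show "vslope p \<le> 1 + P" using P(1) by simp
    qed simp
    finally have d: "norm d \<le> (1 + P) * norm (T d)" .
    have "T d - d = Gi p (Gp py d - Gp p d)" using linear_diff[OF linear_Gi, of p "Gp py d" "Gp p d"] by (simp add: T_def)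
    then have "norm (T d - d) \<le> norm (Gp py d - Gp p d)" using norm_Gi_le by metis
    also have "\<dots> \<le> (P\<^sup>2 + P) * norm (py - p) * norm d" by (rule Gp_lipschitz[OF npy P(1)])
    also have "\<dots> \<le> (P\<^sup>2 + P) * (2 * \<eta> * R') * ((1 + P) * norm (T d))"
      using npp d P0 by (intro mult_mono mult_nonneg_nonneg order_trans[OF norm_ge_zero npp]) auto
    also have "\<dots> = \<eta> * A * norm (T d)" by (simp add: A_def)
    finally have "(norm (T d - d))\<^sup>2 \<le> (\<eta> * A * norm (T d))\<^sup>2" by (rule power_mono) simp
    also have "\<dots> = \<eta> * (norm (T d))\<^sup>2 * (\<eta> * A\<^sup>2)" by (simp add: power2_eq_square)
    also have "\<dots> \<le> \<eta> * (norm (T d))\<^sup>2 * (\<epsilon> / 2)"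
      using small \<eta> by (intro mult_left_mono) (auto simp: A_def)
    finally show ?thesis using \<epsilon> by (simp add: divide_le_eq)
  qed
  have "adm k py Z"
  proof (rule SH_superjet[OF u \<Omega>(1) _ y0(2) Z(1)])
    show "y0 \<in> \<Omega>" using \<Omega>(2) y0(1) by (auto simp: dist_norm norm_minus_commute subset_iff)
    fix e :: real assume e: "e > 0"
    let ?e = "e / (vslope py)\<^sup>2"
    have "?e > 0" using e by simp
    then obtain \<delta> where \<delta>: "\<delta> > 0" "\<And>x'. norm (x' - x) < \<delta> \<Longrightarrow> w x' + \<eta> * (norm (x' - z))\<^sup>2 \<le>
        w x + \<eta> * (norm (x - z))\<^sup>2 + p \<bullet> (x' - x) + qform X (x' - x) / 2 + ?e * (norm (x' - x))\<^sup>2"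
      using sj unfolding superjet_def by meson
    define \<delta>' where "\<delta>' = min (R' - norm (y0 - z)) (\<delta> / vslope py)"
    have "\<delta>' > 0" using \<delta> y0(1) by (simp add: \<delta>'_def)
    moreover have "u y \<le> ereal (?b + py \<bullet> (y - y0) + qform Z (y - y0) / 2 + e * (norm (y - y0))\<^sup>2)"
      if y: "norm (y - y0) < \<delta>'" for y
    proof -
      define d where "d = y - y0"
      let ?x' = "x + T d"
      have "norm (y - z) \<le> norm (y - y0) + norm (y0 - z)" using norm_triangle_ineq[of "y - y0" "y0 - z"] by simp
      then have yz: "norm (y - z) \<le> R'" using y by (simp add: \<delta>'_def)
      have nT: "norm (T d) \<le> vslope py * norm d"
        using norm_Gi_le[of p "Gp py d"] norm_Gp_le[of py d] by (simp add: T_def)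
      have "vslope py * norm d < \<delta>" using y by (simp add: \<delta>'_def d_def pos_less_divide_eq mult.commute)
      then have "w ?x' + \<eta> * (norm (?x' - z))\<^sup>2 \<le>
        w x + \<eta> * (norm (x - z))\<^sup>2 + p \<bullet> T d + qform X (T d) / 2 + ?e * (norm (T d))\<^sup>2"
        using \<delta>(2)[of ?x'] nT by simp
      moreover have "\<eta> * (norm (?x' - z))\<^sup>2 = \<eta> * (norm (x - z))\<^sup>2 + (2 * \<eta>) * ((x - z) \<bullet> T d) + \<eta> * (norm (T d))\<^sup>2"
      proof -
        have "?x' - z = (x - z) + T d" by simp
        then show ?thesis by (simp only: norm_add_sq) (simp add: algebra_simps)
      qed
      moreover have "(norm (?x' - y))\<^sup>2 / \<epsilon> = (norm (x - y0))\<^sup>2 / \<epsilon> - py \<bullet> (T d - d) + (norm (T d - d))\<^sup>2 / \<epsilon>"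
      proof -
        have "?x' - y = (x - y0) + (T d - d)" by (simp add: d_def)
        then have "(norm (?x' - y))\<^sup>2 / \<epsilon> = (norm (x - y0))\<^sup>2 / \<epsilon> + 2 / \<epsilon> * ((x - y0) \<bullet> (T d - d)) + (norm (T d - d))\<^sup>2 / \<epsilon>"
          by (simp only: norm_add_sq) (simp add: add_divide_distrib)
        moreover have "py \<bullet> (T d - d) = - (2 / \<epsilon> * ((x - y0) \<bullet> (T d - d)))"
          unfolding py inner_scaleR_left by (simp add: inner_diff_left minus_divide_left algebra_simps)
        ultimately show ?thesis by simp
      qed
      moreover have "py \<bullet> T d = p \<bullet> T d - (2 * \<eta>) * ((x - z) \<bullet> T d)" by (simp add: py_def inner_diff_left)
      moreover have "?e * (norm (T d))\<^sup>2 \<le> e * (norm d)\<^sup>2"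
      proof -
        have "(norm (T d))\<^sup>2 \<le> (vslope py * norm d)\<^sup>2" using nT by (rule power_mono) simp
        then have "?e * (norm (T d))\<^sup>2 \<le> ?e * (vslope py * norm d)\<^sup>2" using \<open>?e > 0\<close> by (intro mult_left_mono) auto
        then show ?thesis by (simp add: power_mult_distrib)
      qed
      moreover note Td[of d]
      ultimately have "w ?x' + (norm (?x' - y))\<^sup>2 / \<epsilon> \<le> ?b + py \<bullet> d + (qform X (T d) - \<eta> * (norm (T d))\<^sup>2) / 2 + e * (norm d)\<^sup>2"
        unfolding inner_diff_right by argo
      then show ?thesis using upper[OF yz, of ?x'] unfolding d_def[symmetric] Z(2) qX by (meson ereal_less_eq(3) order_trans)
    qed
    ultimately show "\<exists>\<delta>>0. \<forall>y. norm (y - y0) < \<delta> \<longrightarrow> u y \<le> ereal (?b + py \<bullet> (y - y0) + qform Z (y - y0) / 2 + e * (norm (y - y0))\<^sup>2)"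
      by blast
  qed
  \<comment> \<open>\<open>T\<close> takes \<open>Gi py v\<close> to \<open>Gi p v\<close>, so the
    polar inequalities for \<open>Z\<close> at \<open>py\<close> are literally those for
    \<open>?X\<close> at \<open>p\<close>.\<close>
  then show "adm k p ?X" unfolding adm_def Z(2) T_def Gp_Gi .
qed

section \<open>Choice of the parameters and conclusion\<close>

lemma cball_subset_enlarge:
  fixes z :: "'a::euclidean_space"
  assumes "open \<Omega>" "cball z R \<subseteq> \<Omega>" "R > 0"
  shows "\<exists>R'>R. cball z R' \<subseteq> \<Omega>"
proof -
  obtain e where e: "e > 0" "(\<Union>x\<in>cball z R. ball x e) \<subseteq> \<Omega>"
    using compact_subset_open_imp_ball_epsilon_subset[OF compact_cball assms(1,2)] by blast
  have "y \<in> \<Omega>" if y: "norm (y - z) \<le> R + e / 2" for y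
  proof (cases "norm (y - z) \<le> R")
    case True
    then show ?thesis using assms(2) by (auto simp: dist_norm norm_minus_commute subset_iff)
  next
    case False
    let ?t = "R / norm (y - z)"
    let ?x = "z + ?t *\<^sub>R (y - z)"
    have n: "norm (y - z) > 0" using False assms(3) by linarith
    have "norm (?x - z) = R" using n assms(3) by simp
    then have xz: "?x \<in> cball z R" by (simp add: dist_norm norm_minus_commute)
    have "y - ?x = (1 - ?t) *\<^sub>R (y - z)" by (simp add: algebra_simps)
    then have "norm (y - ?x) = \<bar>1 - ?t\<bar> * norm (y - z)" by (simp only: norm_scaleR)
    also have "\<dots> = norm (y - z) - R" using n False assms(3) by (simp add: abs_of_nonneg field_simps)
    finally have "y \<in> ball ?x e" using y e(1) by (simp add: dist_norm norm_minus_commute)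
    then show ?thesis using xz e(2) by blast
  qed
  then have "cball z (R + e / 2) \<subseteq> \<Omega>" by (auto simp: dist_norm norm_minus_commute)
  then show ?thesis using e(1) by (intro exI[of _ "R + e / 2"]) auto
qed

text \<open>\<open>u\<close> need not be bounded below, but every small ball contains points of
  finite value because the exceptional set is negligible. A finite cover makes the bound uniform; it
  is what keeps the maximisers of the sup-convolution near \<open>x\<close>.\<close>

lemma lower_bound_on_net:
  fixes u :: "real^'n::finite \<Rightarrow> ereal"
  assumes neg: "negligible {x\<in>\<Omega>. u x = -\<infinity>}" and R: "R > 0" "cball z R \<subseteq> \<Omega>" and \<delta>: "\<delta> > 0"
  shows "\<exists>m. \<forall>x\<in>cball z R. \<exists>y\<in>cball z R. norm (x - y) \<le> \<delta> \<and> ereal m \<le> u y"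
proof -
  have fin: "\<exists>y\<in>cball z R. \<exists>c. norm (x - y) \<le> \<delta> / 2 \<and> ereal c \<le> u y" if x: "x \<in> cball z R" for x
  proof -
    have "x \<in> closure (ball z R)" using x R(1) by simp
    moreover have "0 < \<delta> / 2" using \<delta> by simp
    ultimately obtain y' where "y' \<in> ball z R" "dist y' x < \<delta> / 2" unfolding closure_approachable by blast
    then have "y' \<in> ball x (\<delta> / 2) \<inter> ball z R" by (simp add: dist_commute)
    then have "ball x (\<delta> / 2) \<inter> ball z R \<noteq> {}" by blast
    then have "\<not> negligible (ball x (\<delta> / 2) \<inter> ball z R)" by (intro open_not_negligible) auto
    then have "\<not> ball x (\<delta> / 2) \<inter> ball z R \<subseteq> {x\<in>\<Omega>. u x = -\<infinity>}" using neg negligible_subset by blast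
    then obtain y where y: "y \<in> ball x (\<delta> / 2)" "y \<in> ball z R" "u y \<noteq> -\<infinity>" using R(2) by (auto simp: subset_iff)
    have "\<exists>c. ereal c \<le> u y"
    proof (cases "u y")
      case (real c)
      then show ?thesis by auto
    qed (use y in auto)
    then show ?thesis using y by (auto simp: dist_norm intro!: bexI[of _ y])
  qed
  then obtain Y C where YC: "\<And>x. x \<in> cball z R \<Longrightarrow> Y x \<in> cball z R \<and> norm (x - Y x) \<le> \<delta> / 2 \<and> ereal (C x) \<le> u (Y x)"
    by metis
  obtain F where F: "F \<subseteq> cball z R" "finite F" "cball z R \<subseteq> (\<Union>x\<in>F. ball x (\<delta> / 2))"
    by (rule compactE_image[OF compact_cball, of "cball z R" "\<lambda>x. ball x (\<delta> / 2)"]) (use \<delta> in auto)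
  have "\<exists>y\<in>cball z R. norm (x - y) \<le> \<delta> \<and> ereal (Min (C ` F)) \<le> u y" if x: "x \<in> cball z R" for x
  proof -
    obtain f where f: "f \<in> F" "x \<in> ball f (\<delta> / 2)" using F(3) x by blast
    have "norm (x - Y f) \<le> norm (x - f) + norm (f - Y f)" using norm_triangle_ineq[of "x - f" "f - Y f"] by simp
    also have "\<dots> \<le> \<delta>" using f YC[of f] F(1) by (auto simp: dist_norm norm_minus_commute)
    finally have "norm (x - Y f) \<le> \<delta>" .
    moreover have "ereal (Min (C ` F)) \<le> ereal (C f)" using f F(2) by simp
    then have "ereal (Min (C ` F)) \<le> u (Y f)" using YC[of f] f F(1) order_trans by blast
    ultimately show ?thesis using YC[of f] f F(1) by blast
  qed
  then show ?thesis by blast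
qed

text \<open>The bound from above is at a nearby point \<open>y\<close>, since the sup-convolution
  picks up values of \<open>u\<close> around \<open>x\<close> and \<open>u\<close> is only upper
  semicontinuous.\<close>

lemma smooth_approximation_step:
  fixes u :: "real^'n::finite \<Rightarrow> ereal"
  assumes k: "1 \<le> k" "k \<le> CARD('n)" and u: "u \<in> SH k \<Omega>" and \<Omega>: "open \<Omega>" "cball z R' \<subseteq> \<Omega>"
    and R: "0 < R" "R < R'" and \<delta>: "\<delta> > 0"
  shows "\<exists>v. smooth_on (ball z R) v \<and> (\<forall>x\<in>ball z R. (\<forall>j\<le>k. 0 \<le> H_curv j v x) \<and>
    u x \<le> ereal (v x + 2 * \<delta>) \<and> (\<exists>y\<in>cball z R'. norm (x - y) \<le> 2 * \<delta> \<and> ereal (v x - 2 * \<delta>) \<le> u y))"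
proof -
  let ?D = "cball z R'"
  have SH: "\<And>x. x \<in> \<Omega> \<Longrightarrow> u x \<noteq> \<infinity>" "usc_on \<Omega> u" "negligible {x\<in>\<Omega>. u x = -\<infinity>}" using u by (auto simp: SH_def)
  have R': "R' > 0" using R by simp
  define R1 where "R1 = (R + R') / 2"
  have R1: "R < R1" "R1 < R'" using R by (auto simp: R1_def)
  \<comment> \<open>Maximisers will be within \<open>2 * d\<close> of \<open>x\<close>; the second
    bound keeps them in the open ball of radius \<open>R'\<close> for \<open>x\<close> in the ball
    of radius \<open>R1\<close>.\<close>
  define d where "d = min \<delta> ((R' - R1) / 4)"
  have d: "d > 0" "d \<le> \<delta>" "d \<le> (R' - R1) / 4" using \<delta> R1 unfolding d_def by (simp, intro min.cobounded1, intro min.cobounded2)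
  obtain m where m: "\<And>x. x \<in> ?D \<Longrightarrow> \<exists>y\<in>?D. norm (x - y) \<le> d \<and> ereal m \<le> u y"
    using lower_bound_on_net[OF SH(3) R' \<Omega>(2) d(1)] by blast
  have "\<exists>U. True \<and> (\<forall>y\<in>?D. u y \<le> ereal (U + 0))"
  proof (rule usc_finite_cover[OF SH(2) compact_cball \<Omega>(2) _ continuous_on_const])
    show "?D \<noteq> {}" using R' by simp
    fix y assume "y \<in> ?D"
    then have "u y < \<infinity>" using SH(1) \<Omega>(2) by auto
    then obtain c where "u y < ereal c" using ereal_dense2 by blast
    then show "\<exists>c. True \<and> u y < ereal (c + 0)" by auto
  qed
  then obtain U where "\<forall>y\<in>?D. u y \<le> ereal (U + 0)" by blast
  then have U: "u y \<le> ereal U" if "y \<in> ?D" for y using that by (metis add.right_neutral)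
  \<comment> \<open>\<open>U - m\<close> bounds the possible gain of a distant point over a point of
    the net, so this penalty confines maximisers to distance \<open>2 * d\<close>.\<close>
  define \<epsilon> where "\<epsilon> = d\<^sup>2 / (\<bar>U - m\<bar> + 1)"
  have \<epsilon>: "\<epsilon> > 0" using d by (simp add: \<epsilon>_def)
  have \<epsilon>U: "\<epsilon> * (U - m) \<le> d\<^sup>2"
  proof -
    have "\<epsilon> * (U - m) \<le> \<epsilon> * (\<bar>U - m\<bar> + 1)" using \<epsilon> by (intro mult_left_mono) auto
    also have "\<dots> = d\<^sup>2" by (simp add: \<epsilon>_def)
    finally show ?thesis .
  qed
  have "z \<in> ?D" using R' by simp
  then obtain y1 where "y1 \<in> ?D" "ereal m \<le> u y1" using m by blast
  then have y1: "y1 \<in> ?D" "u y1 \<noteq> -\<infinity>" by auto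
  obtain w where w: "supconv u ?D \<epsilon> w"
    using supconv_exists[OF SH(2) compact_cball \<Omega>(2) SH(1) y1] by blast
  have loc: "\<exists>y0\<in>?D. norm (x - y0) \<le> 2 * d \<and> u y0 = ereal (w x + (norm (x - y0))\<^sup>2 / \<epsilon>)" if x: "x \<in> ?D" for x
  proof -
    obtain y0 where y0: "y0 \<in> ?D" "u y0 = ereal (w x + (norm (x - y0))\<^sup>2 / \<epsilon>)" using w unfolding supconv_def by blast
    obtain y where y: "y \<in> ?D" "norm (x - y) \<le> d" "ereal m \<le> u y" using m[OF x] by blast
    have "u y \<le> ereal (w x + (norm (x - y))\<^sup>2 / \<epsilon>)" using w y(1) unfolding supconv_def by blast
    then have "m \<le> w x + (norm (x - y))\<^sup>2 / \<epsilon>" using y(3) by (meson ereal_less_eq(3) order_trans)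
    moreover have "(norm (x - y))\<^sup>2 / \<epsilon> \<le> d\<^sup>2 / \<epsilon>" using y(2) \<epsilon> by (intro divide_right_mono power_mono) auto
    moreover have "w x + (norm (x - y0))\<^sup>2 / \<epsilon> \<le> U" using U[OF y0(1)] y0(2) by simp
    ultimately have "(norm (x - y0))\<^sup>2 / \<epsilon> \<le> (U - m) + d\<^sup>2 / \<epsilon>" by linarith
    then have "(norm (x - y0))\<^sup>2 \<le> \<epsilon> * (U - m) + d\<^sup>2" using \<epsilon> by (simp add: field_simps)
    also have "\<dots> \<le> (2 * d)\<^sup>2" using \<epsilon>U by (simp add: power_mult_distrib) (use zero_le_power2[of d] in linarith)
    finally have "norm (x - y0) \<le> 2 * d" by (rule power2_le_imp_le) (use d in simp)
    then show ?thesis using y0 by blast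
  qed
  \<comment> \<open>The Lipschitz constant of the sup-convolution plus that of the added quadratic.
    The bound \<open>\<eta> \<le> 1\<close> keeps \<open>P\<close> independent of
    \<open>\<eta>\<close>, which is chosen later in terms of \<open>P\<close>.\<close>
  define P where "P = 4 * R' / \<epsilon> + 2 * R'"
  define A where "A = (P\<^sup>2 + P) * (1 + P) * (2 * R')"
  \<comment> \<open>The three bounds serve the Lipschitz constant \<open>P\<close>, the smallness
    condition of \<open>supconv_superjet\<close>, and an error of at most \<open>\<delta>\<close>
    from the added quadratic.\<close>
  define \<eta> where "\<eta> = min 1 (min (\<epsilon> / (2 * (A\<^sup>2 + 1))) (\<delta> / (R'\<^sup>2 + 1)))"
  have P: "0 \<le> P" "4 * R' / \<epsilon> \<le> P" using R' \<epsilon> by (auto simp: P_def)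
  have A1: "A\<^sup>2 + 1 > 0" "R'\<^sup>2 + 1 > 0" by (auto intro: add_nonneg_pos)
  have \<eta>: "\<eta> > 0" "\<eta> \<le> 1" "\<eta> \<le> \<epsilon> / (2 * (A\<^sup>2 + 1))" "\<eta> \<le> \<delta> / (R'\<^sup>2 + 1)"
    unfolding \<eta>_def using \<epsilon> \<delta> A1 by auto
  have \<eta>A: "2 * \<eta> * A\<^sup>2 \<le> \<epsilon>"
  proof -
    have "2 * \<eta> * A\<^sup>2 \<le> \<eta> * (2 * (A\<^sup>2 + 1))" using \<eta>(1) by (simp add: algebra_simps)
    also have "\<dots> \<le> \<epsilon>" using \<eta>(3) A1 by (simp add: pos_le_divide_eq)
    finally show ?thesis .
  qed
  have \<eta>R: "\<eta> * R'\<^sup>2 \<le> \<delta>"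
  proof -
    have "\<eta> * R'\<^sup>2 \<le> \<eta> * (R'\<^sup>2 + 1)" using \<eta>(1) by simp
    also have "\<dots> \<le> \<delta>" using \<eta>(4) A1 by (simp add: pos_le_divide_eq)
    finally show ?thesis .
  qed
  let ?W = "\<lambda>x. w x + \<eta> * (norm (x - z))\<^sup>2"
  have cW: "continuous_on UNIV ?W"
    by (intro continuous_on_add supconv_continuous[OF w \<epsilon>] continuous_on_mult continuous_on_const continuous_on_power
        continuous_on_norm continuous_on_diff continuous_on_id)
  have lip: "\<bar>?W x - ?W y\<bar> \<le> P * norm (x - y)" if xy: "x \<in> ball z R1" "y \<in> ball z R1" for x y
  proof -
    have n: "norm (x - z) \<le> R'" "norm (y - z) \<le> R'" using xy R1 by (auto simp: dist_norm norm_minus_commute)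
    have "\<bar>w x - w y\<bar> \<le> norm (x - y) * (norm (x - z) + norm (y - z) + 2 * R') / \<epsilon>" by (rule supconv_lipschitz[OF w \<epsilon>])
    also have "\<dots> \<le> norm (x - y) * (4 * R') / \<epsilon>" using n \<epsilon> by (intro divide_right_mono mult_left_mono) auto
    finally have a: "\<bar>w x - w y\<bar> \<le> 4 * R' / \<epsilon> * norm (x - y)" by (simp add: mult.commute)
    have "\<bar>(norm (x - z))\<^sup>2 - (norm (y - z))\<^sup>2\<bar> = \<bar>norm (x - z) - norm (y - z)\<bar> * \<bar>norm (x - z) + norm (y - z)\<bar>"
      by (simp only: abs_mult[symmetric] power2_eq_square square_diff_square_factored mult.commute)
    also have "\<dots> \<le> norm (x - y) * (2 * R')"
      using norm_triangle_ineq3[of "x - z" "y - z"] n by (intro mult_mono) auto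
    finally have "\<eta> * \<bar>(norm (x - z))\<^sup>2 - (norm (y - z))\<^sup>2\<bar> \<le> 1 * (norm (x - y) * (2 * R'))"
      using \<eta> R' by (intro mult_mono) auto
    then have b: "\<bar>\<eta> * (norm (x - z))\<^sup>2 - \<eta> * (norm (y - z))\<^sup>2\<bar> \<le> 2 * R' * norm (x - y)"
      using \<eta>(1) by (simp add: right_diff_distrib[symmetric] abs_mult mult.commute mult.left_commute)
    have "P * norm (x - y) = 4 * R' / \<epsilon> * norm (x - y) + 2 * R' * norm (x - y)" by (simp add: P_def distrib_right)
    then show ?thesis using a b by linarith
  qed
  have sub: "(\<forall>v. - (2 / \<epsilon>) * (norm v)\<^sup>2 \<le> qform X v) \<and> adm k p (X - \<eta> *\<^sub>R mat 1)"
    if x: "x \<in> ball z R1" and X: "transpose X = X" and sj: "superjet ?W x p X" for x p X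
  proof -
    have nx: "norm (x - z) < R1" using x by (simp add: dist_norm norm_minus_commute)
    then obtain y0 where y0: "norm (x - y0) \<le> 2 * d" "u y0 = ereal (w x + (norm (x - y0))\<^sup>2 / \<epsilon>)"
      using loc[of x] R1 by (auto simp: dist_norm norm_minus_commute)
    have y0z: "norm (y0 - z) < R'"
      using norm_triangle_ineq[of "y0 - x" "x - z"] nx y0(1) d(3) R1 by (simp add: norm_minus_commute)
    have p: "norm p \<le> P"
    proof (rule superjet_gradient_bound[OF sj _ _ P(1)])
      show "0 < R1 - norm (x - z)" using nx by simp
      fix y assume "norm (y - x) < R1 - norm (x - z)"
      then have "norm (y - z) < R1" using norm_triangle_ineq[of "y - x" "x - z"] by simp
      then have "\<bar>?W x - ?W y\<bar> \<le> P * norm (x - y)" using lip[OF x, of y] by (simp add: dist_norm norm_minus_commute)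
      then show "?W x - P * norm (y - x) \<le> ?W y" unfolding norm_minus_commute[of y x] by linarith
    qed
    show ?thesis
      by (rule supconv_superjet[OF u \<Omega> \<epsilon> \<eta>(1) w y0z y0(2) _ sj X p P(2)]) (use nx R1 \<eta>A in \<open>auto simp: A_def\<close>)
  qed
  have "\<exists>v. smooth_on (ball z R) v \<and> (\<forall>x\<in>ball z R. (\<forall>j\<le>k. 0 \<le> H_curv j v x) \<and> \<bar>v x - ?W x\<bar> \<le> \<delta>)"
  proof (rule hopf_cole_regularisation[where K = "2 / \<epsilon>", OF k cW R1(1) P(1) _ \<eta>(1) _ _ \<delta>])
    show "2 / \<epsilon> \<ge> 0" using \<epsilon> by simp
  qed (use lip sub in blast)+
  then obtain v where v: "smooth_on (ball z R) v" "\<And>x. x \<in> ball z R \<Longrightarrow> (\<forall>j\<le>k. 0 \<le> H_curv j v x) \<and> \<bar>v x - ?W x\<bar> \<le> \<delta>"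
    by blast
  show ?thesis
  proof (intro exI[of _ v] conjI ballI v(1))
    fix x assume x: "x \<in> ball z R"
    then have n: "norm (x - z) \<le> R'" using R by (simp add: dist_norm norm_minus_commute)
    have xD: "x \<in> ?D" using x R by simp
    show "\<forall>j\<le>k. 0 \<le> H_curv j v x" using v(2)[OF x] by blast
    have "\<eta> * (norm (x - z))\<^sup>2 \<le> \<eta> * R'\<^sup>2" using n \<eta>(1) by (intro mult_left_mono power_mono) auto
    moreover have "0 \<le> \<eta> * (norm (x - z))\<^sup>2" using \<eta>(1) by simp
    ultimately have vw: "\<bar>v x - w x\<bar> \<le> 2 * \<delta>" using v(2)[OF x] \<eta>R by linarith
    have "u x \<le> ereal (w x + (norm (x - x))\<^sup>2 / \<epsilon>)" using w xD unfolding supconv_def by blast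
    also have "\<dots> \<le> ereal (v x + 2 * \<delta>)" using vw by simp
    finally show "u x \<le> ereal (v x + 2 * \<delta>)" .
    obtain y0 where y0: "y0 \<in> ?D" "norm (x - y0) \<le> 2 * d" "u y0 = ereal (w x + (norm (x - y0))\<^sup>2 / \<epsilon>)"
      using loc[OF xD] by blast
    have "0 \<le> (norm (x - y0))\<^sup>2 / \<epsilon>" using \<epsilon> by simp
    then have "ereal (v x - 2 * \<delta>) \<le> u y0" unfolding y0(3) ereal_less_eq(3) using vw by linarith
    then show "\<exists>y\<in>?D. norm (x - y) \<le> 2 * \<delta> \<and> ereal (v x - 2 * \<delta>) \<le> u y" using y0(1,2) d(2) by (intro bexI[of _ y0]) auto
  qed
qed

text \<open>The approximants are bounded below by \<open>u x\<close> and above by values of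
  \<open>u\<close> at points tending to \<open>x\<close>, both up to errors tending to 0. Upper
  semicontinuity turns the second bound into one by \<open>u x\<close>, including the case
  \<open>u x = -\<infinity>\<close>.\<close>

theorem theorem4p1:
  fixes \<Omega> :: "(real^'n::finite) set" and u :: "real^'n \<Rightarrow> ereal"
    and k :: nat and z :: "real^'n" and R :: real
  assumes "1 < k" and "k < CARD('n)"
    and "open \<Omega>" and "connected \<Omega>" and "\<Omega> \<noteq> {}" and "bounded \<Omega>"
    and "u \<in> SH k \<Omega>"
    and "R > 0" and "cball z R \<subseteq> \<Omega>"
  shows "\<exists>v :: nat \<Rightarrow> real^'n \<Rightarrow> real.
           (\<forall>j. Cinf_on (v j) (ball z R) \<and> C2_H_subharmonic k (v j) (ball z R)) \<and>
           (\<forall>x\<in>ball z R. (\<lambda>j. ereal (v j x)) \<longlonglongrightarrow> u x)"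
proof -
  obtain R' where R': "R < R'" "cball z R' \<subseteq> \<Omega>" using cball_subset_enlarge[OF assms(3,9,8)] by blast
  let ?d = "\<lambda>j. inverse (real (Suc j))"
  have "\<exists>v. smooth_on (ball z R) v \<and> (\<forall>x\<in>ball z R. (\<forall>i\<le>k. 0 \<le> H_curv i v x) \<and>
    u x \<le> ereal (v x + 2 * ?d j) \<and> (\<exists>y\<in>cball z R'. norm (x - y) \<le> 2 * ?d j \<and> ereal (v x - 2 * ?d j) \<le> u y))" for j
    by (rule smooth_approximation_step[OF _ _ assms(7,3) R'(2) assms(8) R'(1)]) (use assms(1,2) in auto)
  then obtain v where v: "\<And>j. smooth_on (ball z R) (v j) \<and> (\<forall>x\<in>ball z R. (\<forall>i\<le>k. 0 \<le> H_curv i (v j) x) \<and>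
    u x \<le> ereal (v j x + 2 * ?d j) \<and> (\<exists>y\<in>cball z R'. norm (x - y) \<le> 2 * ?d j \<and> ereal (v j x - 2 * ?d j) \<le> u y))"
    by metis
  have ev: "\<forall>\<^sub>F j in sequentially. 2 * ?d j < t" if t: "t > 0" for t
  proof -
    have "(\<lambda>j. 2 * ?d j) \<longlonglongrightarrow> 2 * 0" by (intro tendsto_intros LIMSEQ_inverse_real_of_nat)
    then show ?thesis by (rule order_tendstoD(2)) (use t in simp)
  qed
  have "(\<lambda>j. ereal (v j x)) \<longlonglongrightarrow> u x" if x: "x \<in> ball z R" for x
  proof (rule order_tendstoI)
    fix a assume "a < u x"
    then obtain s where s: "a < ereal s" "ereal s < u x" using ereal_dense2 by blast
    obtain t where t: "a < ereal t" "ereal t < ereal s" using ereal_dense2[OF s(1)] by blast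
    have "\<forall>\<^sub>F j in sequentially. 2 * ?d j < s - t" by (rule ev) (use t in simp)
    then show "\<forall>\<^sub>F j in sequentially. a < ereal (v j x)"
    proof eventually_elim
      case (elim j)
      have "ereal s < ereal (v j x + 2 * ?d j)" using s(2) v[of j] x by (meson less_le_trans)
      then have "s < v j x + 2 * ?d j" by (simp only: ereal_less(1) less_ereal.simps)
      then have "t < v j x" using elim by linarith
      then have "ereal t < ereal (v j x)" by simp
      with t(1) show ?case by (rule less_trans)
    qed
  next
    fix a assume "u x < a"
    then obtain t where t: "u x < ereal t" "ereal t < a" using ereal_dense2 by blast
    obtain s where s: "u x < ereal s" "ereal s < ereal t" using ereal_dense2[OF t(1)] by blast
    have "usc_on \<Omega> u" using assms(7) by (simp add: SH_def)
    then have "openin (top_of_set \<Omega>) {y\<in>\<Omega>. u y < ereal s}" unfolding usc_on_def by blast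
    then have "open {y\<in>\<Omega>. u y < ereal s}" using openin_open_eq[OF assms(3)] by blast
    moreover have "x \<in> {y\<in>\<Omega>. u y < ereal s}" using x assms(9) s by auto
    ultimately obtain r where r: "r > 0" "ball x r \<subseteq> {y\<in>\<Omega>. u y < ereal s}" using open_contains_ball by meson
    have "\<forall>\<^sub>F j in sequentially. 2 * ?d j < min r (t - s)" by (rule ev) (use r s in simp)
    then show "\<forall>\<^sub>F j in sequentially. ereal (v j x) < a"
    proof eventually_elim
      case (elim j)
      obtain y where y: "norm (x - y) \<le> 2 * ?d j" "ereal (v j x - 2 * ?d j) \<le> u y" using v[of j] x by blast
      have "y \<in> ball x r" using y(1) elim by (simp add: dist_norm)
      then have "u y < ereal s" using r(2) by blast
      then have "ereal (v j x - 2 * ?d j) < ereal s" using y(2) by (rule le_less_trans[rotated])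
      then have "v j x - 2 * ?d j < s" by (simp only: less_ereal.simps)
      then have "v j x < t" using elim by linarith
      then have "ereal (v j x) < ereal t" by simp
      then show ?case using t(2) by (rule less_trans)
    qed
  qed
  moreover have "Cinf_on (v j) (ball z R) \<and> C2_H_subharmonic k (v j) (ball z R)" for j
    using v[of j] smooth_on_Cinf_on[OF open_ball] smooth_on_Cm_on[OF open_ball] by (auto simp: C2_H_subharmonic_def)
  ultimately show ?thesis by blast
qed

end
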